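(* Let $\Lambda$ be an action operad, let $P$ be a $\Lambda$-operad in $\mathbf{Cat}$ and let $\underline P$ be the induced 2-monad on $\mathbf{Cat}$. Every pseudo-$\underline P$-algebra is equivalent (in the 2-category $\mathbf{Ps}\text{-}\underline P\text{-}\mathbf{Alg}$) to a strict $\underline P$-algebra.
   Context: $\mathbb N\ni 0$; $e_n$ is the identity of $\Lambda(n)$; permutations compose as functions. A (non-symmetric) operad $O$ in sets: sets $O(n)$ ($n\in\mathbb N$), $\mathrm{id}\in O(1)$, functions $\mu:O(n)\times O(k_1)\times\cdots\times O(k_n)\to O(k_1+\cdots+k_n)$, unital and associative in the usual sense; maps preserve $\mathrm{id}$ and $\mu$. The operad $\Sigma$ of symmetric groups has $\mu(\sigma;\tau_1,\dots,\tau_n)=\delta(\sigma)\cdot\beta(\tau_1,\dots,\tau_n)$, with $\beta$ the block sum of the permutations $\tau_i\in\Sigma_{k_i}$ and $\delta(\sigma)=\delta_{n;k_1,\dots,k_n}(\sigma)$ sending $k_1+\cdots+k_{i-1}+a$ ($1\le a\le k_i$) to $(\sum_{\sigma(i')<\sigma(i)}k_{i'})+a$. An action operad $(\Lambda,\pi)$: an operad $\Lambda$ in sets with a group structure on each $\Lambda(n)$ and a map of operads $\pi:\Lambda\to\Sigma$ whose components are group homomorphisms, such that, writing $g(i)=\pi_n(g)(i)$ and $g^{-1}(i)=\pi_n(g)^{-1}(i)$, $\mu(g';f_1',\dots,f_n')\mu(g;f_1,\dots,f_n)=\mu(g'g;f'_{g(1)}f_1,\dots,f'_{g(n)}f_n)$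 for $g,g'\in\Lambda(n)$, $f_i\in\Lambda(k_i)$, $f_i'\in\Lambda(k_{g^{-1}(i)})$. Put $\beta^\Lambda(g_1,\dots,g_n)=\mu(e_n;g_1,\dots,g_n)$ and $\delta^\Lambda_{n;k_1,\dots,k_n}(g)=\mu(g;e_{k_1},\dots,e_{k_n})$. A $\Lambda$-operad $P$ in $\mathbf{Cat}$: small categories $P(n)$, an object $\mathrm{id}\in P(1)$, functors $\mu:P(n)\times P(k_1)\times\cdots\times P(k_n)\to P(k_1+\cdots+k_n)$, strictly unital and associative, with strict right actions of $\Lambda(n)$ on $P(n)$ by functors such that (for objects and morphisms) $\mu(p;q_1\cdot g_1,\dots,q_n\cdot g_n)=\mu(p;q_1,\dots,q_n)\cdot\beta^\Lambda(g_1,\dots,g_n)$ and $\mu(p\cdot g;q_1,\dots,q_n)=\mu(p;q_{g^{-1}(1)},\dots,q_{g^{-1}(n)})\cdot\delta^\Lambda_{n;k_1,\dots,k_n}(g)$. $\underline P$ is the 2-monad $\underline P(X)=\coprod_nP(n)\otimes_{\Lambda(n)}X^n$, where $\Lambda(n)$ acts on $X^n$ by $g\cdot(x_1,\dots,x_n)=(x_{g^{-1}(1)},\dots,x_{g^{-1}(n)})$ and $P(n)\otimes_{\Lambda(n)}X^n$ is the coequalizer in $\mathbf{Cat}$ of $(p,g,\underline x)\mapsto(p\cdot g,\underline x)$ and $(p,g,\underline x)\mapsto(p,g\cdot\underline x)$; unit $x\mapsto[\mathrm{id};x]$; multiplication $[p;[q_1;\underline{x_1}],\dots,[q_n;\underline{x_n}]]\mapsto[\mu(p;q_1,\dots,q_n);\underline{x_1},\dots,\underline{x_n}]$.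 For a 2-monad $(T,\mu,\eta)$: a pseudo-$T$-algebra is $(X,\alpha:TX\to X,\Phi,\Phi_\eta)$ with invertible 2-cells $\Phi:\alpha\circ T\alpha\Rightarrow\alpha\circ\mu_X$, $\Phi_\eta:1_X\Rightarrow\alpha\circ\eta_X$ satisfying $(\Phi*T\mu_X)(\alpha*T\Phi)=(\Phi*\mu_{TX})(\Phi*T^2\alpha)$ and $(\Phi*T\eta_X)(\alpha*T\Phi_\eta)=1_\alpha$; it is strict if $\Phi,\Phi_\eta$ are identities. A pseudomorphism $(X,\alpha,\Phi,\Phi_\eta)\to(Y,\beta,\Psi,\Psi_\eta)$ is $f:X\to Y$ with an invertible $\bar f:\beta\circ Tf\Rightarrow f\circ\alpha$ such that $(\bar f*\mu_X)(\Psi*T^2f)=(f*\Phi)(\bar f*T\alpha)(\beta*T\bar f)$ and $(\bar f*\eta_X)(\Psi_\eta*f)=f*\Phi_\eta$. A $T$-transformation $(f,\bar f)\Rightarrow(g,\bar g)$ is a 2-cell $\gamma:f\Rightarrow g$ with $\bar g\,(\beta*T\gamma)=(\gamma*\alpha)\,\bar f$. These form the 2-category $\mathbf{Ps}\text{-}T\text{-}\mathbf{Alg}$. *)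

theory Defs
  imports "HOL-Algebra.Sym_Groups"
begin

section \<open>Small categories, functors and 2-cells\<close>

text \<open>\<open>Comp C g f\<close> is the composite of \<open>f\<close> followed by \<open>g\<close>.  Values of the structure maps, of functors
  and of transformations outside the carriers are irrelevant, and all equations are
  relativised to the carriers.\<close>

record ('o, 'a) cat =
  Obj :: "'o set"
  Arr :: "'a set"
  Dom :: "'a \<Rightarrow> 'o"
  Cod :: "'a \<Rightarrow> 'o"
  Id :: "'o \<Rightarrow> 'a"
  Comp :: "'a \<Rightarrow> 'a \<Rightarrow> 'a"

locale category =
  fixes C :: "('o, 'a) cat"
  assumes Dom_in: "f \<in> Arr C \<Longrightarrow> Dom C f \<in> Obj C"
    and Cod_in: "f \<in> Arr C \<Longrightarrow> Cod C f \<in> Obj C"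
    and Id_in: "x \<in> Obj C \<Longrightarrow> Id C x \<in> Arr C"
    and Dom_Id: "x \<in> Obj C \<Longrightarrow> Dom C (Id C x) = x"
    and Cod_Id: "x \<in> Obj C \<Longrightarrow> Cod C (Id C x) = x"
    and Comp_in: "\<lbrakk>g \<in> Arr C; f \<in> Arr C; Dom C g = Cod C f\<rbrakk> \<Longrightarrow> Comp C g f \<in> Arr C"
    and Dom_Comp: "\<lbrakk>g \<in> Arr C; f \<in> Arr C; Dom C g = Cod C f\<rbrakk> \<Longrightarrow> Dom C (Comp C g f) = Dom C f"
    and Cod_Comp: "\<lbrakk>g \<in> Arr C; f \<in> Arr C; Dom C g = Cod C f\<rbrakk> \<Longrightarrow> Cod C (Comp C g f) = Cod C g"
    and Comp_Id: "f \<in> Arr C \<Longrightarrow> Comp C f (Id C (Dom C f)) = f"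
    and Id_Comp: "f \<in> Arr C \<Longrightarrow> Comp C (Id C (Cod C f)) f = f"
    and Comp_assoc: "\<lbrakk>h \<in> Arr C; g \<in> Arr C; f \<in> Arr C; Dom C h = Cod C g; Dom C g = Cod C f\<rbrakk>
      \<Longrightarrow> Comp C (Comp C h g) f = Comp C h (Comp C g f)"

record ('o, 'a, 'p, 'b) ftor =
  omap :: "'o \<Rightarrow> 'p"
  amap :: "'a \<Rightarrow> 'b"

definition is_functor :: "('o, 'a) cat \<Rightarrow> ('p, 'b) cat \<Rightarrow> ('o, 'a, 'p, 'b) ftor \<Rightarrow> bool" where
  "is_functor C D F \<longleftrightarrow>
     (\<forall>x\<in>Obj C. omap F x \<in> Obj D) \<and>
     (\<forall>f\<in>Arr C. amap F f \<in> Arr D \<and> Dom D (amap F f) = omap F (Dom C f)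
        \<and> Cod D (amap F f) = omap F (Cod C f)) \<and>
     (\<forall>x\<in>Obj C. amap F (Id C x) = Id D (omap F x)) \<and>
     (\<forall>g\<in>Arr C. \<forall>f\<in>Arr C. Dom C g = Cod C f
        \<longrightarrow> amap F (Comp C g f) = Comp D (amap F g) (amap F f))"

definition ftor_id :: "('o, 'a, 'o, 'a) ftor" where
  "ftor_id = \<lparr>omap = (\<lambda>x. x), amap = (\<lambda>f. f)\<rparr>"

definition ftor_comp ::
  "('p, 'b, 'q, 'c) ftor \<Rightarrow> ('o, 'a, 'p, 'b) ftor \<Rightarrow> ('o, 'a, 'q, 'c) ftor" where
  "ftor_comp G F = \<lparr>omap = (\<lambda>x. omap G (omap F x)), amap = (\<lambda>f. amap G (amap F f))\<rparr>"

definition ftor_eq :: "('o, 'a) cat \<Rightarrow> ('o, 'a, 'p, 'b) ftor \<Rightarrow> ('o, 'a, 'p, 'b) ftor \<Rightarrow> bool" where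
  "ftor_eq C F G \<longleftrightarrow> (\<forall>x\<in>Obj C. omap F x = omap G x) \<and> (\<forall>f\<in>Arr C. amap F f = amap G f)"

text \<open>A natural transformation is given by its components.\<close>

definition is_nat_trans :: "('o, 'a) cat \<Rightarrow> ('p, 'b) cat \<Rightarrow> ('o, 'a, 'p, 'b) ftor
    \<Rightarrow> ('o, 'a, 'p, 'b) ftor \<Rightarrow> ('o \<Rightarrow> 'b) \<Rightarrow> bool" where
  "is_nat_trans C D F G t \<longleftrightarrow>
     (\<forall>x\<in>Obj C. t x \<in> Arr D \<and> Dom D (t x) = omap F x \<and> Cod D (t x) = omap G x) \<and>
     (\<forall>f\<in>Arr C. Comp D (t (Cod C f)) (amap F f) = Comp D (amap G f) (t (Dom C f)))"

definition inverse_cells :: "('o, 'a) cat \<Rightarrow> ('p, 'b) cat \<Rightarrow> ('o, 'a, 'p, 'b) ftor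
    \<Rightarrow> ('o, 'a, 'p, 'b) ftor \<Rightarrow> ('o \<Rightarrow> 'b) \<Rightarrow> ('o \<Rightarrow> 'b) \<Rightarrow> bool" where
  "inverse_cells C D F G t s \<longleftrightarrow>
     (\<forall>x\<in>Obj C. Comp D (s x) (t x) = Id D (omap F x) \<and> Comp D (t x) (s x) = Id D (omap G x))"

definition is_nat_iso :: "('o, 'a) cat \<Rightarrow> ('p, 'b) cat \<Rightarrow> ('o, 'a, 'p, 'b) ftor
    \<Rightarrow> ('o, 'a, 'p, 'b) ftor \<Rightarrow> ('o \<Rightarrow> 'b) \<Rightarrow> bool" where
  "is_nat_iso C D F G t \<longleftrightarrow> is_nat_trans C D F G t \<and>
     (\<exists>s. is_nat_trans C D G F s \<and> inverse_cells C D F G t s)"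

definition is_identity_cell :: "('o, 'a) cat \<Rightarrow> ('p, 'b) cat \<Rightarrow> ('o, 'a, 'p, 'b) ftor
    \<Rightarrow> ('o, 'a, 'p, 'b) ftor \<Rightarrow> ('o \<Rightarrow> 'b) \<Rightarrow> bool" where
  "is_identity_cell C D F G t \<longleftrightarrow> ftor_eq C F G \<and> (\<forall>x\<in>Obj C. t x = Id D (omap F x))"

definition pair_cat :: "('o, 'a) cat \<Rightarrow> ('p, 'b) cat \<Rightarrow> ('o \<times> 'p, 'a \<times> 'b) cat" where
  "pair_cat C D = \<lparr>Obj = Obj C \<times> Obj D, Arr = Arr C \<times> Arr D,
     Dom = (\<lambda>(f, g). (Dom C f, Dom D g)), Cod = (\<lambda>(f, g). (Cod C f, Cod D g)),
     Id = (\<lambda>(x, y). (Id C x, Id D y)),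
     Comp = (\<lambda>(f, g) (f', g'). (Comp C f f', Comp D g g'))\<rparr>"

text \<open>The finite product \<open>C\<^sub>1 \<times> \<dots> \<times> C\<^sub>n\<close>.\<close>

definition list_cat :: "('o, 'a) cat list \<Rightarrow> ('o list, 'a list) cat" where
  "list_cat Cs = \<lparr>Obj = {xs. list_all2 (\<lambda>C x. x \<in> Obj C) Cs xs},
     Arr = {fs. list_all2 (\<lambda>C f. f \<in> Arr C) Cs fs},
     Dom = map2 Dom Cs, Cod = map2 Cod Cs, Id = map2 Id Cs,
     Comp = (\<lambda>gs fs. map (\<lambda>(C, g, f). Comp C g f) (zip Cs (zip gs fs)))\<rparr>"

definition coprod_cat :: "(nat \<Rightarrow> ('o, 'a) cat) \<Rightarrow> (nat \<times> 'o, nat \<times> 'a) cat" where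
  "coprod_cat C = \<lparr>Obj = (SIGMA n:UNIV. Obj (C n)), Arr = (SIGMA n:UNIV. Arr (C n)),
     Dom = (\<lambda>(n, f). (n, Dom (C n) f)), Cod = (\<lambda>(n, f). (n, Cod (C n) f)),
     Id = (\<lambda>(n, x). (n, Id (C n) x)),
     Comp = (\<lambda>(n, g) (m, f). (n, Comp (C n) g f))\<rparr>"

section \<open>Operads in sets\<close>

text \<open>An \<open>n\<close>-tuple is a list of length \<open>n\<close>; its entries are counted from 1, as the permutations in
  \<^const>\<open>sym_group\<close> act on \<open>{1..n}\<close>.\<close>

abbreviation entry :: "'x list \<Rightarrow> nat \<Rightarrow> 'x" where
  "entry xs i \<equiv> xs ! (i - 1)"

text \<open>\<open>reindex s (x\<^sub>1, \<dots>, x\<^sub>n) = (x\<^bsub>s(1)\<^esub>, \<dots>, x\<^bsub>s(n)\<^esub>)\<close>.\<close>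

definition reindex :: "(nat \<Rightarrow> nat) \<Rightarrow> 'x list \<Rightarrow> 'x list" where
  "reindex s xs = map (\<lambda>i. entry xs (s i)) [1..<Suc (length xs)]"

definition tuples :: "(nat \<Rightarrow> 'x set) \<Rightarrow> nat list \<Rightarrow> 'x list set" where
  "tuples A ks = {xs. list_all2 (\<lambda>k x. x \<in> A k) ks xs}"

text \<open>\<open>m ks p qs\<close> is \<open>\<mu>(p; q\<^sub>1, \<dots>, q\<^sub>n)\<close>, where \<open>ks = [k\<^sub>1, \<dots>, k\<^sub>n]\<close> lists the arities of the \<open>q\<^sub>i\<close>.  The
  sets \<open>A n\<close> need not be disjoint, so \<open>m\<close> has to be told the arities.\<close>

locale set_operad =
  fixes A :: "nat \<Rightarrow> 'x set" and u :: 'x and m :: "nat list \<Rightarrow> 'x \<Rightarrow> 'x list \<Rightarrow> 'x"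
  assumes u_in: "u \<in> A 1"
    and m_in: "\<lbrakk>p \<in> A (length ks); qs \<in> tuples A ks\<rbrakk> \<Longrightarrow> m ks p qs \<in> A (sum_list ks)"
    and left_unit: "p \<in> A n \<Longrightarrow> m [n] u [p] = p"
    and right_unit: "p \<in> A n \<Longrightarrow> m (replicate n 1) p (replicate n u) = p"
    and m_assoc: "\<lbrakk>p \<in> A (length lss); qs \<in> tuples A (map length lss);
        list_all2 (\<lambda>ls rs. rs \<in> tuples A ls) lss rss\<rbrakk>
      \<Longrightarrow> m (concat lss) (m (map length lss) p qs) (concat rss)
        = m (map sum_list lss) p (map (\<lambda>(ls, q, rs). m ls q rs) (zip lss (zip qs rss)))"

subsection \<open>The operad of symmetric groups\<close>

text \<open>Every \<open>x \<in> {1..k\<^sub>1 + \<dots> + k\<^sub>n}\<close> is uniquely \<open>k\<^sub>1 + \<dots> + k\<^bsub>i-1\<^esub> + a\<close> with \<open>1 \<le> a \<le> k\<^sub>i\<close>; here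
  \<open>i = block_index ks x\<close> and \<open>a = block_pos ks x\<close>.\<close>

definition block_index :: "nat list \<Rightarrow> nat \<Rightarrow> nat" where
  "block_index ks x = (LEAST i. x \<le> sum_list (take i ks))"

definition block_pos :: "nat list \<Rightarrow> nat \<Rightarrow> nat" where
  "block_pos ks x = x - sum_list (take (block_index ks x - 1) ks)"

definition sym_beta :: "nat list \<Rightarrow> (nat \<Rightarrow> nat) list \<Rightarrow> nat \<Rightarrow> nat" where
  "sym_beta ks ts x = (if x \<in> {1..sum_list ks}
     then sum_list (take (block_index ks x - 1) ks) + entry ts (block_index ks x) (block_pos ks x)
     else x)"

definition sym_delta :: "nat list \<Rightarrow> (nat \<Rightarrow> nat) \<Rightarrow> nat \<Rightarrow> nat" where
  "sym_delta ks s x = (if x \<in> {1..sum_list ks}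
     then (\<Sum>j\<in>{j \<in> {1..length ks}. s j < s (block_index ks x)}. entry ks j) + block_pos ks x
     else x)"

definition sym_mu :: "nat list \<Rightarrow> (nat \<Rightarrow> nat) \<Rightarrow> (nat \<Rightarrow> nat) list \<Rightarrow> nat \<Rightarrow> nat" where
  "sym_mu ks s ts = sym_delta ks s \<circ> sym_beta ks ts"

section \<open>Action operads\<close>

record 'g action_operad_data =
  lgrp :: "nat \<Rightarrow> 'g monoid"
  lid :: 'g
  lmu :: "nat list \<Rightarrow> 'g \<Rightarrow> 'g list \<Rightarrow> 'g"
  lproj :: "nat \<Rightarrow> 'g \<Rightarrow> nat \<Rightarrow> nat"

locale action_operad =
  fixes L :: "'g action_operad_data"
  assumes L_operad: "set_operad (\<lambda>n. carrier (lgrp L n)) (lid L) (lmu L)"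
    and L_group: "group (lgrp L n)"
    and proj_hom: "lproj L n \<in> hom (lgrp L n) (sym_group n)"
    and proj_id: "lproj L 1 (lid L) = id"
    and proj_mu: "\<lbrakk>g \<in> carrier (lgrp L (length ks)); fs \<in> tuples (\<lambda>k. carrier (lgrp L k)) ks\<rbrakk>
      \<Longrightarrow> lproj L (sum_list ks) (lmu L ks g fs)
        = sym_mu ks (lproj L (length ks) g) (map2 (lproj L) ks fs)"
    and mu_mult: "\<lbrakk>g \<in> carrier (lgrp L (length ks)); g' \<in> carrier (lgrp L (length ks));
        fs \<in> tuples (\<lambda>k. carrier (lgrp L k)) ks;
        ks' = reindex (inv' (lproj L (length ks) g)) ks;
        fs' \<in> tuples (\<lambda>k. carrier (lgrp L k)) ks'\<rbrakk>
      \<Longrightarrow> lmu L ks' g' fs' \<otimes>\<^bsub>lgrp L (sum_list ks)\<^esub> lmu L ks g fs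
        = lmu L ks (g' \<otimes>\<^bsub>lgrp L (length ks)\<^esub> g)
            (map (\<lambda>i. entry fs' (lproj L (length ks) g i) \<otimes>\<^bsub>lgrp L (entry ks i)\<^esub> entry fs i)
               [1..<Suc (length ks)])"
begin

definition lbeta :: "nat list \<Rightarrow> 'g list \<Rightarrow> 'g" where
  "lbeta ks gs = lmu L ks \<one>\<^bsub>lgrp L (length ks)\<^esub> gs"

definition ldelta :: "nat list \<Rightarrow> 'g \<Rightarrow> 'g" where
  "ldelta ks g = lmu L ks g (map (\<lambda>k. \<one>\<^bsub>lgrp L k\<^esub>) ks)"

text \<open>\<open>lact n g (x\<^sub>1, \<dots>, x\<^sub>n)\<close> has \<open>i\<close>-th entry \<open>x\<^sub>j\<close> with \<open>j = g\<^sup>-\<^sup>1(i)\<close>.\<close>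

definition lact :: "nat \<Rightarrow> 'g \<Rightarrow> 'x list \<Rightarrow> 'x list" where
  "lact n g xs = reindex (inv' (lproj L n g)) xs"

end

section \<open>Operads in categories with an action of an action operad\<close>

locale lambda_set_operad = action_operad L + set_operad A u m
  for L :: "'g action_operad_data"
    and A :: "nat \<Rightarrow> 'x set" and u :: 'x and m :: "nat list \<Rightarrow> 'x \<Rightarrow> 'x list \<Rightarrow> 'x" +
  fixes act :: "nat \<Rightarrow> 'x \<Rightarrow> 'g \<Rightarrow> 'x"
  assumes act_in: "\<lbrakk>p \<in> A n; g \<in> carrier (lgrp L n)\<rbrakk> \<Longrightarrow> act n p g \<in> A n"
    and act_one: "p \<in> A n \<Longrightarrow> act n p \<one>\<^bsub>lgrp L n\<^esub> = p"
    and act_mult: "\<lbrakk>p \<in> A n; g \<in> carrier (lgrp L n); h \<in> carrier (lgrp L n)\<rbrakk>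
      \<Longrightarrow> act n p (g \<otimes>\<^bsub>lgrp L n\<^esub> h) = act n (act n p g) h"
    and equivar_beta: "\<lbrakk>p \<in> A (length ks); qs \<in> tuples A ks;
        gs \<in> tuples (\<lambda>k. carrier (lgrp L k)) ks\<rbrakk>
      \<Longrightarrow> m ks p (map (\<lambda>(k, q, g). act k q g) (zip ks (zip qs gs)))
        = act (sum_list ks) (m ks p qs) (lbeta ks gs)"
    and equivar_delta: "\<lbrakk>p \<in> A (length ks); qs \<in> tuples A ks; g \<in> carrier (lgrp L (length ks))\<rbrakk>
      \<Longrightarrow> m ks (act (length ks) p g) qs
        = act (sum_list ks) (m (lact (length ks) g ks) p (lact (length ks) g qs)) (ldelta ks g)"

record ('g, 'po, 'pa) cat_operad_data =
  pcat :: "nat \<Rightarrow> ('po, 'pa) cat"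
  pid :: 'po
  pmuO :: "nat list \<Rightarrow> 'po \<Rightarrow> 'po list \<Rightarrow> 'po"
  pmuA :: "nat list \<Rightarrow> 'pa \<Rightarrow> 'pa list \<Rightarrow> 'pa"
  pactO :: "nat \<Rightarrow> 'po \<Rightarrow> 'g \<Rightarrow> 'po"
  pactA :: "nat \<Rightarrow> 'pa \<Rightarrow> 'g \<Rightarrow> 'pa"

text \<open>Two functors are equal iff they agree on objects and on arrows, so the equations of a \<open>\<Lambda>\<close>-operad
  in categories say that its objects and its arrows both form \<open>\<Lambda>\<close>-operads in sets.\<close>

locale lambda_operad = action_operad L
  for L :: "'g action_operad_data" +
  fixes P :: "('g, 'po, 'pa) cat_operad_data"
  assumes P_cat: "category (pcat P n)"
    and P_obj: "lambda_set_operad L (\<lambda>n. Obj (pcat P n)) (pid P) (pmuO P) (pactO P)"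
    and P_arr: "lambda_set_operad L (\<lambda>n. Arr (pcat P n)) (Id (pcat P 1) (pid P)) (pmuA P) (pactA P)"
    and P_mu: "is_functor
        (pair_cat (pcat P (length ks)) (list_cat (map (pcat P) ks))) (pcat P (sum_list ks))
        \<lparr>omap = (\<lambda>(p, qs). pmuO P ks p qs), amap = (\<lambda>(p, qs). pmuA P ks p qs)\<rparr>"
    and P_act: "g \<in> carrier (lgrp L n) \<Longrightarrow> is_functor (pcat P n) (pcat P n)
        \<lparr>omap = (\<lambda>p. pactO P n p g), amap = (\<lambda>p. pactA P n p g)\<rparr>"

section \<open>The induced 2-monad\<close>

text \<open>The types of objects and of arrows of the coproduct of the \<open>P(n) \<otimes>\<^bsub>\<Lambda>(n)\<^esub> X\<^sup>n\<close>: an arity and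
  a class of pairs.\<close>

type_synonym ('p, 'x) tens = "nat \<times> ('p \<times> 'x list) set"

subsection \<open>The coequalizer \<open>P(n) \<otimes>\<^bsub>\<Lambda>(n)\<^esub> X\<^sup>n\<close>\<close>

context lambda_operad
begin

definition power_cat :: "nat \<Rightarrow> ('o, 'a) cat \<Rightarrow> ('po \<times> 'o list, 'pa \<times> 'a list) cat" where
  "power_cat n X = pair_cat (pcat P n) (list_cat (replicate n X))"

inductive obj_eq :: "nat \<Rightarrow> ('o, 'a) cat \<Rightarrow> 'po \<times> 'o list \<Rightarrow> 'po \<times> 'o list \<Rightarrow> bool"
  for n :: nat and X :: "('o, 'a) cat" where
  gen: "\<lbrakk>(p, xs) \<in> Obj (power_cat n X); g \<in> carrier (lgrp L n)\<rbrakk>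
    \<Longrightarrow> obj_eq n X (pactO P n p g, xs) (p, lact n g xs)"
| refl: "z \<in> Obj (power_cat n X) \<Longrightarrow> obj_eq n X z z"
| sym: "obj_eq n X z w \<Longrightarrow> obj_eq n X w z"
| trans: "\<lbrakk>obj_eq n X z w; obj_eq n X w v\<rbrakk> \<Longrightarrow> obj_eq n X z v"

text \<open>When the action is not free, the orbits of arrows do not form a category: composable orbits
  may have several composites up to the action, which a functor out of the coequalizer has to
  identify.  Hence the closure under composition.\<close>

inductive arr_eq :: "nat \<Rightarrow> ('o, 'a) cat \<Rightarrow> 'pa \<times> 'a list \<Rightarrow> 'pa \<times> 'a list \<Rightarrow> bool"
  for n :: nat and X :: "('o, 'a) cat" where
  gen: "\<lbrakk>(p, fs) \<in> Arr (power_cat n X); g \<in> carrier (lgrp L n)\<rbrakk>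
    \<Longrightarrow> arr_eq n X (pactA P n p g, fs) (p, lact n g fs)"
| refl: "z \<in> Arr (power_cat n X) \<Longrightarrow> arr_eq n X z z"
| sym: "arr_eq n X z w \<Longrightarrow> arr_eq n X w z"
| trans: "\<lbrakk>arr_eq n X z w; arr_eq n X w v\<rbrakk> \<Longrightarrow> arr_eq n X z v"
| comp: "\<lbrakk>arr_eq n X b b'; arr_eq n X a a';
    Dom (power_cat n X) b = Cod (power_cat n X) a; Dom (power_cat n X) b' = Cod (power_cat n X) a'\<rbrakk>
    \<Longrightarrow> arr_eq n X (Comp (power_cat n X) b a) (Comp (power_cat n X) b' a')"

definition obj_class :: "nat \<Rightarrow> ('o, 'a) cat \<Rightarrow> 'po \<times> 'o list \<Rightarrow> ('po \<times> 'o list) set" where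
  "obj_class n X z = {w. obj_eq n X z w}"

definition arr_class :: "nat \<Rightarrow> ('o, 'a) cat \<Rightarrow> 'pa \<times> 'a list \<Rightarrow> ('pa \<times> 'a list) set" where
  "arr_class n X z = {w. arr_eq n X z w}"

definition rep :: "'z set \<Rightarrow> 'z" where
  "rep K = (SOME z. z \<in> K)"

definition tensor :: "nat \<Rightarrow> ('o, 'a) cat \<Rightarrow> (('po \<times> 'o list) set, ('pa \<times> 'a list) set) cat" where
  "tensor n X = \<lparr>Obj = obj_class n X ` Obj (power_cat n X),
     Arr = arr_class n X ` Arr (power_cat n X),
     Dom = (\<lambda>K. obj_class n X (Dom (power_cat n X) (rep K))),
     Cod = (\<lambda>K. obj_class n X (Cod (power_cat n X) (rep K))),
     Id = (\<lambda>K. arr_class n X (Id (power_cat n X) (rep K))),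
     Comp = (\<lambda>K M. let (b, a) = rep {(b, a). b \<in> K \<and> a \<in> M \<and>
                        Dom (power_cat n X) b = Cod (power_cat n X) a}
                   in arr_class n X (Comp (power_cat n X) b a))\<rparr>"

definition tensor_proj :: "nat \<Rightarrow> ('o, 'a) cat \<Rightarrow>
    ('po \<times> 'o list, 'pa \<times> 'a list, ('po \<times> 'o list) set, ('pa \<times> 'a list) set) ftor" where
  "tensor_proj n X = \<lparr>omap = obj_class n X, amap = arr_class n X\<rparr>"

text \<open>\<open>F\<close> coequalizes \<open>(p, g, x) \<mapsto> (p \<cdot> g, x)\<close> and \<open>(p, g, x) \<mapsto> (p, g \<cdot> x)\<close>.\<close>

definition balanced :: "nat \<Rightarrow> ('o, 'a) cat \<Rightarrow> ('po \<times> 'o list, 'pa \<times> 'a list, 'd, 'e) ftor \<Rightarrow> bool" where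
  "balanced n X F \<longleftrightarrow>
     (\<forall>g\<in>carrier (lgrp L n).
        (\<forall>(p, xs)\<in>Obj (power_cat n X). omap F (pactO P n p g, xs) = omap F (p, lact n g xs)) \<and>
        (\<forall>(p, fs)\<in>Arr (power_cat n X). amap F (pactA P n p g, fs) = amap F (p, lact n g fs)))"


text \<open>The remainder of this part shows that \<open>tensor n X\<close> with \<open>tensor_proj n X\<close> is the coequalizer
  in question.\<close>

lemma obj_class_eq:
  assumes "obj_eq n X z w"
  shows "obj_class n X z = obj_class n X w"
  using assms unfolding obj_class_def by (auto intro: obj_eq.sym obj_eq.trans)

lemma arr_class_eq:
  assumes "arr_eq n X z w"
  shows "arr_class n X z = arr_class n X w"
  using assms unfolding arr_class_def by (auto intro: arr_eq.sym arr_eq.trans)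

lemma rep_obj_class:
  assumes "z \<in> Obj (power_cat n X)"
  shows "obj_eq n X z (rep (obj_class n X z))"
  using someI[of "\<lambda>w. w \<in> obj_class n X z" z] assms
  by (auto simp: obj_class_def rep_def intro: obj_eq.refl)

lemma rep_arr_class:
  assumes "z \<in> Arr (power_cat n X)"
  shows "arr_eq n X z (rep (arr_class n X z))"
  using someI[of "\<lambda>w. w \<in> arr_class n X z" z] assms
  by (auto simp: arr_class_def rep_def intro: arr_eq.refl)

lemma length_reindex [simp]: "length (reindex s xs) = length xs"
  by (simp add: reindex_def del: upt_Suc)

lemma proj_permutes:
  assumes "g \<in> carrier (lgrp L n)"
  shows "lproj L n g permutes {1..n}"
  using proj_hom[of n] assms by (auto simp: hom_def sym_group_def)

lemma length_lact [simp]: "length (lact n g xs) = length xs"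
  by (simp add: lact_def)

lemma nth_lact:
  assumes "i < length xs"
  shows "lact n g xs ! i = entry xs (inv' (lproj L n g) (Suc i))"
  using assms by (simp add: lact_def reindex_def del: upt_Suc)

lemma lact_index:
  assumes "g \<in> carrier (lgrp L n)" "i < n"
  shows "inv' (lproj L n g) (Suc i) - 1 < n"
  using permutes_in_image[OF permutes_inv[OF proj_permutes[OF assms(1)]], of "Suc i"] assms(2)
  by auto

lemma list_all2_replicate:
  "list_all2 Q (replicate n X) xs \<longleftrightarrow> length xs = n \<and> (\<forall>i<n. Q X (xs ! i))"
  by (auto simp: list_all2_conv_all_nth)

lemma Obj_power: "z \<in> Obj (power_cat n X) \<longleftrightarrow>
    fst z \<in> Obj (pcat P n) \<and> length (snd z) = n \<and> (\<forall>i<n. snd z ! i \<in> Obj X)"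
  by (cases z) (simp add: power_cat_def pair_cat_def list_cat_def list_all2_replicate)

lemma Arr_power: "z \<in> Arr (power_cat n X) \<longleftrightarrow>
    fst z \<in> Arr (pcat P n) \<and> length (snd z) = n \<and> (\<forall>i<n. snd z ! i \<in> Arr X)"
  by (cases z) (simp add: power_cat_def pair_cat_def list_cat_def list_all2_replicate)

lemma map2_replicate: "length xs = n \<Longrightarrow> map2 h (replicate n X) xs = map (h X) xs"
  by (rule nth_equalityI) auto

lemma Dom_power: "length (snd z) = n \<Longrightarrow>
    Dom (power_cat n X) z = (Dom (pcat P n) (fst z), map (Dom X) (snd z))"
  by (cases z) (simp add: power_cat_def pair_cat_def list_cat_def map2_replicate)

lemma Cod_power: "length (snd z) = n \<Longrightarrow>
    Cod (power_cat n X) z = (Cod (pcat P n) (fst z), map (Cod X) (snd z))"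
  by (cases z) (simp add: power_cat_def pair_cat_def list_cat_def map2_replicate)

lemma Id_power: "length (snd z) = n \<Longrightarrow>
    Id (power_cat n X) z = (Id (pcat P n) (fst z), map (Id X) (snd z))"
  by (cases z) (simp add: power_cat_def pair_cat_def list_cat_def map2_replicate)

lemma Comp_power: "length (snd z) = n \<Longrightarrow> length (snd w) = n \<Longrightarrow>
    Comp (power_cat n X) z w
    = (Comp (pcat P n) (fst z) (fst w), map2 (Comp X) (snd z) (snd w))"
  by (cases z; cases w)
    (auto simp: power_cat_def pair_cat_def list_cat_def intro!: nth_equalityI)

lemma power_category:
  assumes "category X"
  shows "category (power_cat n X)"
proof -
  interpret X: category X by fact
  interpret Pn: category "pcat P n" by (rule P_cat)
  have dom_cod: "Dom X (ys ! i) = Cod X (xs ! i)"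
    if "map (Dom X) ys = map (Cod X) xs" "i < length xs" for xs ys i
    using that by (metis length_map nth_map)
  show ?thesis
  proof
    fix f assume f: "f \<in> Arr (power_cat n X)"
    then show "Dom (power_cat n X) f \<in> Obj (power_cat n X)"
      and "Cod (power_cat n X) f \<in> Obj (power_cat n X)"
      by (simp_all add: Arr_power Obj_power Dom_power Cod_power
          Pn.Dom_in Pn.Cod_in X.Dom_in X.Cod_in)
    from f have l: "length (snd f) = n" by (simp add: Arr_power)
    show "Comp (power_cat n X) f (Id (power_cat n X) (Dom (power_cat n X) f)) = f"
      using f l by (simp add: Dom_power Id_power Comp_power, cases f)
        (auto simp: Arr_power Pn.Comp_Id X.Comp_Id intro!: nth_equalityI)
    show "Comp (power_cat n X) (Id (power_cat n X) (Cod (power_cat n X) f)) f = f"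
      using f l by (simp add: Cod_power Id_power Comp_power, cases f)
        (auto simp: Arr_power Pn.Id_Comp X.Id_Comp intro!: nth_equalityI)
  next
    fix x assume x: "x \<in> Obj (power_cat n X)"
    then have l: "length (snd x) = n" by (simp add: Obj_power)
    from x show "Id (power_cat n X) x \<in> Arr (power_cat n X)"
      by (simp add: Arr_power Obj_power Id_power Pn.Id_in X.Id_in)
    from x l show "Dom (power_cat n X) (Id (power_cat n X) x) = x"
      and "Cod (power_cat n X) (Id (power_cat n X) x) = x"
      by (cases x; auto simp: Obj_power Id_power Dom_power Cod_power
          Pn.Dom_Id X.Dom_Id Pn.Cod_Id X.Cod_Id intro!: nth_equalityI)+
  next
    fix g f
    assume gf: "g \<in> Arr (power_cat n X)" "f \<in> Arr (power_cat n X)"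
      "Dom (power_cat n X) g = Cod (power_cat n X) f"
    then have l: "length (snd g) = n" "length (snd f) = n" by (simp_all add: Arr_power)
    have d: "Dom (pcat P n) (fst g) = Cod (pcat P n) (fst f)"
      "\<forall>i<n. Dom X (snd g ! i) = Cod X (snd f ! i)"
      using gf(3) l by (auto simp: Dom_power Cod_power dest: dom_cod)
    from gf l d show "Comp (power_cat n X) g f \<in> Arr (power_cat n X)"
      by (simp add: Arr_power Comp_power Pn.Comp_in X.Comp_in)
    from gf l d show "Dom (power_cat n X) (Comp (power_cat n X) g f) = Dom (power_cat n X) f"
      and "Cod (power_cat n X) (Comp (power_cat n X) g f) = Cod (power_cat n X) g"
      by (auto simp: Arr_power Comp_power Dom_power Cod_power Pn.Dom_Comp X.Dom_Comp
          Pn.Cod_Comp X.Cod_Comp intro!: nth_equalityI)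
    fix h
    assume h: "h \<in> Arr (power_cat n X)" "Dom (power_cat n X) h = Cod (power_cat n X) g"
    then have lh: "length (snd h) = n" by (simp add: Arr_power)
    have dh: "Dom (pcat P n) (fst h) = Cod (pcat P n) (fst g)"
      "\<forall>i<n. Dom X (snd h ! i) = Cod X (snd g ! i)"
      using h(2) l lh by (auto simp: Dom_power Cod_power dest: dom_cod)
    show "Comp (power_cat n X) (Comp (power_cat n X) h g) f
        = Comp (power_cat n X) h (Comp (power_cat n X) g f)"
      using gf h l lh d dh
      by (auto simp: Arr_power Comp_power Pn.Comp_assoc X.Comp_assoc intro!: nth_equalityI)
  qed
qed

lemma lact_map:
  assumes "g \<in> carrier (lgrp L n)" "length xs = n"
  shows "lact n g (map h xs) = map h (lact n g xs)"
  using assms lact_index[OF assms(1)] by (auto simp: nth_lact intro!: nth_equalityI)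

lemma lact_inv:
  assumes g: "g \<in> carrier (lgrp L n)" and l: "length xs = n"
  shows "lact n g (lact n (inv\<^bsub>lgrp L n\<^esub> g) xs) = xs"
proof -
  interpret G: group "lgrp L n" by (rule L_group)
  let ?s = "lproj L n g" and ?t = "lproj L n (inv\<^bsub>lgrp L n\<^esub> g)"
  interpret h: group_hom "lgrp L n" "sym_group n" "lproj L n"
    by (intro group_hom.intro group_hom_axioms.intro L_group sym_group_is_group proj_hom)
  have "?t = inv' ?s"
    using h.hom_inv[OF g] sym_group_inv_equality[of ?s n] proj_permutes[OF g]
    by (simp add: sym_group_carrier)
  then have t: "inv' ?t = ?s"
    using inv_inv_eq[OF permutes_bij[OF proj_permutes[OF g]]] by simp
  have "lact n g (lact n (inv\<^bsub>lgrp L n\<^esub> g) xs) ! i = xs ! i" if i: "i < n" for i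
  proof -
    let ?j = "inv' ?s (Suc i)"
    have j: "?j - 1 < n" using lact_index[OF g i] .
    have "?j \<in> {1..n}"
      using permutes_in_image[OF permutes_inv[OF proj_permutes[OF g]], of "Suc i"] i by auto
    then have "Suc (?j - 1) = ?j" by auto
    then show ?thesis
      using i j l permutes_inverses(1)[OF proj_permutes[OF g]] by (simp add: nth_lact t)
  qed
  then show ?thesis using l by (auto intro: nth_equalityI)
qed

lemma lact_power_Obj:
  assumes "g \<in> carrier (lgrp L n)" "(p, xs) \<in> Obj (power_cat n X)"
  shows "(p, lact n g xs) \<in> Obj (power_cat n X)"
  using assms lact_index[OF assms(1)] by (auto simp: Obj_power nth_lact)

lemma lact_power_Arr:
  assumes "g \<in> carrier (lgrp L n)" "(p, xs) \<in> Arr (power_cat n X)"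
  shows "(p, lact n g xs) \<in> Arr (power_cat n X)"
  using assms lact_index[OF assms(1)] by (auto simp: Arr_power nth_lact)

lemma act_functor:
  assumes "g \<in> carrier (lgrp L n)"
  shows "p \<in> Obj (pcat P n) \<Longrightarrow> pactO P n p g \<in> Obj (pcat P n)"
    and "f \<in> Arr (pcat P n) \<Longrightarrow> pactA P n f g \<in> Arr (pcat P n)"
    and "f \<in> Arr (pcat P n) \<Longrightarrow> Dom (pcat P n) (pactA P n f g) = pactO P n (Dom (pcat P n) f) g"
    and "f \<in> Arr (pcat P n) \<Longrightarrow> Cod (pcat P n) (pactA P n f g) = pactO P n (Cod (pcat P n) f) g"
    and "p \<in> Obj (pcat P n) \<Longrightarrow> pactA P n (Id (pcat P n) p) g = Id (pcat P n) (pactO P n p g)"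
  using P_act[OF assms] by (auto simp: is_functor_def)

lemma obj_eq_Obj:
  "obj_eq n X z w \<Longrightarrow> z \<in> Obj (power_cat n X) \<and> w \<in> Obj (power_cat n X)"
proof (induction rule: obj_eq.induct)
  case (gen p xs g)
  then show ?case
    using lact_power_Obj[OF gen(2,1)] act_functor(1)[OF gen(2)] by (auto simp: Obj_power)
qed auto

lemma arr_eq_Arr:
  assumes "category X"
  shows "arr_eq n X z w \<Longrightarrow>
    z \<in> Arr (power_cat n X) \<and> w \<in> Arr (power_cat n X) \<and>
    obj_eq n X (Dom (power_cat n X) z) (Dom (power_cat n X) w) \<and>
    obj_eq n X (Cod (power_cat n X) z) (Cod (power_cat n X) w)"
proof (induction rule: arr_eq.induct)
  interpret C: category "power_cat n X" by (rule power_category[OF assms])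
  {
    case (gen p fs g)
    have p: "p \<in> Arr (pcat P n)" and l: "length fs = n" using gen(1) by (auto simp: Arr_power)
    have "(Dom (pcat P n) p, map (Dom X) fs) \<in> Obj (power_cat n X)"
      "(Cod (pcat P n) p, map (Cod X) fs) \<in> Obj (power_cat n X)"
      using C.Dom_in[OF gen(1)] C.Cod_in[OF gen(1)] l by (simp_all add: Dom_power Cod_power)
    from this[THEN obj_eq.gen, OF gen(2)] show ?case
      using gen lact_power_Arr[OF gen(2,1)] act_functor(2)[OF gen(2) p] p l
      by (auto simp: Arr_power Dom_power Cod_power act_functor(3,4)[OF gen(2)] lact_map)
  next
    case (refl z)
    then show ?case by (auto intro: obj_eq.refl C.Dom_in C.Cod_in)
  next
    case (sym z w)
    then show ?case by (auto intro: obj_eq.sym)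
  next
    case (trans z w v)
    then show ?case by (auto intro: obj_eq.trans)
  next
    case (comp b b' a a')
    then show ?case by (auto simp: C.Comp_in C.Dom_Comp C.Cod_Comp)
  }
qed

lemma lift_Dom:
  assumes X: "category X"
  shows "obj_eq n X z w \<Longrightarrow>
    (\<forall>b\<in>Arr (power_cat n X). Dom (power_cat n X) b = z
       \<longrightarrow> (\<exists>b'. arr_eq n X b b' \<and> Dom (power_cat n X) b' = w)) \<and>
    (\<forall>b\<in>Arr (power_cat n X). Dom (power_cat n X) b = w
       \<longrightarrow> (\<exists>b'. arr_eq n X b b' \<and> Dom (power_cat n X) b' = z))"
proof (induction rule: obj_eq.induct)
  case (gen p xs g)
  interpret G: group "lgrp L n" by (rule L_group)
  interpret A: lambda_set_operad L "\<lambda>n. Arr (pcat P n)" "Id (pcat P 1) (pid P)" "pmuA P" "pactA P"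
    by (rule P_arr)
  interpret O: lambda_set_operad L "\<lambda>n. Obj (pcat P n)" "pid P" "pmuO P" "pactO P"
    by (rule P_obj)
  let ?h = "inv\<^bsub>lgrp L n\<^esub> g"
  have h: "?h \<in> carrier (lgrp L n)" using gen(2) by simp
  have p: "p \<in> Obj (pcat P n)" and l: "length xs = n" using gen(1) by (auto simp: Obj_power)
  have undo: "lact n ?h (lact n g xs) = xs" using lact_inv[OF h l] gen(2) by simp
  show ?case
  proof (intro conjI ballI impI)
    fix b assume b: "b \<in> Arr (power_cat n X)" "Dom (power_cat n X) b = (pactO P n p g, xs)"
    obtain v fs where vfs: "b = (v, fs)" by (cases b)
    have v: "v \<in> Arr (pcat P n)" and lf: "length fs = n" using b vfs by (auto simp: Arr_power)
    have dv: "Dom (pcat P n) v = pactO P n p g" "map (Dom X) fs = xs"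
      using b(2) lf by (auto simp: vfs Dom_power)
    let ?v = "pactA P n v ?h"
    have "(?v, fs) \<in> Arr (power_cat n X)"
      using b vfs act_functor(2)[OF h v] by (auto simp: Arr_power)
    from arr_eq.gen[OF this gen(2)] have "arr_eq n X b (?v, lact n g fs)"
      using A.act_mult[OF v h gen(2)] A.act_one[OF v] gen(2) vfs by simp
    moreover have "Dom (power_cat n X) (?v, lact n g fs) = (p, lact n g xs)"
      using lf dv O.act_mult[OF p gen(2) h] O.act_one[OF p] gen(2)
      by (auto simp: Dom_power act_functor(3)[OF h v] lact_map[OF gen(2) lf, symmetric])
    ultimately show "\<exists>b'. arr_eq n X b b' \<and> Dom (power_cat n X) b' = (p, lact n g xs)" by blast
  next
    fix b assume b: "b \<in> Arr (power_cat n X)" "Dom (power_cat n X) b = (p, lact n g xs)"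
    obtain v fs where vfs: "b = (v, fs)" by (cases b)
    have v: "v \<in> Arr (pcat P n)" and lf: "length fs = n" using b vfs by (auto simp: Arr_power)
    have dv: "Dom (pcat P n) v = p" "map (Dom X) fs = lact n g xs"
      using b(2) lf by (auto simp: vfs Dom_power)
    have "(v, lact n ?h fs) \<in> Arr (power_cat n X)" using lact_power_Arr[OF h] b vfs by auto
    from arr_eq.sym[OF arr_eq.gen[OF this gen(2)]]
    have "arr_eq n X b (pactA P n v g, lact n ?h fs)" using lact_inv[OF gen(2) lf] vfs by simp
    moreover have "Dom (power_cat n X) (pactA P n v g, lact n ?h fs) = (pactO P n p g, xs)"
      using lf dv undo by (simp add: Dom_power act_functor(3)[OF gen(2) v] lact_map[OF h lf, symmetric])
    ultimately show "\<exists>b'. arr_eq n X b b' \<and> Dom (power_cat n X) b' = (pactO P n p g, xs)" by blast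
  qed
next
  case (refl z)
  then show ?case by (auto intro: arr_eq.refl)
next
  case (sym z w)
  then show ?case by blast
next
  case (trans z w v)
  then show ?case using arr_eq_Arr[OF X] by (meson arr_eq.trans)
qed

lemma tensor_Obj: "x \<in> Obj (power_cat n X) \<Longrightarrow> obj_class n X x \<in> Obj (tensor n X)"
  and tensor_Arr: "f \<in> Arr (power_cat n X) \<Longrightarrow> arr_class n X f \<in> Arr (tensor n X)"
  by (simp_all add: tensor_def)

lemma tensor_Dom:
  assumes "category X" "f \<in> Arr (power_cat n X)"
  shows "Dom (tensor n X) (arr_class n X f) = obj_class n X (Dom (power_cat n X) f)"
    and "Cod (tensor n X) (arr_class n X f) = obj_class n X (Cod (power_cat n X) f)"
  using arr_eq_Arr[OF assms(1) rep_arr_class[OF assms(2)]]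
  by (auto simp: tensor_def intro!: obj_class_eq intro: obj_eq.sym)

lemma arr_eq_Id:
  assumes "category X"
  shows "obj_eq n X x y \<Longrightarrow> arr_eq n X (Id (power_cat n X) x) (Id (power_cat n X) y)"
proof (induction rule: obj_eq.induct)
  interpret C: category "power_cat n X" by (rule power_category[OF assms])
  {
    case (gen p xs g)
    then have p: "p \<in> Obj (pcat P n)" and l: "length xs = n" by (auto simp: Obj_power)
    have "(Id (pcat P n) p, map (Id X) xs) \<in> Arr (power_cat n X)"
      using C.Id_in[OF gen(1)] l by (simp add: Id_power)
    from arr_eq.gen[OF this gen(2)] show ?case using l by (simp add: Id_power act_functor(5)[OF gen(2) p] lact_map[OF gen(2)])
  next
    case (refl z)
    then show ?case by (auto intro: arr_eq.refl C.Id_in)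
  next
    case (sym z w)
    then show ?case by (auto intro: arr_eq.sym)
  next
    case (trans z w v)
    then show ?case by (auto intro: arr_eq.trans)
  }
qed

lemma tensor_Id:
  assumes "category X" "x \<in> Obj (power_cat n X)"
  shows "Id (tensor n X) (obj_class n X x) = arr_class n X (Id (power_cat n X) x)"
  using arr_class_eq[OF arr_eq_Id[OF assms(1) rep_obj_class[OF assms(2)]]]
  by (simp add: tensor_def)

lemma tensor_Comp:
  assumes X: "category X" and b: "b \<in> Arr (power_cat n X)" and a: "a \<in> Arr (power_cat n X)"
    and ba: "Dom (power_cat n X) b = Cod (power_cat n X) a"
  shows "Comp (tensor n X) (arr_class n X b) (arr_class n X a)
    = arr_class n X (Comp (power_cat n X) b a)"
proof -
  let ?S = "{(b', a'). b' \<in> arr_class n X b \<and> a' \<in> arr_class n X a \<and>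
    Dom (power_cat n X) b' = Cod (power_cat n X) a'}"
  have "(b, a) \<in> ?S" using a b ba by (auto simp: arr_class_def intro: arr_eq.refl)
  then have "rep ?S \<in> ?S" unfolding rep_def by (rule someI)
  then obtain b' a' where r: "rep ?S = (b', a')" "arr_eq n X b b'" "arr_eq n X a a'"
    "Dom (power_cat n X) b' = Cod (power_cat n X) a'" by (auto simp: arr_class_def)
  from arr_class_eq[OF arr_eq.comp[OF r(2,3) ba r(4)]] r(1) show ?thesis
    by (simp add: tensor_def)
qed

lemma obj_class_eq_iff:
  assumes "x \<in> Obj (power_cat n X)" "obj_class n X x = obj_class n X y"
  shows "obj_eq n X y x"
  using assms obj_eq.refl[OF assms(1)] by (auto simp: obj_class_def)

lemma arr_class_eq_iff:
  assumes "x \<in> Arr (power_cat n X)" "arr_class n X x = arr_class n X y"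
  shows "arr_eq n X y x"
  using assms arr_eq.refl[OF assms(1)] by (auto simp: arr_class_def)

lemma tensor_composable:
  assumes X: "category X" and G: "G \<in> Arr (tensor n X)" and a: "a \<in> Arr (power_cat n X)"
    and e: "Dom (tensor n X) G = Cod (tensor n X) (arr_class n X a)"
  obtains b where "b \<in> Arr (power_cat n X)" "G = arr_class n X b"
    "Dom (power_cat n X) b = Cod (power_cat n X) a"
proof -
  interpret C: category "power_cat n X" by (rule power_category[OF X])
  obtain c where c: "c \<in> Arr (power_cat n X)" "G = arr_class n X c"
    using G by (auto simp: tensor_def)
  have "obj_eq n X (Dom (power_cat n X) c) (Cod (power_cat n X) a)"
    using e tensor_Dom[OF X c(1)] tensor_Dom[OF X a] c(2) obj_class_eq_iff[OF C.Cod_in[OF a]] by simp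
  then obtain b where "arr_eq n X c b" "Dom (power_cat n X) b = Cod (power_cat n X) a"
    using lift_Dom[OF X] c(1) by blast
  then show ?thesis using that[of b] arr_class_eq arr_eq_Arr[OF X] c(2) by metis
qed

lemma tensor_Obj_cases:
  assumes "K \<in> Obj (tensor n X)"
  obtains x where "x \<in> Obj (power_cat n X)" "K = obj_class n X x"
  using assms by (auto simp: tensor_def)

lemma tensor_Arr_cases:
  assumes "K \<in> Arr (tensor n X)"
  obtains f where "f \<in> Arr (power_cat n X)" "K = arr_class n X f"
  using assms by (auto simp: tensor_def)

lemma tensor_category:
  assumes X: "category X"
  shows "category (tensor n X)"
proof -
  interpret C: category "power_cat n X" by (rule power_category[OF X])
  note s = tensor_Obj tensor_Arr tensor_Dom[OF X] tensor_Id[OF X] tensor_Comp[OF X]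
    C.Dom_in C.Cod_in C.Id_in C.Dom_Id C.Cod_Id C.Comp_in C.Dom_Comp C.Cod_Comp
    C.Comp_Id C.Id_Comp C.Comp_assoc
  show ?thesis
  proof
    fix F assume F: "F \<in> Arr (tensor n X)"
    then obtain f where "f \<in> Arr (power_cat n X)" "F = arr_class n X f" by (rule tensor_Arr_cases)
    then show "Dom (tensor n X) F \<in> Obj (tensor n X)" "Cod (tensor n X) F \<in> Obj (tensor n X)"
      "Comp (tensor n X) F (Id (tensor n X) (Dom (tensor n X) F)) = F"
      "Comp (tensor n X) (Id (tensor n X) (Cod (tensor n X) F)) F = F"
      by (simp_all add: s)
  next
    fix K assume "K \<in> Obj (tensor n X)"
    then obtain x where "x \<in> Obj (power_cat n X)" "K = obj_class n X x" by (rule tensor_Obj_cases)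
    then show "Id (tensor n X) K \<in> Arr (tensor n X)" "Dom (tensor n X) (Id (tensor n X) K) = K"
      "Cod (tensor n X) (Id (tensor n X) K) = K"
      by (simp_all add: s)
  next
    fix G F assume G: "G \<in> Arr (tensor n X)" and F: "F \<in> Arr (tensor n X)"
      and GF: "Dom (tensor n X) G = Cod (tensor n X) F"
    obtain f where f: "f \<in> Arr (power_cat n X)" "F = arr_class n X f" using F by (rule tensor_Arr_cases)
    obtain g where g: "g \<in> Arr (power_cat n X)" "G = arr_class n X g"
      "Dom (power_cat n X) g = Cod (power_cat n X) f"
      using tensor_composable[OF X G f(1)] GF f(2) by metis
    show "Comp (tensor n X) G F \<in> Arr (tensor n X)"
      "Dom (tensor n X) (Comp (tensor n X) G F) = Dom (tensor n X) F"
      "Cod (tensor n X) (Comp (tensor n X) G F) = Cod (tensor n X) G"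
      using f g by (simp_all add: s)
    fix H assume H: "H \<in> Arr (tensor n X)" and HG: "Dom (tensor n X) H = Cod (tensor n X) G"
    obtain h where h: "h \<in> Arr (power_cat n X)" "H = arr_class n X h"
      "Dom (power_cat n X) h = Cod (power_cat n X) g"
      using tensor_composable[OF X H g(1)] HG g(2) by metis
    show "Comp (tensor n X) (Comp (tensor n X) H G) F = Comp (tensor n X) H (Comp (tensor n X) G F)"
      using f g h by (simp add: s)
  qed
qed

lemma tensor_proj_functor:
  assumes "category X"
  shows "is_functor (power_cat n X) (tensor n X) (tensor_proj n X)"
  using assms
  by (simp add: is_functor_def tensor_proj_def tensor_Obj tensor_Arr tensor_Dom tensor_Id tensor_Comp)

lemma tensor_proj_balanced: "balanced n X (tensor_proj n X)"
  unfolding balanced_def tensor_proj_def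
  by (auto simp del: split_paired_All
      intro!: obj_class_eq arr_class_eq intro: obj_eq.gen arr_eq.gen)

theorem tensor_universal:
  assumes X: "category X" and F: "is_functor (power_cat n X) D F" and bal: "balanced n X F"
  shows "\<exists>H. is_functor (tensor n X) D H \<and>
      ftor_eq (power_cat n X) (ftor_comp H (tensor_proj n X)) F \<and>
      (\<forall>H'. is_functor (tensor n X) D H' \<and>
         ftor_eq (power_cat n X) (ftor_comp H' (tensor_proj n X)) F \<longrightarrow> ftor_eq (tensor n X) H' H)"
proof -
  interpret C: category "power_cat n X" by (rule power_category[OF X])
  have o: "omap F z = omap F w" if "obj_eq n X z w" for z w
    using that bal by (induction rule: obj_eq.induct) (auto simp: balanced_def)
  have a: "amap F z = amap F w" if "arr_eq n X z w" for z w
    using that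
  proof (induction rule: arr_eq.induct)
    case (gen p fs g)
    then show ?case using bal by (auto simp: balanced_def)
  next
    case (comp b b' a a')
    then show ?case
      using F arr_eq_Arr[OF X comp(1)] arr_eq_Arr[OF X comp(2)] by (simp add: is_functor_def)
  qed auto
  define H where "H = \<lparr>omap = (\<lambda>K. omap F (rep K)), amap = (\<lambda>K. amap F (rep K))\<rparr>"
  have Ho: "omap H (obj_class n X x) = omap F x" if "x \<in> Obj (power_cat n X)" for x
    using o[OF rep_obj_class[OF that]] by (simp add: H_def)
  have Ha: "amap H (arr_class n X f) = amap F f" if "f \<in> Arr (power_cat n X)" for f
    using a[OF rep_arr_class[OF that]] by (simp add: H_def)
  have "is_functor (tensor n X) D H"
    unfolding is_functor_def
  proof (intro conjI ballI impI)
    fix K assume "K \<in> Obj (tensor n X)"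
    then obtain x where x: "x \<in> Obj (power_cat n X)" "K = obj_class n X x" by (rule tensor_Obj_cases)
    then show "omap H K \<in> Obj D" "amap H (Id (tensor n X) K) = Id D (omap H K)"
      using F by (simp_all add: Ho Ha tensor_Id[OF X] C.Id_in is_functor_def)
  next
    fix K assume "K \<in> Arr (tensor n X)"
    then obtain f where f: "f \<in> Arr (power_cat n X)" "K = arr_class n X f" by (rule tensor_Arr_cases)
    then show "amap H K \<in> Arr D" "Dom D (amap H K) = omap H (Dom (tensor n X) K)"
      "Cod D (amap H K) = omap H (Cod (tensor n X) K)"
      using F by (simp_all add: Ho Ha tensor_Dom[OF X] C.Dom_in C.Cod_in is_functor_def)
  next
    fix K M assume K: "K \<in> Arr (tensor n X)" and M: "M \<in> Arr (tensor n X)"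
      and KM: "Dom (tensor n X) K = Cod (tensor n X) M"
    obtain f where f: "f \<in> Arr (power_cat n X)" "M = arr_class n X f" using M by (rule tensor_Arr_cases)
    obtain g where g: "g \<in> Arr (power_cat n X)" "K = arr_class n X g"
      "Dom (power_cat n X) g = Cod (power_cat n X) f"
      using tensor_composable[OF X K f(1)] KM f(2) by metis
    show "amap H (Comp (tensor n X) K M) = Comp D (amap H K) (amap H M)"
      using f g F by (simp add: Ha tensor_Comp[OF X] C.Comp_in is_functor_def)
  qed
  moreover have "ftor_eq (power_cat n X) (ftor_comp H (tensor_proj n X)) F"
    by (simp add: ftor_eq_def ftor_comp_def tensor_proj_def Ho Ha)
  moreover have "ftor_eq (tensor n X) H' H"
    if "ftor_eq (power_cat n X) (ftor_comp H' (tensor_proj n X)) F" for H'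
    using that by (auto simp: ftor_eq_def ftor_comp_def tensor_proj_def Ho Ha
        elim!: tensor_Obj_cases tensor_Arr_cases)
  ultimately show ?thesis by blast
qed

subsection \<open>The 2-functor, the multiplication and the unit\<close>

text \<open>All formulas are evaluated on a representative of a class.  In \<open>Tfun Y F\<close> and \<open>Tcell Y t\<close> the
  category \<open>Y\<close> is the codomain of the functor \<open>F\<close>, respectively of the functors between which \<open>t\<close> is a
  transformation.\<close>

definition Tcat :: "('o, 'a) cat \<Rightarrow> (('po, 'o) tens, ('pa, 'a) tens) cat" where
  "Tcat X = coprod_cat (\<lambda>n. tensor n X)"

definition Tfun :: "('p, 'b) cat \<Rightarrow> ('o, 'a, 'p, 'b) ftor
    \<Rightarrow> (('po, 'o) tens, ('pa, 'a) tens, ('po, 'p) tens, ('pa, 'b) tens) ftor" where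
  "Tfun Y F = \<lparr>omap = (\<lambda>(n, K). let (p, xs) = rep K in (n, obj_class n Y (p, map (omap F) xs))),
     amap = (\<lambda>(n, K). let (p, fs) = rep K in (n, arr_class n Y (p, map (amap F) fs)))\<rparr>"

definition Tcell :: "('p, 'b) cat \<Rightarrow> ('o \<Rightarrow> 'b) \<Rightarrow> ('po, 'o) tens \<Rightarrow> ('pa, 'b) tens" where
  "Tcell Y t = (\<lambda>(n, K). let (p, xs) = rep K in (n, arr_class n Y (Id (pcat P n) p, map t xs)))"

definition Tmu :: "('o, 'a) cat \<Rightarrow> (('po, ('po, 'o) tens) tens, ('pa, ('pa, 'a) tens) tens,
    ('po, 'o) tens, ('pa, 'a) tens) ftor" where
  "Tmu X =
    \<lparr>omap = (\<lambda>(n, K). let (p, zs) = rep K; ks = map fst zs; rs = map (\<lambda>z. rep (snd z)) zs in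
       (sum_list ks,
        obj_class (sum_list ks) X (pmuO P ks p (map fst rs), concat (map snd rs)))),
     amap = (\<lambda>(n, K). let (p, zs) = rep K; ks = map fst zs; rs = map (\<lambda>z. rep (snd z)) zs in
       (sum_list ks,
        arr_class (sum_list ks) X (pmuA P ks p (map fst rs), concat (map snd rs))))\<rparr>"

definition Teta :: "('o, 'a) cat \<Rightarrow> ('o, 'a, ('po, 'o) tens, ('pa, 'a) tens) ftor" where
  "Teta X = \<lparr>omap = (\<lambda>x. (1, obj_class 1 X (pid P, [x]))),
     amap = (\<lambda>f. (1, arr_class 1 X (Id (pcat P 1) (pid P), [f])))\<rparr>"

end

section \<open>Pseudo-algebras\<close>

record ('po, 'pa, 'o, 'a) pseudo_alg =
  carr :: "('o, 'a) cat"
  str :: "(('po, 'o) tens, ('pa, 'a) tens, 'o, 'a) ftor"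
  assoc_cell :: "('po, ('po, 'o) tens) tens \<Rightarrow> 'a"
  unit_cell :: "'o \<Rightarrow> 'a"

record ('po, 'o, 'a, 'p, 'b) pseudo_mor =
  mfun :: "('o, 'a, 'p, 'b) ftor"
  mcell :: "('po, 'o) tens \<Rightarrow> 'b"

context lambda_operad
begin

text \<open>In each equation between pasted 2-cells, \<open>z\<close> is an object of the category on whose objects the
  components are indexed, and composites are read from right to left.\<close>

definition pseudo_algebra :: "('po, 'pa, 'o, 'a) pseudo_alg \<Rightarrow> bool" where
  "pseudo_algebra A \<longleftrightarrow>
    (let X = carr A; \<alpha> = str A; \<Phi> = assoc_cell A; \<Phi>\<^sub>\<eta> = unit_cell A in
      category X \<and> is_functor (Tcat X) X \<alpha> \<and>
      is_nat_iso (Tcat (Tcat X)) X (ftor_comp \<alpha> (Tfun X \<alpha>)) (ftor_comp \<alpha> (Tmu X)) \<Phi> \<and>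
      is_nat_iso X X ftor_id (ftor_comp \<alpha> (Teta X)) \<Phi>\<^sub>\<eta> \<and>
      (\<forall>z\<in>Obj (Tcat (Tcat (Tcat X))).
         Comp X (\<Phi> (omap (Tfun (Tcat X) (Tmu X)) z)) (amap \<alpha> (Tcell X \<Phi> z))
         = Comp X (\<Phi> (omap (Tmu (Tcat X)) z)) (\<Phi> (omap (Tfun (Tcat X) (Tfun X \<alpha>)) z))) \<and>
      (\<forall>z\<in>Obj (Tcat X).
         Comp X (\<Phi> (omap (Tfun (Tcat X) (Teta X)) z)) (amap \<alpha> (Tcell X \<Phi>\<^sub>\<eta> z))
         = Id X (omap \<alpha> z)))"

definition strict_algebra :: "('po, 'pa, 'o, 'a) pseudo_alg \<Rightarrow> bool" where
  "strict_algebra A \<longleftrightarrow>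
    (let X = carr A; \<alpha> = str A in
      pseudo_algebra A \<and>
      is_identity_cell (Tcat (Tcat X)) X (ftor_comp \<alpha> (Tfun X \<alpha>)) (ftor_comp \<alpha> (Tmu X))
        (assoc_cell A) \<and>
      is_identity_cell X X ftor_id (ftor_comp \<alpha> (Teta X)) (unit_cell A))"

definition pseudomorphism :: "('po, 'pa, 'o, 'a) pseudo_alg \<Rightarrow> ('po, 'pa, 'p, 'b) pseudo_alg
    \<Rightarrow> ('po, 'o, 'a, 'p, 'b) pseudo_mor \<Rightarrow> bool" where
  "pseudomorphism A B M \<longleftrightarrow>
    (let X = carr A; \<alpha> = str A; \<Phi> = assoc_cell A; \<Phi>\<^sub>\<eta> = unit_cell A;
         Y = carr B; \<beta> = str B; \<Psi> = assoc_cell B; \<Psi>\<^sub>\<eta> = unit_cell B;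
         f = mfun M; f' = mcell M in
      is_functor X Y f \<and>
      is_nat_iso (Tcat X) Y (ftor_comp \<beta> (Tfun Y f)) (ftor_comp f \<alpha>) f' \<and>
      (\<forall>z\<in>Obj (Tcat (Tcat X)).
         Comp Y (f' (omap (Tmu X) z)) (\<Psi> (omap (Tfun (Tcat Y) (Tfun Y f)) z))
         = Comp Y (amap f (\<Phi> z))
             (Comp Y (f' (omap (Tfun X \<alpha>) z)) (amap \<beta> (Tcell Y f' z)))) \<and>
      (\<forall>z\<in>Obj X. Comp Y (f' (omap (Teta X) z)) (\<Psi>\<^sub>\<eta> (omap f z)) = amap f (\<Phi>\<^sub>\<eta> z)))"

definition T_transformation :: "('po, 'pa, 'o, 'a) pseudo_alg \<Rightarrow> ('po, 'pa, 'p, 'b) pseudo_alg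
    \<Rightarrow> ('po, 'o, 'a, 'p, 'b) pseudo_mor \<Rightarrow> ('po, 'o, 'a, 'p, 'b) pseudo_mor \<Rightarrow> ('o \<Rightarrow> 'b) \<Rightarrow> bool" where
  "T_transformation A B M N \<gamma> \<longleftrightarrow>
     is_nat_trans (carr A) (carr B) (mfun M) (mfun N) \<gamma> \<and>
     (\<forall>z\<in>Obj (Tcat (carr A)).
        Comp (carr B) (mcell N z) (amap (str B) (Tcell (carr B) \<gamma> z))
        = Comp (carr B) (\<gamma> (omap (str A) z)) (mcell M z))"

definition isomorphic_mors :: "('po, 'pa, 'o, 'a) pseudo_alg \<Rightarrow> ('po, 'pa, 'p, 'b) pseudo_alg
    \<Rightarrow> ('po, 'o, 'a, 'p, 'b) pseudo_mor \<Rightarrow> ('po, 'o, 'a, 'p, 'b) pseudo_mor \<Rightarrow> bool" where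
  "isomorphic_mors A B M N \<longleftrightarrow>
     (\<exists>\<gamma> \<gamma>'. T_transformation A B M N \<gamma> \<and> T_transformation A B N M \<gamma>' \<and>
        inverse_cells (carr A) (carr B) (mfun M) (mfun N) \<gamma> \<gamma>')"

definition mor_id :: "('po, 'pa, 'o, 'a) pseudo_alg \<Rightarrow> ('po, 'o, 'a, 'o, 'a) pseudo_mor" where
  "mor_id A = \<lparr>mfun = ftor_id, mcell = (\<lambda>z. Id (carr A) (omap (str A) z))\<rparr>"

text \<open>For \<open>M = (f, f') : A \<rightarrow> B\<close> and \<open>N = (g, g') : B \<rightarrow> C\<close>, the composite is
  \<open>(g f, (g * f') (g' * T f))\<close>.\<close>

definition mor_comp :: "('po, 'pa, 'p, 'b) pseudo_alg \<Rightarrow> ('po, 'pa, 'q, 'c) pseudo_alg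
    \<Rightarrow> ('po, 'p, 'b, 'q, 'c) pseudo_mor \<Rightarrow> ('po, 'o, 'a, 'p, 'b) pseudo_mor
    \<Rightarrow> ('po, 'o, 'a, 'q, 'c) pseudo_mor" where
  "mor_comp B C N M = \<lparr>mfun = ftor_comp (mfun N) (mfun M),
     mcell = (\<lambda>z. Comp (carr C) (amap (mfun N) (mcell M z))
                    (mcell N (omap (Tfun (carr B) (mfun M)) z)))\<rparr>"

text \<open>Equivalence in the 2-category of pseudo-algebras, pseudomorphisms and \<open>T\<close>-transformations.\<close>

definition equivalent :: "('po, 'pa, 'o, 'a) pseudo_alg \<Rightarrow> ('po, 'pa, 'p, 'b) pseudo_alg \<Rightarrow> bool" where
  "equivalent A B \<longleftrightarrow>
     (\<exists>M N. pseudomorphism A B M \<and> pseudomorphism B A N \<and>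
        isomorphic_mors A A (mor_id A) (mor_comp B A N M) \<and>
        isomorphic_mors B B (mor_comp A B M N) (mor_id B))"

end

end

theory Submission
  imports Defs
begin

text \<open>Write \<open>T\<close> for the 2-monad of \<open>P\<close>. Following Power, factor the structure map \<open>al : TX \<rightarrow> X\<close> as a
  functor that is the identity on objects followed by a fully faithful \<open>G : B \<rightarrow> X\<close>: the objects of
  \<open>B\<close> are those of \<open>TX\<close>, and its arrows \<open>z \<rightarrow> w\<close> are the arrows \<open>al z \<rightarrow> al w\<close> of \<open>X\<close>. The strict
  action on \<open>B\<close> is the multiplication of \<open>T\<close> on objects, and on an arrow \<open>F\<close> of \<open>TB\<close> it is the
  conjugate of \<open>al (TG F)\<close> by the associativity cell \<open>Phi\<close>. It is strictly associative and unital
  because the multiplication is, and \<open>G\<close> together with \<open>x \<mapsto> eta x\<close> gives the equivalence.\<close>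

section \<open>Block permutations of concatenated lists\<close>

text \<open>The formulas for the 2-monad evaluate a chosen member of a class, and the relation on
  arrows is closed under composition, so a class of arrows can be larger than an orbit. Much of the
  work is to show that the multiplication does not depend on representatives: equivariance settles
  the generators, functoriality of the operad composition settles the composites. Afterwards the
  monad is computed on representatives, where associativity and units hold strictly.

  The conjugate by \<open>Phi\<close> is forced: it is the only action on arrows for which
  \<open>Phi\<close> is natural from \<open>al\<close> after \<open>TG\<close> to \<open>G\<close>
  after the action. The monad laws give strictness on objects; on arrows the coherence of the cells
  enters. Both sides of the associativity law are conjugates of one arrow of \<open>X\<close>, and
  \<open>Phi_assoc\<close> makes the conjugating isomorphisms agree. The unit law needs
  \<open>Phi\<close> at \<open>[id; z]\<close> to be inverse to \<open>e\<close>, a second unit law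
  that is derived from the given one and \<open>Phi_assoc\<close>. Arrows of \<open>B\<close> carry
  their endpoints because one arrow of \<open>X\<close> may lie over several pairs of
  objects.\<close>

lemma block_decomp:
  fixes ks :: "nat list"
  assumes "i < sum_list ks"
  obtains j a where "j < length ks" "a < ks ! j" "i = sum_list (take j ks) + a"
proof -
  have "\<exists>j a. j < length ks \<and> a < ks ! j \<and> i = sum_list (take j ks) + a" using assms
  proof (induction ks arbitrary: i)
    case (Cons k ks)
    show ?case
    proof (cases "i < k")
      case True
      then show ?thesis by (intro exI[of _ 0] exI[of _ i]) simp
    next
      case False
      then have "i - k < sum_list ks" using Cons.prems by simp
      then obtain j a where "j < length ks" "a < ks ! j" "i - k = sum_list (take j ks) + a"
        using Cons.IH by blast
      with False show ?thesis by (intro exI[of _ "Suc j"] exI[of _ a]) simp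
    qed
  qed simp
  then show ?thesis using that by blast
qed

lemma sum_list_take_mono:
  fixes ks :: "nat list"
  assumes "i \<le> j"
  shows "sum_list (take i ks) \<le> sum_list (take j ks)"
proof -
  have "take j ks = take i ks @ take (j - i) (drop i ks)"
    using assms by (metis le_add_diff_inverse take_add)
  then show ?thesis by simp
qed

lemma block_less:
  fixes ks :: "nat list"
  assumes "j < length ks" "a < ks ! j"
  shows "sum_list (take j ks) + a < sum_list ks"
  using sum_list_take_mono[of "Suc j" "length ks" ks] assms
  by (simp add: take_Suc_conv_app_nth)

text \<open>Lists are indexed from 0 but permutations act on points counted from 1, so entry
  \<open>a\<close> of block \<open>j\<close> is the point
  \<open>Suc (sum_list (take j ks) + a)\<close>, and its block index is \<open>Suc j\<close>.
  Minimality holds because partial sums increase.\<close>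

lemma block_index_block:
  assumes "j < length ks" "a < ks ! j"
  shows "block_index ks (Suc (sum_list (take j ks) + a)) = Suc j"
  unfolding block_index_def
proof (rule Least_equality)
  show "Suc (sum_list (take j ks) + a) \<le> sum_list (take (Suc j) ks)"
    using assms by (simp add: take_Suc_conv_app_nth)
next
  fix y assume "Suc (sum_list (take j ks) + a) \<le> sum_list (take y ks)"
  then show "Suc j \<le> y" using sum_list_take_mono[of y j ks] by (cases "y \<le> j") auto
qed

lemma block_pos_block:
  assumes "j < length ks" "a < ks ! j"
  shows "block_pos ks (Suc (sum_list (take j ks) + a)) = Suc a"
  by (simp add: block_pos_def block_index_block[OF assms])

lemma concat_nth_block:
  assumes "j < length xss" "a < length (xss ! j)"
  shows "concat xss ! (sum_list (take j (map length xss)) + a) = xss ! j ! a"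
  using assms
proof (induction xss arbitrary: j)
  case (Cons xs xss)
  then show ?case by (cases j) (simp_all add: nth_append)
qed simp

context lambda_operad
begin

lemma proj_Suc:
  assumes "g \<in> carrier (lgrp L n)" "i < n"
  shows "lproj L n g (Suc i) - 1 < n" "Suc (lproj L n g (Suc i) - 1) = lproj L n g (Suc i)"
  using permutes_in_image[OF proj_permutes[OF assms(1)], of "Suc i"] assms(2) by auto

lemma inv_proj_Suc:
  assumes "g \<in> carrier (lgrp L n)" "i < n"
  shows "Suc (inv' (lproj L n g) (Suc i) - 1) = inv' (lproj L n g) (Suc i)"
  using permutes_in_image[OF permutes_inv[OF proj_permutes[OF assms(1)]], of "Suc i"] assms(2)
  by auto

text \<open>\<open>lact\<close> reads entries through the inverse permutation, whereas
  \<open>proj_mu\<close> and \<open>sym_mu\<close> describe the permutation itself. This rule asks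
  where each entry is sent, so that the inverse of a block permutation never has to be
  computed.\<close>

lemma lact_eqI:
  assumes g: "g \<in> carrier (lgrp L n)" and l: "length xs = n" "length ys = n"
    and e: "\<And>i. i < n \<Longrightarrow> entry ys (lproj L n g (Suc i)) = xs ! i"
  shows "lact n g xs = ys"
proof (rule nth_equalityI)
  fix i assume "i < length (lact n g xs)"
  then have i: "i < n" using l by simp
  show "lact n g xs ! i = ys ! i"
    using e[OF lact_index[OF g i]] i l
    unfolding inv_proj_Suc[OF g i] permutes_inverses(1)[OF proj_permutes[OF g]]
    by (simp add: nth_lact)
qed (use l in simp)

lemma nth_lact_proj:
  assumes "g \<in> carrier (lgrp L n)" "i < length xs" "length xs = n"
  shows "entry (lact n g xs) (lproj L n g (Suc i)) = xs ! i"
  using proj_Suc[OF assms(1), of i] assms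
  by (simp add: nth_lact permutes_inverses(2)[OF proj_permutes[OF assms(1)]])

lemma one_in: "\<one>\<^bsub>lgrp L n\<^esub> \<in> carrier (lgrp L n)"
  by (rule monoid.one_closed[OF group.is_monoid[OF L_group]])

lemma proj_one: "lproj L n \<one>\<^bsub>lgrp L n\<^esub> = id"
proof -
  interpret h: group_hom "lgrp L n" "sym_group n" "lproj L n"
    by (intro group_hom.intro group_hom_axioms.intro L_group sym_group_is_group proj_hom)
  show ?thesis using h.hom_one by (simp add: sym_group_def)
qed

lemma lmu_in:
  assumes "g \<in> carrier (lgrp L (length ks))" "list_all2 (\<lambda>k f. f \<in> carrier (lgrp L k)) ks fs"
  shows "lmu L ks g fs \<in> carrier (lgrp L (sum_list ks))"
  using set_operad.m_in[OF L_operad, of g ks fs] assms by (simp add: tuples_def)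

text \<open>\<open>sym_beta\<close> moves a point inside its own block, so \<open>sym_delta\<close>
  still sees block \<open>Suc j\<close> and only changes the offset of that block.\<close>

lemma sym_mu_block:
  assumes j: "j < length ks" "a < ks ! j" and t: "ts ! j permutes {1..ks ! j}"
  shows "sym_mu ks s ts (Suc (sum_list (take j ks) + a))
    = (\<Sum>i\<in>{i \<in> {1..length ks}. s i < s (Suc j)}. entry ks i) + (ts ! j) (Suc a)"
proof -
  have "(ts ! j) (Suc a) \<in> {1..ks ! j}"
    using permutes_in_image[OF t, of "Suc a"] j by simp
  then obtain b where b: "(ts ! j) (Suc a) = Suc b" "b < ks ! j" by (cases "(ts ! j) (Suc a)") auto
  show ?thesis
    using block_less[OF j] block_less[OF j(1) b(2)]
    by (simp add: sym_mu_def sym_beta_def sym_delta_def block_index_block block_pos_block j b)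
qed

text \<open>The offset formula of \<open>sym_delta\<close> for blocks in their natural order; the
  formula for a general permutation is brought to this one by reindexing.\<close>

lemma sum_entry_less:
  assumes "j \<le> length ks"
  shows "(\<Sum>i\<in>{i \<in> {1..length ks}. i < Suc j}. entry ks i) = sum_list (take j ks)"
proof -
  have "(\<Sum>i\<in>{i \<in> {1..length ks}. i < Suc j}. entry ks i) = (\<Sum>i\<in>{0..<j}. ks ! i)"
    by (rule sum.reindex_bij_witness[of _ Suc "\<lambda>i. i - 1"]) (use assms in auto)
  also have "\<dots> = sum_list (take j ks)"
    using assms by (simp add: sum_list_sum_nth)
  finally show ?thesis .
qed

lemma lbeta_in:
  assumes "list_all2 (\<lambda>k f. f \<in> carrier (lgrp L k)) ks gs"
  shows "lbeta ks gs \<in> carrier (lgrp L (sum_list ks))"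
  unfolding lbeta_def by (intro lmu_in assms one_in)

lemma ldelta_in:
  assumes "g \<in> carrier (lgrp L (length ks))"
  shows "ldelta ks g \<in> carrier (lgrp L (sum_list ks))"
  unfolding ldelta_def
  by (intro lmu_in assms) (simp add: list_all2_conv_all_nth one_in)

text \<open>\<open>lbeta ks gs\<close> projects to the block sum of the permutations of the
  \<open>gs\<close>, which leaves every block in its place. This is the list side of
  \<open>equivar_beta\<close>.\<close>

lemma lact_lbeta:
  assumes g: "list_all2 (\<lambda>k g. g \<in> carrier (lgrp L k)) ks gs" and l: "map length xss = ks"
  shows "lact (sum_list ks) (lbeta ks gs) (concat xss)
    = concat (map (\<lambda>(k, g, xs). lact k g xs) (zip ks (zip gs xss)))"
proof (rule lact_eqI[OF lbeta_in[OF g]])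
  let ?yss = "map (\<lambda>(k, g, xs). lact k g xs) (zip ks (zip gs xss))"
  have lg: "length gs = length ks" using g by (simp add: list_all2_lengthD)
  have lx: "length xss = length ks" using l by (metis length_map)
  have lxj: "length (xss ! j) = ks ! j" if "j < length ks" for j using l lx that by (metis nth_map)
  have ly: "map length ?yss = ks" by (rule nth_equalityI) (simp_all add: lg lx lxj)
  show "length (concat xss) = sum_list ks" using l by (simp add: length_concat)
  show "length (concat ?yss) = sum_list ks" using ly by (simp only: length_concat)
  fix i assume "i < sum_list ks"
  then obtain j a where j: "j < length ks" "a < ks ! j" and i: "i = sum_list (take j ks) + a"
    by (rule block_decomp)
  have gj: "gs ! j \<in> carrier (lgrp L (ks ! j))" using g j by (simp add: list_all2_conv_all_nth)
  have xj: "length (xss ! j) = ks ! j" using l j(1) lx by (metis nth_map)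
  let ?t = "lproj L (ks ! j) (gs ! j)"
  have "lproj L (sum_list ks) (lbeta ks gs) = sym_mu ks id (map2 (lproj L) ks gs)"
    using proj_mu[of "\<one>\<^bsub>lgrp L (length ks)\<^esub>" ks gs] g
    by (simp add: lbeta_def proj_one tuples_def one_in)
  then have p: "lproj L (sum_list ks) (lbeta ks gs) (Suc i) = sum_list (take j ks) + ?t (Suc a)"
    using sym_mu_block[OF j, of "map2 (lproj L) ks gs" id] proj_permutes[OF gj] j lg
      sum_entry_less[of j ks]
    by (simp add: i)
  have t: "?t (Suc a) - 1 < ks ! j" "Suc (?t (Suc a) - 1) = ?t (Suc a)"
    using proj_Suc[OF gj j(2)] by auto
  then have "entry (concat ?yss) (lproj L (sum_list ks) (lbeta ks gs) (Suc i))
      = concat ?yss ! (sum_list (take j (map length ?yss)) + (?t (Suc a) - 1))"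
    unfolding p ly by (simp del: map_eq_conv)
  also have "\<dots> = ?yss ! j ! (?t (Suc a) - 1)"
    by (rule concat_nth_block) (use j lg lx t xj in simp_all)
  also have "\<dots> = xss ! j ! a"
    using nth_lact_proj[OF gj, of a "xss ! j"] j lg lx xj by simp
  also have "\<dots> = concat xss ! i"
    using concat_nth_block[of j xss a] j lx xj l by (simp add: i)
  finally show "entry (concat ?yss) (lproj L (sum_list ks) (lbeta ks gs) (Suc i)) = concat xss ! i" .
qed

lemma sum_list_lact:
  fixes ks :: "nat list"
  assumes g: "g \<in> carrier (lgrp L (length ks))"
  shows "sum_list (lact (length ks) g ks) = sum_list ks"
proof -
  let ?s = "lproj L (length ks) g"
  note perm = proj_permutes[OF g]
  have "sum_list (lact (length ks) g ks) = (\<Sum>i\<in>{0..<length ks}. entry ks (inv' ?s (Suc i)))"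
    by (simp add: sum_list_sum_nth nth_lact)
  also have "\<dots> = (\<Sum>i\<in>{0..<length ks}. ks ! i)"
    by (rule sum.reindex_bij_witness[of _ "\<lambda>i. ?s (Suc i) - 1" "\<lambda>i. inv' ?s (Suc i) - 1"])
      (use proj_Suc[OF g] inv_proj_Suc[OF g] lact_index[OF g] in
        \<open>auto simp: permutes_inverses[OF perm]\<close>)
  finally show ?thesis by (simp add: sum_list_sum_nth)
qed

lemma lact_one: "length xs = n \<Longrightarrow> lact n \<one>\<^bsub>lgrp L n\<^esub> xs = xs"
  by (rule lact_eqI[OF one_in]) (simp_all add: proj_one)

text \<open>\<open>ldelta ks g\<close> moves whole blocks without disturbing their interior. This is
  the list side of \<open>equivar_delta\<close>.\<close>

lemma lact_ldelta:
  assumes g: "g \<in> carrier (lgrp L (length ks))" and l: "map length xss = ks"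
  shows "lact (sum_list ks) (ldelta ks g) (concat xss) = concat (lact (length ks) g xss)"
proof (rule lact_eqI[OF ldelta_in[OF g]])
  let ?yss = "lact (length ks) g xss" and ?s = "lproj L (length ks) g"
  have lx: "length xss = length ks" using l by (metis length_map)
  have ly: "map length ?yss = lact (length ks) g ks"
    using lact_map[OF g lx, of length] l by simp
  note perm = proj_permutes[OF g]
  \<comment> \<open>The blocks that end up before block \<open>j\<close> are those with a smaller
    image. Reindexed along the permutation, their lengths form an initial segment of the permuted
    list of lengths.\<close>
  have offset: "(\<Sum>i\<in>{i \<in> {1..length ks}. ?s i < ?s (Suc j)}. entry ks i)
      = sum_list (take (?s (Suc j) - 1) (map length ?yss))" if j: "j < length ks" for j
  proof -
    have "(\<Sum>i\<in>{i \<in> {1..length ks}. ?s i < ?s (Suc j)}. entry ks i)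
      = (\<Sum>i\<in>{i \<in> {1..length ks}. i < ?s (Suc j)}. entry (map length ?yss) i)"
    proof (rule sum.reindex_bij_witness[of _ "inv' ?s" ?s])
      fix i assume i: "i \<in> {i \<in> {1..length ks}. ?s i < ?s (Suc j)}"
      show "inv' ?s (?s i) = i" by (rule permutes_inverses(2)[OF perm])
      show "?s i \<in> {i \<in> {1..length ks}. i < ?s (Suc j)}"
        using i permutes_in_image[OF perm, of i] by simp
      show "entry (map length ?yss) (?s i) = entry ks i"
        using nth_lact_proj[OF g, of "i - 1" ks] i by (auto simp: ly)
    next
      fix i assume i: "i \<in> {i \<in> {1..length ks}. i < ?s (Suc j)}"
      show "?s (inv' ?s i) = i" by (rule permutes_inverses(1)[OF perm])
      then show "inv' ?s i \<in> {i \<in> {1..length ks}. ?s i < ?s (Suc j)}"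
        using i permutes_in_image[OF permutes_inv[OF perm], of i] by simp
    qed
    also have "\<dots> = sum_list (take (?s (Suc j) - 1) (map length ?yss))"
      using sum_entry_less[of "?s (Suc j) - 1" "map length ?yss"] proj_Suc[OF g j] lx by simp
    finally show ?thesis .
  qed
  show "length (concat xss) = sum_list ks" using l by (simp add: length_concat)
  show "length (concat ?yss) = sum_list ks" using ly sum_list_lact[OF g] by (simp only: length_concat)
  fix i assume "i < sum_list ks"
  then obtain j a where j: "j < length ks" "a < ks ! j" and i: "i = sum_list (take j ks) + a"
    by (rule block_decomp)
  have xj: "length (xss ! j) = ks ! j" using l j(1) lx by (metis nth_map)
  let ?ids = "map2 (lproj L) ks (map (\<lambda>k. \<one>\<^bsub>lgrp L k\<^esub>) ks)"
  have "lproj L (sum_list ks) (ldelta ks g) = sym_mu ks ?s ?ids"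
    using proj_mu[OF g, of "map (\<lambda>k. \<one>\<^bsub>lgrp L k\<^esub>) ks"]
    by (simp add: ldelta_def tuples_def list_all2_conv_all_nth one_in)
  moreover have "?ids ! j = id" using j by (simp add: proj_one)
  ultimately have p: "lproj L (sum_list ks) (ldelta ks g) (Suc i)
      = sum_list (take (?s (Suc j) - 1) (map length ?yss)) + Suc a"
    using sym_mu_block[OF j, of ?ids ?s] permutes_id[of "{1..ks ! j}"] offset[OF j(1)]
    by (simp only: i id_apply)
  have y: "?yss ! (?s (Suc j) - 1) = xss ! j"
    using nth_lact_proj[OF g, of j xss] j lx by simp
  have "entry (concat ?yss) (lproj L (sum_list ks) (ldelta ks g) (Suc i))
      = concat ?yss ! (sum_list (take (?s (Suc j) - 1) (map length ?yss)) + a)"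
    unfolding p by simp
  also have "\<dots> = xss ! j ! a"
    using concat_nth_block[of "?s (Suc j) - 1" ?yss a] proj_Suc[OF g j(1)] y lx xj j by simp
  also have "\<dots> = concat xss ! i"
    using concat_nth_block[of j xss a] j lx xj l by (simp add: i)
  finally show "entry (concat ?yss) (lproj L (sum_list ks) (ldelta ks g) (Suc i)) = concat xss ! i" .
qed

end

section \<open>Representatives of objects and arrows of the 2-monad\<close>

lemma coprod_category:
  assumes "\<And>n. category (C n)"
  shows "category (coprod_cat C)"
proof -
  note c = category.Dom_in[OF assms] category.Cod_in[OF assms] category.Id_in[OF assms]
    category.Dom_Id[OF assms] category.Cod_Id[OF assms] category.Comp_in[OF assms]
    category.Dom_Comp[OF assms] category.Cod_Comp[OF assms] category.Comp_Id[OF assms]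
    category.Id_Comp[OF assms] category.Comp_assoc[OF assms]
  show ?thesis by unfold_locales (auto simp: coprod_cat_def c)
qed

lemma is_functorD:
  assumes "is_functor C D F"
  shows "x \<in> Obj C \<Longrightarrow> omap F x \<in> Obj D" "f \<in> Arr C \<Longrightarrow> amap F f \<in> Arr D"
    "f \<in> Arr C \<Longrightarrow> Dom D (amap F f) = omap F (Dom C f)"
    "f \<in> Arr C \<Longrightarrow> Cod D (amap F f) = omap F (Cod C f)"
    "x \<in> Obj C \<Longrightarrow> amap F (Id C x) = Id D (omap F x)"
    "\<lbrakk>g \<in> Arr C; f \<in> Arr C; Dom C g = Cod C f\<rbrakk>
      \<Longrightarrow> amap F (Comp C g f) = Comp D (amap F g) (amap F f)"
  using assms by (auto simp: is_functor_def)

lemma is_nat_transD: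
  assumes "is_nat_trans C D F G t"
  shows "x \<in> Obj C \<Longrightarrow> t x \<in> Arr D" "x \<in> Obj C \<Longrightarrow> Dom D (t x) = omap F x"
    "x \<in> Obj C \<Longrightarrow> Cod D (t x) = omap G x"
    "f \<in> Arr C \<Longrightarrow> Comp D (t (Cod C f)) (amap F f) = Comp D (amap G f) (t (Dom C f))"
  using assms by (auto simp: is_nat_trans_def)

context lambda_operad
begin

text \<open>\<open>Tcat X\<close> before the quotient. With the arity stored in the element,
  \<open>obj_cl\<close> and \<open>arr_cl\<close> are the projections to \<open>Tcat X\<close> and
  \<open>repr\<close> is a section of them.\<close>

definition raw :: "('o, 'a) cat \<Rightarrow> (nat \<times> 'po \<times> 'o list, nat \<times> 'pa \<times> 'a list) cat" where
  "raw X = coprod_cat (\<lambda>n. power_cat n X)"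

definition obj_cl :: "('o, 'a) cat \<Rightarrow> nat \<times> 'po \<times> 'o list \<Rightarrow> ('po, 'o) tens" where
  "obj_cl X r = (fst r, obj_class (fst r) X (snd r))"

definition arr_cl :: "('o, 'a) cat \<Rightarrow> nat \<times> 'pa \<times> 'a list \<Rightarrow> ('pa, 'a) tens" where
  "arr_cl X r = (fst r, arr_class (fst r) X (snd r))"

definition repr :: "('p, 'x) tens \<Rightarrow> nat \<times> 'p \<times> 'x list" where
  "repr z = (fst z, rep (snd z))"

lemma fst_cl [simp]: "fst (obj_cl X r) = fst r" "fst (arr_cl X s) = fst s" "fst (repr z) = fst z"
  by (simp_all add: obj_cl_def arr_cl_def repr_def)

lemma Obj_raw: "r \<in> Obj (raw X) \<longleftrightarrow> fst (snd r) \<in> Obj (pcat P (fst r)) \<and>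
    length (snd (snd r)) = fst r \<and> set (snd (snd r)) \<subseteq> Obj X"
  by (cases r) (auto simp: raw_def coprod_cat_def Obj_power subset_iff in_set_conv_nth)

lemma Arr_raw: "r \<in> Arr (raw X) \<longleftrightarrow> fst (snd r) \<in> Arr (pcat P (fst r)) \<and>
    length (snd (snd r)) = fst r \<and> set (snd (snd r)) \<subseteq> Arr X"
  by (cases r) (auto simp: raw_def coprod_cat_def Arr_power subset_iff in_set_conv_nth)

lemma raw_power: "r \<in> Obj (raw X) \<longleftrightarrow> snd r \<in> Obj (power_cat (fst r) X)"
    "s \<in> Arr (raw X) \<longleftrightarrow> snd s \<in> Arr (power_cat (fst s) X)"
  by (cases r; cases s; simp add: raw_def coprod_cat_def)+

lemma raw_maps:
  "length (snd (snd r)) = fst r \<Longrightarrow>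
    Dom (raw X) r = (fst r, Dom (pcat P (fst r)) (fst (snd r)), map (Dom X) (snd (snd r)))"
  "length (snd (snd r)) = fst r \<Longrightarrow>
    Cod (raw X) r = (fst r, Cod (pcat P (fst r)) (fst (snd r)), map (Cod X) (snd (snd r)))"
  "length (snd (snd x)) = fst x \<Longrightarrow>
    Id (raw X) x = (fst x, Id (pcat P (fst x)) (fst (snd x)), map (Id X) (snd (snd x)))"
  "length (snd (snd r)) = fst r \<Longrightarrow> length (snd (snd s)) = fst r \<Longrightarrow>
    Comp (raw X) r s = (fst r, Comp (pcat P (fst r)) (fst (snd r)) (fst (snd s)),
      map2 (Comp X) (snd (snd r)) (snd (snd s)))"
  by (cases r; cases s; cases x;
      simp add: raw_def coprod_cat_def Dom_power Cod_power Id_power Comp_power)+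

lemma raw_category: "category X \<Longrightarrow> category (raw X)"
  unfolding raw_def by (intro coprod_category power_category)

lemma Tcat_category: "category X \<Longrightarrow> category (Tcat X)"
  unfolding Tcat_def by (intro coprod_category tensor_category)

lemma obj_cl_in: "r \<in> Obj (raw X) \<Longrightarrow> obj_cl X r \<in> Obj (Tcat X)"
  and arr_cl_in: "s \<in> Arr (raw X) \<Longrightarrow> arr_cl X s \<in> Arr (Tcat X)"
  by (auto simp: raw_power Tcat_def coprod_cat_def obj_cl_def arr_cl_def tensor_Obj tensor_Arr)

lemma raw_fst:
  "fst (Dom (raw X) s) = fst s" "fst (Cod (raw X) s) = fst s" "fst (Id (raw X) r) = fst r"
  "fst (Comp (raw X) s s') = fst s"
  by (cases s; cases r; cases s'; simp add: raw_def coprod_cat_def)+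

lemma Tcat_maps:
  assumes X: "category X"
  shows "s \<in> Arr (raw X) \<Longrightarrow> Dom (Tcat X) (arr_cl X s) = obj_cl X (Dom (raw X) s)"
    and "s \<in> Arr (raw X) \<Longrightarrow> Cod (Tcat X) (arr_cl X s) = obj_cl X (Cod (raw X) s)"
    and "r \<in> Obj (raw X) \<Longrightarrow> Id (Tcat X) (obj_cl X r) = arr_cl X (Id (raw X) r)"
    and "\<lbrakk>s \<in> Arr (raw X); s' \<in> Arr (raw X); Dom (raw X) s = Cod (raw X) s'\<rbrakk>
      \<Longrightarrow> Comp (Tcat X) (arr_cl X s) (arr_cl X s') = arr_cl X (Comp (raw X) s s')"
proof -
  show "s \<in> Arr (raw X) \<Longrightarrow> Dom (Tcat X) (arr_cl X s) = obj_cl X (Dom (raw X) s)"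
    "s \<in> Arr (raw X) \<Longrightarrow> Cod (Tcat X) (arr_cl X s) = obj_cl X (Cod (raw X) s)"
    "r \<in> Obj (raw X) \<Longrightarrow> Id (Tcat X) (obj_cl X r) = arr_cl X (Id (raw X) r)"
    by (cases s; cases r; simp add: Tcat_def raw_def coprod_cat_def obj_cl_def arr_cl_def
        tensor_Dom[OF X] tensor_Id[OF X])+
  assume a: "s \<in> Arr (raw X)" "s' \<in> Arr (raw X)" and d: "Dom (raw X) s = Cod (raw X) s'"
  then have "fst s = fst s'" by (metis raw_fst(1,2))
  with a d show "Comp (Tcat X) (arr_cl X s) (arr_cl X s') = arr_cl X (Comp (raw X) s s')"
    by (cases s; cases s'; simp add: Tcat_def raw_def coprod_cat_def arr_cl_def tensor_Comp[OF X])
qed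

lemma repr_obj:
  assumes "z \<in> Obj (Tcat X)"
  shows "repr z \<in> Obj (raw X)" "obj_cl X (repr z) = z"
proof -
  obtain n K where z: "z = (n, K)" by (cases z)
  then have "K \<in> Obj (tensor n X)" using assms by (simp add: Tcat_def coprod_cat_def)
  then obtain x where x: "x \<in> Obj (power_cat n X)" "K = obj_class n X x" by (rule tensor_Obj_cases)
  from rep_obj_class[OF x(1)] have e: "obj_eq n X x (rep K)" by (simp add: x(2))
  show "repr z \<in> Obj (raw X)" using obj_eq_Obj[OF e] by (simp add: z repr_def raw_power)
  show "obj_cl X (repr z) = z" using obj_class_eq[OF e] by (simp add: z repr_def obj_cl_def x(2))
qed

lemma repr_arr:
  assumes X: "category X" and "z \<in> Arr (Tcat X)"
  shows "repr z \<in> Arr (raw X)" "arr_cl X (repr z) = z"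
proof -
  obtain n K where z: "z = (n, K)" by (cases z)
  then have "K \<in> Arr (tensor n X)" using assms by (simp add: Tcat_def coprod_cat_def)
  then obtain x where x: "x \<in> Arr (power_cat n X)" "K = arr_class n X x" by (rule tensor_Arr_cases)
  from rep_arr_class[OF x(1)] have e: "arr_eq n X x (rep K)" by (simp add: x(2))
  show "repr z \<in> Arr (raw X)" using arr_eq_Arr[OF X e] by (simp add: z repr_def raw_power)
  show "arr_cl X (repr z) = z" using arr_class_eq[OF e] by (simp add: z repr_def arr_cl_def x(2))
qed

text \<open>The chosen representatives of two composable classes need not be composable. Acting by a
  group element moves the domain of an arrow anywhere within its class, so one of the two can be
  adjusted to the other.\<close>

lemma arr_cl_composable:
  assumes X: "category X" and "z \<in> Arr (Tcat X)" "s \<in> Arr (raw X)"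
    "Dom (Tcat X) z = Cod (Tcat X) (arr_cl X s)"
  obtains s' where "s' \<in> Arr (raw X)" "arr_cl X s' = z" "Dom (raw X) s' = Cod (raw X) s"
proof -
  obtain n a where s: "s = (n, a)" by (cases s)
  have a: "a \<in> Arr (power_cat n X)" using assms(3) s by (simp add: raw_power)
  obtain K where z: "z = (n, K)"
    using assms(4) by (cases z) (simp add: s Tcat_def coprod_cat_def arr_cl_def)
  have K: "K \<in> Arr (tensor n X)" using assms(2) z by (simp add: Tcat_def coprod_cat_def)
  have d: "Dom (tensor n X) K = Cod (tensor n X) (arr_class n X a)"
    using assms(4) by (simp add: s z Tcat_def coprod_cat_def arr_cl_def)
  from tensor_composable[OF X K a d] obtain b where
    "b \<in> Arr (power_cat n X)" "K = arr_class n X b" "Dom (power_cat n X) b = Cod (power_cat n X) a" .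
  then show ?thesis using that[of "(n, b)"] a
    by (simp add: raw_power s z arr_cl_def raw_def coprod_cat_def)
qed

definition obj_rel :: "('o, 'a) cat \<Rightarrow> nat \<times> 'po \<times> 'o list \<Rightarrow> nat \<times> 'po \<times> 'o list \<Rightarrow> bool" where
  "obj_rel X r s \<longleftrightarrow> fst r = fst s \<and> obj_eq (fst r) X (snd r) (snd s)"

definition arr_rel :: "('o, 'a) cat \<Rightarrow> nat \<times> 'pa \<times> 'a list \<Rightarrow> nat \<times> 'pa \<times> 'a list \<Rightarrow> bool" where
  "arr_rel X r s \<longleftrightarrow> fst r = fst s \<and> arr_eq (fst r) X (snd r) (snd s)"

lemma obj_rel_iff: "r \<in> Obj (raw X) \<Longrightarrow> s \<in> Obj (raw X) \<Longrightarrow> obj_cl X r = obj_cl X s \<longleftrightarrow> obj_rel X r s"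
  unfolding obj_rel_def obj_cl_def raw_power
  by (metis fst_conv obj_class_eq obj_class_eq_iff obj_eq.sym snd_conv)

lemma arr_rel_iff: "r \<in> Arr (raw X) \<Longrightarrow> s \<in> Arr (raw X) \<Longrightarrow> arr_cl X r = arr_cl X s \<longleftrightarrow> arr_rel X r s"
  unfolding arr_rel_def arr_cl_def raw_power
  by (metis fst_conv arr_class_eq arr_class_eq_iff arr_eq.sym snd_conv)

lemma arr_rel_comp:
  assumes "arr_rel X b b'" "arr_rel X a a'" "Dom (raw X) b = Cod (raw X) a"
    "Dom (raw X) b' = Cod (raw X) a'"
  shows "arr_rel X (Comp (raw X) b a) (Comp (raw X) b' a')"
  using assms arr_eq.comp[of "fst b" X "snd b" "snd b'" "snd a" "snd a'"]
  by (cases b; cases b'; cases a; cases a') (auto simp: arr_rel_def raw_def coprod_cat_def)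

subsection \<open>Functors and 2-cells\<close>

definition raw_map :: "('x \<Rightarrow> 'y) \<Rightarrow> nat \<times> 'p \<times> 'x list \<Rightarrow> nat \<times> 'p \<times> 'y list" where
  "raw_map h r = (fst r, fst (snd r), map h (snd (snd r)))"

definition raw_cell :: "('x \<Rightarrow> 'b) \<Rightarrow> nat \<times> 'po \<times> 'x list \<Rightarrow> nat \<times> 'pa \<times> 'b list" where
  "raw_cell t r = (fst r, Id (pcat P (fst r)) (fst (snd r)), map t (snd (snd r)))"

lemma obj_eq_map:
  assumes h: "\<And>x. x \<in> Obj X \<Longrightarrow> h x \<in> Obj Y"
  shows "obj_eq n X z w \<Longrightarrow> obj_eq n Y (fst z, map h (snd z)) (fst w, map h (snd w))"
proof (induction rule: obj_eq.induct)
  case (gen p xs g)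
  have "(p, map h xs) \<in> Obj (power_cat n Y)" using gen(1) h by (simp add: Obj_power)
  from obj_eq.gen[OF this gen(2)] show ?case using gen lact_map[OF gen(2), of xs h]
    by (simp add: Obj_power)
next
  case (refl z)
  then show ?case using h by (intro obj_eq.refl) (simp add: Obj_power)
qed (auto intro: obj_eq.sym obj_eq.trans)

lemma arr_eq_map:
  assumes X: "category X" and F: "is_functor X Y F"
  shows "arr_eq n X z w \<Longrightarrow> arr_eq n Y (fst z, map (amap F) (snd z)) (fst w, map (amap F) (snd w))"
proof (induction rule: arr_eq.induct)
  case (gen p fs g)
  have "(p, map (amap F) fs) \<in> Arr (power_cat n Y)" using gen(1) is_functorD[OF F] by (simp add: Arr_power)
  from arr_eq.gen[OF this gen(2)] show ?case using gen lact_map[OF gen(2), of fs "amap F"]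
    by (simp add: Arr_power)
next
  case (refl z)
  then show ?case using is_functorD[OF F] by (intro arr_eq.refl) (simp add: Arr_power)
next
  case (comp b b' a a')
  \<comment> \<open>Applied entrywise, a functor preserves composability and composites in the power
    category, so it respects the closure under composition.\<close>
  have *: "(fst (Comp (power_cat n X) b a), map (amap F) (snd (Comp (power_cat n X) b a)))
      = Comp (power_cat n Y) (fst b, map (amap F) (snd b)) (fst a, map (amap F) (snd a))"
    "Dom (power_cat n Y) (fst b, map (amap F) (snd b)) = Cod (power_cat n Y) (fst a, map (amap F) (snd a))"
    if "b \<in> Arr (power_cat n X)" "a \<in> Arr (power_cat n X)"
      "Dom (power_cat n X) b = Cod (power_cat n X) a" for b a
  proof -
    have l: "length (snd b) = n" "length (snd a) = n" using that by (simp_all add: Arr_power)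
    with that(3) have d: "map (Dom X) (snd b) = map (Cod X) (snd a)"
      "Dom (pcat P n) (fst b) = Cod (pcat P n) (fst a)"
      by (simp_all add: Dom_power Cod_power)
    have d': "Dom X (snd b ! i) = Cod X (snd a ! i)" if "i < n" for i
      using d l that by (metis nth_map)
    show "(fst (Comp (power_cat n X) b a), map (amap F) (snd (Comp (power_cat n X) b a)))
      = Comp (power_cat n Y) (fst b, map (amap F) (snd b)) (fst a, map (amap F) (snd a))"
      using that(1,2) l d' by (auto simp: Comp_power Arr_power is_functorD(6)[OF F] intro!: nth_equalityI)
    show "Dom (power_cat n Y) (fst b, map (amap F) (snd b)) = Cod (power_cat n Y) (fst a, map (amap F) (snd a))"
      using that(1,2) l d(2) d' by (auto simp: Dom_power Cod_power Arr_power is_functorD(3,4)[OF F] intro!: nth_equalityI)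
  qed
  have "b \<in> Arr (power_cat n X)" "b' \<in> Arr (power_cat n X)" "a \<in> Arr (power_cat n X)" "a' \<in> Arr (power_cat n X)"
    using arr_eq_Arr[OF X comp(1)] arr_eq_Arr[OF X comp(2)] by auto
  then show ?case using comp(3-6) * by (simp add: arr_eq.comp)
qed (auto intro: arr_eq.sym arr_eq.trans)

text \<open>The relation on objects is generated by the action alone, and the action takes
  identities of \<open>P(n)\<close> to identities. Apart from 2-cells, the case where
  \<open>t\<close> is \<open>Id\<close> turns related objects into related identity arrows.\<close>

lemma arr_eq_cell:
  assumes t: "\<And>x. x \<in> Obj X \<Longrightarrow> t x \<in> Arr Y"
  shows "obj_eq n X z w \<Longrightarrow>
    arr_eq n Y (Id (pcat P n) (fst z), map t (snd z)) (Id (pcat P n) (fst w), map t (snd w))"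
proof (induction rule: obj_eq.induct)
  case (gen p xs g)
  have p: "p \<in> Obj (pcat P n)" using gen(1) by (simp add: Obj_power)
  have "(Id (pcat P n) p, map t xs) \<in> Arr (power_cat n Y)"
    using gen(1) t category.Id_in[OF P_cat] by (simp add: Arr_power Obj_power)
  from arr_eq.gen[OF this gen(2)] show ?case
    using gen(1) lact_map[OF gen(2), of xs t] by (simp add: Obj_power act_functor(5)[OF gen(2)])
next
  case (refl z)
  then show ?case using t category.Id_in[OF P_cat] by (intro arr_eq.refl) (simp add: Arr_power Obj_power)
qed (auto intro: arr_eq.sym arr_eq.trans)

lemma repr_obj_rel:
  assumes "r \<in> Obj (raw X)"
  shows "obj_rel X r (repr (obj_cl X r))"
  using repr_obj[OF obj_cl_in[OF assms]] obj_rel_iff[OF assms] by metis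

lemma repr_arr_rel:
  assumes "category X" "r \<in> Arr (raw X)"
  shows "arr_rel X r (repr (arr_cl X r))"
  using repr_arr[OF assms(1) arr_cl_in[OF assms(2)]] arr_rel_iff[OF assms(2)] by metis

lemma Tfun_repr:
  "omap (Tfun Y F) z = obj_cl Y (raw_map (omap F) (repr z))"
  "amap (Tfun Y F) w = arr_cl Y (raw_map (amap F) (repr w))"
  "Tcell Y t z = arr_cl Y (raw_cell t (repr z))"
  by (simp_all add: Tfun_def Tcell_def obj_cl_def arr_cl_def raw_map_def raw_cell_def repr_def split: prod.split)

text \<open>Independence of the representative that \<open>Tfun\<close> evaluates. The hypothesis
  speaks of objects so that the lemma also applies to \<open>Tmu X\<close>, which is used through
  \<open>Tmu_maps\<close> rather than as a functor.\<close>

lemma Tfun_obj: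
  assumes F: "\<And>x. x \<in> Obj X \<Longrightarrow> omap F x \<in> Obj Y" and r: "r \<in> Obj (raw X)"
  shows "omap (Tfun Y F) (obj_cl X r) = obj_cl Y (raw_map (omap F) r)"
  using obj_class_eq[OF obj_eq_map[of X "omap F" Y, OF F]] repr_obj_rel[OF r]
  by (simp add: Tfun_repr obj_cl_def raw_map_def obj_rel_def)

lemma Tfun_arr:
  assumes X: "category X" and F: "is_functor X Y F" and r: "r \<in> Arr (raw X)"
  shows "amap (Tfun Y F) (arr_cl X r) = arr_cl Y (raw_map (amap F) r)"
  using arr_class_eq[OF arr_eq_map[OF X F]] repr_arr_rel[OF X r]
  by (simp add: Tfun_repr arr_cl_def raw_map_def arr_rel_def)

lemma Tcell_cl:
  assumes t: "\<And>x. x \<in> Obj X \<Longrightarrow> t x \<in> Arr Y" and r: "r \<in> Obj (raw X)"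
  shows "Tcell Y t (obj_cl X r) = arr_cl Y (raw_cell t r)"
  using arr_class_eq[OF arr_eq_cell[of X t Y, OF t]] repr_obj_rel[OF r]
  by (simp add: Tfun_repr arr_cl_def obj_cl_def raw_cell_def obj_rel_def)

lemma raw_map_functor:
  assumes F: "is_functor X Y F"
  shows "is_functor (raw X) (raw Y) \<lparr>omap = raw_map (omap F), amap = raw_map (amap F)\<rparr>"
proof -
  have c: "map (amap F) (map2 (Comp X) gs fs) = map2 (Comp Y) (map (amap F) gs) (map (amap F) fs)"
    if "length gs = length fs" "map (Dom X) gs = map (Cod X) fs" "set gs \<subseteq> Arr X" "set fs \<subseteq> Arr X" for gs fs
    using that by (induction gs fs rule: list_induct2) (auto simp: is_functorD[OF F])
  show ?thesis unfolding is_functor_def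
    by (auto simp: Obj_raw Arr_raw raw_map_def raw_maps subset_iff is_functorD[OF F]
        intro!: c[unfolded map_map])
qed

lemma Tfun_functor:
  assumes X: "category X" and Y: "category Y" and F: "is_functor X Y F"
  shows "is_functor (Tcat X) (Tcat Y) (Tfun Y F)"
proof -
  interpret RX: category "raw X" by (rule raw_category[OF X])
  note R = is_functorD[OF raw_map_functor[OF F], simplified]
  note o = Tfun_obj[of X F Y, OF is_functorD(1)[OF F]] and a = Tfun_arr[OF X F]
  show ?thesis unfolding is_functor_def
  proof (intro conjI ballI impI)
    fix z assume z: "z \<in> Obj (Tcat X)"
    note r = repr_obj[OF z]
    from r show "omap (Tfun Y F) z \<in> Obj (Tcat Y)" by (simp add: Tfun_repr obj_cl_in R)
    show "amap (Tfun Y F) (Id (Tcat X) z) = Id (Tcat Y) (omap (Tfun Y F) z)"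
      using a[of "Id (raw X) (repr z)"] r Tcat_maps(3)[OF X r(1)]
      by (simp add: Tfun_repr(1) R Tcat_maps(3)[OF Y] RX.Id_in)
  next
    fix z assume z: "z \<in> Arr (Tcat X)"
    note r = repr_arr[OF X z]
    from r show "amap (Tfun Y F) z \<in> Arr (Tcat Y)" by (simp add: Tfun_repr arr_cl_in R)
    show "Dom (Tcat Y) (amap (Tfun Y F) z) = omap (Tfun Y F) (Dom (Tcat X) z)"
      "Cod (Tcat Y) (amap (Tfun Y F) z) = omap (Tfun Y F) (Cod (Tcat X) z)"
      using o[of "Dom (raw X) (repr z)"] o[of "Cod (raw X) (repr z)"] r
        Tcat_maps(1,2)[OF X r(1)]
      by (simp_all add: Tfun_repr(2) R Tcat_maps(1,2)[OF Y] RX.Dom_in RX.Cod_in)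
  next
    fix w z assume w: "w \<in> Arr (Tcat X)" and z: "z \<in> Arr (Tcat X)" and d: "Dom (Tcat X) w = Cod (Tcat X) z"
    note r = repr_arr[OF X z]
    \<comment> \<open>\<open>repr w\<close> and \<open>repr z\<close> may fail to be composable, so
      the representative of \<open>w\<close> is chosen to fit that of \<open>z\<close>.\<close>
    obtain s where s: "s \<in> Arr (raw X)" "arr_cl X s = w" "Dom (raw X) s = Cod (raw X) (repr z)"
      using arr_cl_composable[OF X w r(1)] d r(2) by metis
    have "Comp (Tcat X) w z = arr_cl X (Comp (raw X) s (repr z))"
      using Tcat_maps(4)[OF X s(1) r(1) s(3)] r s by simp
    then show "amap (Tfun Y F) (Comp (Tcat X) w z) = Comp (Tcat Y) (amap (Tfun Y F) w) (amap (Tfun Y F) z)"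
      using r s a[OF s(1)] a[OF r(1)]
      by (simp add: a R Tcat_maps(4)[OF Y] RX.Comp_in)
  qed
qed

lemma raw_map_in:
  assumes "\<And>x. x \<in> Obj X \<Longrightarrow> h x \<in> Obj Y" "r \<in> Obj (raw X)"
  shows "raw_map h r \<in> Obj (raw Y)"
  using assms by (auto simp: Obj_raw raw_map_def)

lemma raw_cell_arr:
  assumes t: "\<And>x. x \<in> Obj X \<Longrightarrow> t x \<in> Arr Y" and r: "r \<in> Obj (raw X)"
  shows "raw_cell t r \<in> Arr (raw Y)"
    "Dom (raw Y) (raw_cell t r) = raw_map (\<lambda>x. Dom Y (t x)) r"
    "Cod (raw Y) (raw_cell t r) = raw_map (\<lambda>x. Cod Y (t x)) r"
proof -
  interpret Pn: category "pcat P (fst r)" by (rule P_cat)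
  show "raw_cell t r \<in> Arr (raw Y)" using t r by (auto simp: Arr_raw Obj_raw raw_cell_def Pn.Id_in)
  show "Dom (raw Y) (raw_cell t r) = raw_map (\<lambda>x. Dom Y (t x)) r"
    "Cod (raw Y) (raw_cell t r) = raw_map (\<lambda>x. Cod Y (t x)) r"
    using r by (simp_all add: Obj_raw raw_cell_def raw_map_def raw_maps Pn.Dom_Id Pn.Cod_Id)
qed

lemma raw_map_cong:
  assumes "\<And>x. x \<in> set (snd (snd r)) \<Longrightarrow> h x = h' x"
  shows "raw_map h r = raw_map h' r"
  using assms by (simp add: raw_map_def)

lemma raw_cell_cong:
  assumes "\<And>x. x \<in> set (snd (snd r)) \<Longrightarrow> h x = h' x"
  shows "raw_cell h r = raw_cell h' r"
  using assms by (simp add: raw_cell_def)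

lemma raw_map_raw_map: "raw_map h (raw_map h' r) = raw_map (\<lambda>x. h (h' x)) r"
  "raw_cell t (raw_map k s) = raw_cell (\<lambda>x. t (k x)) s"
  "raw_map k' (raw_cell t' s') = raw_cell (\<lambda>x. k' (t' x)) s'"
  by (simp_all add: raw_map_def raw_cell_def)

lemma Tfun_obj_cong:
  assumes "z \<in> Obj (Tcat X)" "\<And>x. x \<in> Obj X \<Longrightarrow> omap F x = omap F' x"
  shows "omap (Tfun Y F) z = omap (Tfun Y F') z"
  using repr_obj(1)[OF assms(1)] assms(2)
  by (auto simp: Tfun_repr Obj_raw intro!: arg_cong[of _ _ "obj_cl Y"] raw_map_cong)

lemma Tfun_arr_cong:
  assumes "category X" "z \<in> Arr (Tcat X)" "\<And>x. x \<in> Arr X \<Longrightarrow> amap F x = amap F' x"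
  shows "amap (Tfun Y F) z = amap (Tfun Y F') z"
  using repr_arr(1)[OF assms(1,2)] assms(3)
  by (auto simp: Tfun_repr Arr_raw intro!: arg_cong[of _ _ "arr_cl Y"] raw_map_cong)

lemma Tcell_cong:
  assumes "z \<in> Obj (Tcat X)" "\<And>x. x \<in> Obj X \<Longrightarrow> t x = t' x"
  shows "Tcell Y t z = Tcell Y t' z"
  using repr_obj(1)[OF assms(1)] assms(2)
  by (auto simp: Tfun_repr Obj_raw intro!: arg_cong[of _ _ "arr_cl Y"] raw_cell_cong)

lemma Tfun_obj_in:
  assumes "\<And>x. x \<in> Obj X \<Longrightarrow> omap F x \<in> Obj Y" "z \<in> Obj (Tcat X)"
  shows "omap (Tfun Y F) z \<in> Obj (Tcat Y)"
  unfolding Tfun_repr by (intro obj_cl_in raw_map_in[of X] assms(1) repr_obj assms(2))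

lemma Tfun_obj_Tfun:
  assumes F: "\<And>x. x \<in> Obj X \<Longrightarrow> omap F x \<in> Obj Y" and G: "\<And>y. y \<in> Obj Y \<Longrightarrow> omap G y \<in> Obj Z"
    and z: "z \<in> Obj (Tcat X)"
  shows "omap (Tfun Z G) (omap (Tfun Y F) z) = omap (Tfun Z (ftor_comp G F)) z"
  using Tfun_obj[of Y G Z, OF G raw_map_in[of X "omap F" Y, OF F repr_obj(1)[OF z]]]
  by (simp add: Tfun_repr(1)[where z=z] raw_map_raw_map ftor_comp_def)

lemma Tfun_arr_Tfun:
  assumes X: "category X" and Y: "category Y" and F: "is_functor X Y F" and G: "is_functor Y Z G"
    and z: "z \<in> Arr (Tcat X)"
  shows "amap (Tfun Z G) (amap (Tfun Y F) z) = amap (Tfun Z (ftor_comp G F)) z"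
  using Tfun_arr[OF Y G is_functorD(2)[OF raw_map_functor[OF F], simplified, OF repr_arr(1)[OF X z]]]
  by (simp add: Tfun_repr(2)[where w=z] raw_map_raw_map ftor_comp_def)

lemma Tcell_Tfun:
  assumes F: "\<And>x. x \<in> Obj X \<Longrightarrow> omap F x \<in> Obj Y" and t: "\<And>y. y \<in> Obj Y \<Longrightarrow> t y \<in> Arr Z"
    and z: "z \<in> Obj (Tcat X)"
  shows "Tcell Z t (omap (Tfun Y F) z) = Tcell Z (\<lambda>x. t (omap F x)) z"
  using Tcell_cl[of Y t Z, OF t raw_map_in[of X "omap F" Y, OF F repr_obj(1)[OF z]]]
  by (simp add: Tfun_repr(1,3)[where z=z] raw_map_raw_map)

lemma Tfun_Tcell:
  assumes Y: "category Y" and t: "\<And>x. x \<in> Obj X \<Longrightarrow> t x \<in> Arr Y" and G: "is_functor Y Z G"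
    and z: "z \<in> Obj (Tcat X)"
  shows "amap (Tfun Z G) (Tcell Y t z) = Tcell Z (\<lambda>x. amap G (t x)) z"
  using Tfun_arr[OF Y G raw_cell_arr(1)[of X t Y, OF t repr_obj(1)[OF z]]]
  by (simp add: Tfun_repr(3)[where z=z] raw_map_raw_map)

lemma Tcell_arr:
  assumes Y: "category Y" and t: "\<And>x. x \<in> Obj X \<Longrightarrow> t x \<in> Arr Y" and z: "z \<in> Obj (Tcat X)"
  shows "Tcell Y t z \<in> Arr (Tcat Y)"
    "(\<And>x. x \<in> Obj X \<Longrightarrow> Dom Y (t x) = omap F x) \<Longrightarrow> Dom (Tcat Y) (Tcell Y t z) = omap (Tfun Y F) z"
    "(\<And>x. x \<in> Obj X \<Longrightarrow> Cod Y (t x) = omap G x) \<Longrightarrow> Cod (Tcat Y) (Tcell Y t z) = omap (Tfun Y G) z"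
proof -
  note r = raw_cell_arr[of X t Y, OF t repr_obj(1)[OF z]]
  note s = repr_obj(1)[OF z, unfolded Obj_raw]
  show "Tcell Y t z \<in> Arr (Tcat Y)" unfolding Tfun_repr by (intro arr_cl_in r)
  show "Dom (Tcat Y) (Tcell Y t z) = omap (Tfun Y F) z" if "\<And>x. x \<in> Obj X \<Longrightarrow> Dom Y (t x) = omap F x"
  proof -
    have "raw_map (\<lambda>x. Dom Y (t x)) (repr z) = raw_map (omap F) (repr z)"
      by (rule raw_map_cong) (use s that in blast)
    then show ?thesis by (simp add: Tfun_repr Tcat_maps(1)[OF Y r(1)] r)
  qed
  show "Cod (Tcat Y) (Tcell Y t z) = omap (Tfun Y G) z" if "\<And>x. x \<in> Obj X \<Longrightarrow> Cod Y (t x) = omap G x"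
  proof -
    have "raw_map (\<lambda>x. Cod Y (t x)) (repr z) = raw_map (omap G) (repr z)"
      by (rule raw_map_cong) (use s that in blast)
    then show ?thesis by (simp add: Tfun_repr Tcat_maps(2)[OF Y r(1)] r)
  qed
qed

lemma Tcell_comp:
  assumes Y: "category Y" and t: "\<And>x. x \<in> Obj X \<Longrightarrow> t x \<in> Arr Y" and s: "\<And>x. x \<in> Obj X \<Longrightarrow> s x \<in> Arr Y"
    and d: "\<And>x. x \<in> Obj X \<Longrightarrow> Dom Y (s x) = Cod Y (t x)" and z: "z \<in> Obj (Tcat X)"
  shows "Comp (Tcat Y) (Tcell Y s z) (Tcell Y t z) = Tcell Y (\<lambda>x. Comp Y (s x) (t x)) z"
proof -
  note r = repr_obj(1)[OF z]
  note t' = raw_cell_arr[of X t Y, OF t r] and s' = raw_cell_arr[of X s Y, OF s r]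
  interpret Pn: category "pcat P (fst z)" by (rule P_cat)
  have m: "map2 (Comp Y) (map s xs) (map t xs) = map (\<lambda>x. Comp Y (s x) (t x)) xs" for xs
    by (induction xs) auto
  have "raw_map (\<lambda>x. Dom Y (s x)) (repr z) = raw_map (\<lambda>x. Cod Y (t x)) (repr z)"
    by (rule raw_map_cong) (use d r in \<open>auto simp: Obj_raw\<close>)
  then have "Comp (Tcat Y) (Tcell Y s z) (Tcell Y t z)
      = arr_cl Y (Comp (raw Y) (raw_cell s (repr z)) (raw_cell t (repr z)))"
    by (simp add: Tfun_repr Tcat_maps(4)[OF Y s'(1) t'(1)] t' s')
  also have "Comp (raw Y) (raw_cell s (repr z)) (raw_cell t (repr z))
      = raw_cell (\<lambda>x. Comp Y (s x) (t x)) (repr z)"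
    using r Pn.Comp_Id[OF Pn.Id_in] Pn.Dom_Id
    by (simp add: Obj_raw raw_cell_def raw_maps m)
  finally show ?thesis by (simp add: Tfun_repr)
qed

lemma Tcell_Id:
  assumes Y: "category Y" and F: "\<And>x. x \<in> Obj X \<Longrightarrow> omap F x \<in> Obj Y" and z: "z \<in> Obj (Tcat X)"
  shows "Tcell Y (\<lambda>x. Id Y (omap F x)) z = Id (Tcat Y) (omap (Tfun Y F) z)"
proof -
  have "raw_map (omap F) (repr z) \<in> Obj (raw Y)" using raw_map_in[of X "omap F" Y] F repr_obj(1)[OF z] by blast
  then show ?thesis using repr_obj(1)[OF z]
    by (simp add: Tfun_repr Tcat_maps(3)[OF Y] raw_maps raw_map_def raw_cell_def Obj_raw o_def)
qed

text \<open>Checked on one representative: each entry is a naturality square of \<open>t\<close>,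
  and in the operation component both sides are composites with an identity.\<close>

lemma Tcell_nat_trans:
  assumes X: "category X" and Y: "category Y" and F: "is_functor X Y F" and G: "is_functor X Y G"
    and t: "is_nat_trans X Y F G t"
  shows "is_nat_trans (Tcat X) (Tcat Y) (Tfun Y F) (Tfun Y G) (Tcell Y t)"
  unfolding is_nat_trans_def
proof (intro conjI ballI)
  note T = is_nat_transD[OF t]
  {
    fix z assume z: "z \<in> Obj (Tcat X)"
    show "Tcell Y t z \<in> Arr (Tcat Y)" by (rule Tcell_arr(1)[OF Y T(1) z])
    show "Dom (Tcat Y) (Tcell Y t z) = omap (Tfun Y F) z" by (rule Tcell_arr(2)[OF Y T(1) z T(2)])
    show "Cod (Tcat Y) (Tcell Y t z) = omap (Tfun Y G) z" by (rule Tcell_arr(3)[OF Y T(1) z T(3)])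
  }
  fix f assume f: "f \<in> Arr (Tcat X)"
  interpret RX: category "raw X" by (rule raw_category[OF X])
  note r = repr_arr[OF X f]
  note l = r(1)[unfolded Arr_raw]
  interpret Pn: category "pcat P (fst f)" by (rule P_cat)
  note FA = is_functorD[OF raw_map_functor[OF F], simplified] and GA = is_functorD[OF raw_map_functor[OF G], simplified]
  note tc = Tcell_cl[of X t Y, OF T(1)]
  have rc: "Dom (raw Y) (raw_cell t x) = raw_map (omap F) x" "Cod (raw Y) (raw_cell t x) = raw_map (omap G) x"
    "raw_cell t x \<in> Arr (raw Y)" if "x \<in> Obj (raw X)" for x
    using raw_cell_arr[of X t Y x, OF T(1) that] that T by (auto simp: Obj_raw intro!: raw_map_cong)
  have e: "map2 (Comp Y) (map t (map (Cod X) fs)) (map (amap F) fs)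
      = map2 (Comp Y) (map (amap G) fs) (map t (map (Dom X) fs))" if "set fs \<subseteq> Arr X" for fs
    using that by (induction fs) (simp_all add: T(4))
  have d: "Dom (Tcat X) f = obj_cl X (Dom (raw X) (repr f))" "Cod (Tcat X) f = obj_cl X (Cod (raw X) (repr f))"
    using Tcat_maps(1,2)[OF X r(1)] r(2) by auto
  have "Comp (Tcat Y) (Tcell Y t (Cod (Tcat X) f)) (amap (Tfun Y F) f)
      = arr_cl Y (Comp (raw Y) (raw_cell t (Cod (raw X) (repr f))) (raw_map (amap F) (repr f)))"
    using r RX.Cod_in[OF r(1)]
    by (simp add: d tc Tfun_repr(2) Tcat_maps(4)[OF Y] rc FA)
  also have "Comp (raw Y) (raw_cell t (Cod (raw X) (repr f))) (raw_map (amap F) (repr f))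
      = Comp (raw Y) (raw_map (amap G) (repr f)) (raw_cell t (Dom (raw X) (repr f)))"
    using l e[of "snd (snd (repr f))"]
    by (simp add: raw_maps raw_cell_def raw_map_def Pn.Id_Comp Pn.Comp_Id)
  also have "arr_cl Y \<dots> = Comp (Tcat Y) (amap (Tfun Y G) f) (Tcell Y t (Dom (Tcat X) f))"
    using r RX.Dom_in[OF r(1)]
    by (simp add: d tc Tfun_repr(2) Tcat_maps(4)[OF Y] rc GA)
  finally show "Comp (Tcat Y) (Tcell Y t (Cod (Tcat X) f)) (amap (Tfun Y F) f)
      = Comp (Tcat Y) (amap (Tfun Y G) f) (Tcell Y t (Dom (Tcat X) f))" .
qed

subsection \<open>The multiplication\<close>

text \<open>The multiplication on an operation \<open>p\<close> and a list of representatives.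
  Taking the operad composition \<open>m\<close> as a parameter lets one formula serve objects and
  arrows.\<close>

definition raw_mu :: "(nat list \<Rightarrow> 'p \<Rightarrow> 'p list \<Rightarrow> 'p) \<Rightarrow> 'p \<Rightarrow> (nat \<times> 'p \<times> 'x list) list \<Rightarrow> nat \<times> 'p \<times> 'x list" where
  "raw_mu m p rs = (sum_list (map fst rs), m (map fst rs) p (map (\<lambda>r. fst (snd r)) rs),
     concat (map (\<lambda>r. snd (snd r)) rs))"

abbreviation "muO \<equiv> raw_mu (pmuO P)"
abbreviation "muA \<equiv> raw_mu (pmuA P)"

lemma length_concat_raw:
  assumes "\<And>r. r \<in> set rs \<Longrightarrow> length (snd (snd r)) = fst r"
  shows "length (concat (map (\<lambda>r. snd (snd r)) rs)) = sum_list (map fst rs)"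
  using assms by (induction rs) auto

lemma concat_map2:
  assumes "length rs = length ss" "\<And>i. i < length rs \<Longrightarrow> length (u (rs ! i)) = length (v (ss ! i))"
  shows "concat (map2 (\<lambda>r s. map2 h (u r) (v s)) rs ss) = map2 h (concat (map u rs)) (concat (map v ss))"
  using assms
proof (induction rs ss rule: list_induct2)
  case (Cons r rs s ss)
  have "length (u (rs ! i)) = length (v (ss ! i))" if "i < length rs" for i
    using Cons.prems[of "Suc i"] that by simp
  then show ?case using Cons.IH Cons.prems[of 0] by (simp add: zip_append)
qed simp

section \<open>Raw multiplication and the category structure: source, target, identities,
  composites\<close>

lemma mu_in_Obj:
  assumes p: "p \<in> Obj (pcat P n)" and rs: "set rs \<subseteq> Obj (raw X)" and l: "length rs = n"
  shows "muO p rs \<in> Obj (raw X)"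
proof -
  interpret O: lambda_set_operad L "\<lambda>n. Obj (pcat P n)" "pid P" "pmuO P" "pactO P" by (rule P_obj)
  have r: "\<forall>r\<in>set rs. fst (snd r) \<in> Obj (pcat P (fst r))" "\<forall>r\<in>set rs. set (snd (snd r)) \<subseteq> Obj X"
    "\<And>r. r \<in> set rs \<Longrightarrow> length (snd (snd r)) = fst r"
    using rs unfolding subset_iff Obj_raw by blast+
  then show ?thesis
    using O.m_in[of p "map fst rs" "map (\<lambda>r. fst (snd r)) rs"] p l length_concat_raw[OF r(3)]
    by (simp add: Obj_raw raw_mu_def tuples_def list_all2_map1 list_all2_map2 list_all2_same UN_subset_iff)
qed

lemma mu_in_Arr:
  assumes p: "a \<in> Arr (pcat P n)" and rs: "set ss \<subseteq> Arr (raw X)" and l: "length ss = n"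
  shows "muA a ss \<in> Arr (raw X)"
proof -
  interpret A: lambda_set_operad L "\<lambda>n. Arr (pcat P n)" "Id (pcat P 1) (pid P)" "pmuA P" "pactA P"
    by (rule P_arr)
  have r: "\<forall>r\<in>set ss. fst (snd r) \<in> Arr (pcat P (fst r))" "\<forall>r\<in>set ss. set (snd (snd r)) \<subseteq> Arr X"
    "\<And>r. r \<in> set ss \<Longrightarrow> length (snd (snd r)) = fst r"
    using rs unfolding subset_iff Arr_raw by blast+
  then show ?thesis
    using A.m_in[of a "map fst ss" "map (\<lambda>r. fst (snd r)) ss"] p l length_concat_raw[OF r(3)]
    by (simp add: Arr_raw raw_mu_def tuples_def list_all2_map1 list_all2_map2 list_all2_same UN_subset_iff)
qed

lemma P_mu_maps:
  assumes "length ks = n"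
  shows "\<lbrakk>a \<in> Arr (pcat P n); list_all2 (\<lambda>k f. f \<in> Arr (pcat P k)) ks fs\<rbrakk>
      \<Longrightarrow> Dom (pcat P (sum_list ks)) (pmuA P ks a fs)
        = pmuO P ks (Dom (pcat P n) a) (map2 (\<lambda>k. Dom (pcat P k)) ks fs)"
    and "\<lbrakk>a \<in> Arr (pcat P n); list_all2 (\<lambda>k f. f \<in> Arr (pcat P k)) ks fs\<rbrakk>
      \<Longrightarrow> Cod (pcat P (sum_list ks)) (pmuA P ks a fs)
        = pmuO P ks (Cod (pcat P n) a) (map2 (\<lambda>k. Cod (pcat P k)) ks fs)"
    and "\<lbrakk>p \<in> Obj (pcat P n); list_all2 (\<lambda>k q. q \<in> Obj (pcat P k)) ks qs\<rbrakk>
      \<Longrightarrow> pmuA P ks (Id (pcat P n) p) (map2 (\<lambda>k. Id (pcat P k)) ks qs)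
        = Id (pcat P (sum_list ks)) (pmuO P ks p qs)"
    and "\<lbrakk>a \<in> Arr (pcat P n); list_all2 (\<lambda>k f. f \<in> Arr (pcat P k)) ks fs;
        b \<in> Arr (pcat P n); list_all2 (\<lambda>k f. f \<in> Arr (pcat P k)) ks gs;
        Dom (pcat P n) b = Cod (pcat P n) a;
        map2 (\<lambda>k. Dom (pcat P k)) ks gs = map2 (\<lambda>k. Cod (pcat P k)) ks fs\<rbrakk>
      \<Longrightarrow> pmuA P ks (Comp (pcat P n) b a) (map (\<lambda>(k, g, f). Comp (pcat P k) g f) (zip ks (zip gs fs)))
        = Comp (pcat P (sum_list ks)) (pmuA P ks b gs) (pmuA P ks a fs)"
  using is_functorD(3)[OF P_mu[of ks], of "(a, fs)"] is_functorD(4)[OF P_mu[of ks], of "(a, fs)"]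
    is_functorD(5)[OF P_mu[of ks], of "(p, qs)"] is_functorD(6)[OF P_mu[of ks], of "(b, gs)" "(a, fs)"]
  by (simp_all add: assms(1) pair_cat_def list_cat_def list_all2_map1 zip_map1 o_def case_prod_unfold)

lemma mu_Id:
  assumes p: "p \<in> Obj (pcat P n)" and ts: "set ts \<subseteq> Obj (raw X)" and lt: "length ts = n"
  shows "Id (raw X) (muO p ts) = muA (Id (pcat P n) p) (map (Id (raw X)) ts)"
proof -
  have zz: "zip (map f xs) (map g xs) = map (\<lambda>x. (f x, g x)) xs" for f g and xs :: "'z list"
    by (induction xs) auto
  have q: "list_all2 (\<lambda>k f. f \<in> Obj (pcat P k)) (map fst ts) (map (\<lambda>r. fst (snd r)) ts)"
    using ts by (auto simp: list_all2_map1 list_all2_map2 list_all2_same Obj_raw)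
  have len: "length (snd (snd r)) = fst r" if "r \<in> set ts" for r
    using that ts by (auto simp: Obj_raw)
  have m: "map fst (map (Id (raw X)) ts) = map fst ts"
    by (simp add: raw_fst)
  have D: "map (\<lambda>r. fst (snd r)) (map (Id (raw X)) ts) = map (\<lambda>r. Id (pcat P (fst r)) (fst (snd r))) ts"
    "map (\<lambda>r. snd (snd r)) (map (Id (raw X)) ts) = map (\<lambda>r. map (Id X) (snd (snd r))) ts"
    using len by (auto simp: raw_maps)
  have "length (snd (snd (muO p ts))) = fst (muO p ts)" using length_concat_raw[OF len] by (simp add: raw_mu_def)
  note rm = raw_maps(3)[OF this]
  show "Id (raw X) (muO p ts) = muA (Id (pcat P n) p) (map (Id (raw X)) ts)"
    unfolding rm unfolding raw_mu_def m D
    using P_mu_maps(3)[of "map fst ts" n p "map (\<lambda>r. fst (snd r)) ts"] p lt q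
    by (simp add: zz map_concat o_def)
qed

lemma mu_maps:
  assumes X: "category X" and l: "length rs = n"
  shows "a \<in> Arr (pcat P n) \<Longrightarrow> set rs \<subseteq> Arr (raw X)
      \<Longrightarrow> Dom (raw X) (muA a rs) = muO (Dom (pcat P n) a) (map (Dom (raw X)) rs)"
    and "a \<in> Arr (pcat P n) \<Longrightarrow> set rs \<subseteq> Arr (raw X)
      \<Longrightarrow> Cod (raw X) (muA a rs) = muO (Cod (pcat P n) a) (map (Cod (raw X)) rs)"
    and "\<lbrakk>a \<in> Arr (pcat P n); b \<in> Arr (pcat P n); Dom (pcat P n) b = Cod (pcat P n) a;
        set rs \<subseteq> Arr (raw X); set ss \<subseteq> Arr (raw X); length ss = n;
        map (Dom (raw X)) ss = map (Cod (raw X)) rs\<rbrakk>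
      \<Longrightarrow> Comp (raw X) (muA b ss) (muA a rs)
        = muA (Comp (pcat P n) b a) (map2 (Comp (raw X)) ss rs)"
proof -
  have zz: "zip (map f xs) (map g xs) = map (\<lambda>x. (f x, g x)) xs" for f g and xs :: "'z list"
    by (induction xs) auto
  have len: "length (snd (snd r)) = fst r" if "r \<in> set rs" "set rs \<subseteq> Arr (raw X)" for r rs
    using that by (auto simp: Arr_raw)
  have lc: "length (concat (map (\<lambda>r. snd (snd r)) rs)) = sum_list (map fst rs)"
    if "set rs \<subseteq> Arr (raw X)" for rs
    using len[OF _ that] by (rule length_concat_raw)
  {
    assume a: "a \<in> Arr (pcat P n)" and rs: "set rs \<subseteq> Arr (raw X)"
    have q: "list_all2 (\<lambda>k f. f \<in> Arr (pcat P k)) (map fst rs) (map (\<lambda>r. fst (snd r)) rs)"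
      using rs by (auto simp: list_all2_map1 list_all2_map2 list_all2_same Arr_raw)
    have m: "map fst (map (Dom (raw X)) rs) = map fst rs" "map fst (map (Cod (raw X)) rs) = map fst rs"
      by (simp_all add: raw_fst)
    have D: "map (\<lambda>r. fst (snd r)) (map (Dom (raw X)) rs) = map (\<lambda>r. Dom (pcat P (fst r)) (fst (snd r))) rs"
      "map (\<lambda>r. fst (snd r)) (map (Cod (raw X)) rs) = map (\<lambda>r. Cod (pcat P (fst r)) (fst (snd r))) rs"
      "map (\<lambda>r. snd (snd r)) (map (Dom (raw X)) rs) = map (\<lambda>r. map (Dom X) (snd (snd r))) rs"
      "map (\<lambda>r. snd (snd r)) (map (Cod (raw X)) rs) = map (\<lambda>r. map (Cod X) (snd (snd r))) rs"
      using len[OF _ rs] by (auto simp: raw_maps)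
    have "length (snd (snd (muA a rs))) = fst (muA a rs)" using lc[OF rs] by (simp add: raw_mu_def)
    note rm = raw_maps(1,2)[OF this]
    show "Dom (raw X) (muA a rs) = muO (Dom (pcat P n) a) (map (Dom (raw X)) rs)"
      unfolding rm unfolding raw_mu_def m D
      using P_mu_maps(1)[of "map fst rs" n a "map (\<lambda>r. fst (snd r)) rs"] a l q
      by (simp add: zz map_concat o_def)
    show "Cod (raw X) (muA a rs) = muO (Cod (pcat P n) a) (map (Cod (raw X)) rs)"
      unfolding rm unfolding raw_mu_def m D
      using P_mu_maps(2)[of "map fst rs" n a "map (\<lambda>r. fst (snd r)) rs"] a l q
      by (simp add: zz map_concat o_def)
  next
    assume a: "a \<in> Arr (pcat P n)" and b: "b \<in> Arr (pcat P n)" and ba: "Dom (pcat P n) b = Cod (pcat P n) a"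
      and rs: "set rs \<subseteq> Arr (raw X)" and ss: "set ss \<subseteq> Arr (raw X)" and ls: "length ss = n"
      and d: "map (Dom (raw X)) ss = map (Cod (raw X)) rs"
    \<comment> \<open>Composable entries have the same arity, so both lists of arrows are composed
      at the same list of arities.\<close>
    have f: "map fst ss = map fst rs" using arg_cong[OF d, of "map fst"] by (simp add: o_def raw_fst)
    have fi: "fst (ss ! i) = fst (rs ! i)" if "i < n" for i using f that l ls by (metis nth_map)
    have li: "length (snd (snd (ss ! i))) = fst (rs ! i)" "length (snd (snd (rs ! i))) = fst (rs ! i)" if "i < n" for i
      using len[OF _ rs] len[OF _ ss] l ls that fi by auto
    have di: "Dom (raw X) (ss ! i) = Cod (raw X) (rs ! i)" if "i < n" for i using d that l ls by (metis nth_map)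
    have "Dom (pcat P (fst (rs ! i))) (fst (snd (ss ! i))) = Cod (pcat P (fst (rs ! i))) (fst (snd (rs ! i)))" if "i < n" for i
      using di[OF that] that by (simp add: raw_maps li fi)
    then have dq: "map2 (\<lambda>k. Dom (pcat P k)) (map fst rs) (map (\<lambda>r. fst (snd r)) ss)
        = map2 (\<lambda>k. Cod (pcat P k)) (map fst rs) (map (\<lambda>r. fst (snd r)) rs)"
      using l ls by (auto intro!: nth_equalityI)
    have q: "list_all2 (\<lambda>k f. f \<in> Arr (pcat P k)) (map fst rs) (map (\<lambda>r. fst (snd r)) rs)"
      using rs by (auto simp: list_all2_map1 list_all2_map2 list_all2_same Arr_raw)
    have q': "list_all2 (\<lambda>k f. f \<in> Arr (pcat P k)) (map fst rs) (map (\<lambda>r. fst (snd r)) ss)"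
      unfolding f[symmetric]
      using ss by (auto simp: list_all2_map1 list_all2_map2 list_all2_same Arr_raw)
    have m: "map fst (map2 (Comp (raw X)) ss rs) = map fst rs"
      "map (\<lambda>r. fst (snd r)) (map2 (Comp (raw X)) ss rs)
        = map (\<lambda>(k, g, f). Comp (pcat P k) g f) (zip (map fst rs)
            (zip (map (\<lambda>r. fst (snd r)) ss) (map (\<lambda>r. fst (snd r)) rs)))"
      "map (\<lambda>r. snd (snd r)) (map2 (Comp (raw X)) ss rs)
        = map2 (\<lambda>r s. map2 (Comp X) (snd (snd r)) (snd (snd s))) ss rs"
      by (rule nth_equalityI; simp add: raw_maps l ls fi li)+
    have "length (snd (snd (muA b ss))) = fst (muA b ss)" "length (snd (snd (muA a rs))) = fst (muA b ss)"
      using lc[OF rs] lc[OF ss] by (simp_all add: raw_mu_def f)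
    note rm = raw_maps(4)[OF this]
    have c: "concat (map2 (\<lambda>r s. map2 (Comp X) (snd (snd r)) (snd (snd s))) ss rs)
        = map2 (Comp X) (concat (map (\<lambda>r. snd (snd r)) ss)) (concat (map (\<lambda>r. snd (snd r)) rs))"
      using l ls li by (intro concat_map2) auto
    show "Comp (raw X) (muA b ss) (muA a rs) = muA (Comp (pcat P n) b a) (map2 (Comp (raw X)) ss rs)"
      unfolding rm unfolding raw_mu_def m f c
      using P_mu_maps(4)[of "map fst rs" n a "map (\<lambda>r. fst (snd r)) rs" b "map (\<lambda>r. fst (snd r)) ss"] a b ba l q q' dq
      by simp
  }
qed

section \<open>Independence of the multiplication from representatives\<close>

lemma Arr_power_set: "z \<in> Arr (power_cat n X) \<Longrightarrow> set (snd z) \<subseteq> Arr X"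
  unfolding Arr_power by (metis in_set_conv_nth subsetI)

lemma repr_arrs:
  assumes "category X" "set zs \<subseteq> Arr (Tcat X)"
  shows "set (map repr zs) \<subseteq> Arr (raw X)" "map (arr_cl X) (map repr zs) = zs"
  using assms(2) by (induction zs) (simp_all add: repr_arr[OF assms(1)])

lemma repr_objs:
  assumes "set zs \<subseteq> Obj (Tcat X)"
  shows "set (map repr zs) \<subseteq> Obj (raw X)" "map (obj_cl X) (map repr zs) = zs"
  using assms by (induction zs) (simp_all add: repr_obj)

lemma arr_rel_refl: "r \<in> Arr (raw X) \<Longrightarrow> arr_rel X r r"
  by (simp add: arr_rel_def raw_power arr_eq.refl)

lemma arr_rel_sym: "arr_rel X r s \<Longrightarrow> arr_rel X s r"
  by (auto simp: arr_rel_def intro: arr_eq.sym)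

lemma arr_rel_trans: "arr_rel X r s \<Longrightarrow> arr_rel X s t \<Longrightarrow> arr_rel X r t"
  by (auto simp: arr_rel_def intro: arr_eq.trans)

lemma arr_rel_in: "category X \<Longrightarrow> arr_rel X r s \<Longrightarrow> r \<in> Arr (raw X) \<and> s \<in> Arr (raw X)"
  unfolding arr_rel_def raw_power using arr_eq_Arr by metis

text \<open>\<open>equivar_beta\<close> turns the actions on the inner operations into one action of
  \<open>lbeta\<close> on the composite. A generator of the relation carries it over to the
  concatenated list, and \<open>lact_lbeta\<close> distributes it over the blocks.\<close>

lemma mu_equivar_inner:
  assumes a: "a \<in> Arr (pcat P n)" and l: "length rs = n" and rs: "set rs \<subseteq> Arr (raw X)"
    and gs: "list_all2 (\<lambda>r g. g \<in> carrier (lgrp L (fst r))) rs gs"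
  shows "arr_rel X (muA a (map2 (\<lambda>r g. (fst r, pactA P (fst r) (fst (snd r)) g, snd (snd r))) rs gs))
    (muA a (map2 (\<lambda>r g. (fst r, fst (snd r), lact (fst r) g (snd (snd r)))) rs gs))"
proof -
  interpret A: lambda_set_operad L "\<lambda>n. Arr (pcat P n)" "Id (pcat P 1) (pid P)" "pmuA P" "pactA P"
    by (rule P_arr)
  let ?ks = "map fst rs" and ?qs = "map (\<lambda>r. fst (snd r)) rs" and ?xss = "map (\<lambda>r. snd (snd r)) rs"
  have lg: "length gs = length rs" using gs by (simp add: list_all2_lengthD)
  have len: "map length ?xss = ?ks" using rs by (auto simp: Arr_raw)
  have q: "?qs \<in> tuples (\<lambda>k. Arr (pcat P k)) ?ks"
    using rs by (auto simp: tuples_def list_all2_map1 list_all2_map2 list_all2_same Arr_raw)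
  have g: "gs \<in> tuples (\<lambda>k. carrier (lgrp L k)) ?ks" using gs by (simp add: tuples_def list_all2_map1)
  have z: "map2 (\<lambda>r. f (fst r) (fst (snd r))) rs gs = map (\<lambda>(k, q, g). f k q g) (zip ?ks (zip ?qs gs))"
    for f :: "nat \<Rightarrow> 'pa \<Rightarrow> 'g \<Rightarrow> 'pa"
    using lg by (auto intro!: nth_equalityI)
  have x: "map2 (\<lambda>r g. lact (fst r) g (snd (snd r))) rs gs = map (\<lambda>(k, g, xs). lact k g xs) (zip ?ks (zip gs ?xss))"
    using lg by (auto intro!: nth_equalityI)
  have f: "map2 (\<lambda>r g. h r) rs gs = map h rs" for h :: "nat \<times> 'pa \<times> 'a list \<Rightarrow> 'z"
    using lg by (auto intro!: nth_equalityI)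
  have m: "(pmuA P ?ks a ?qs, concat ?xss) \<in> Arr (power_cat (sum_list ?ks) X)"
    using mu_in_Arr[OF a rs l] by (simp add: raw_power raw_mu_def)
  have b: "lbeta ?ks gs \<in> carrier (lgrp L (sum_list ?ks))"
    using gs by (intro lbeta_in) (simp add: list_all2_map1)
  have "arr_eq (sum_list ?ks) X (pactA P (sum_list ?ks) (pmuA P ?ks a ?qs) (lbeta ?ks gs), concat ?xss)
    (pmuA P ?ks a ?qs, lact (sum_list ?ks) (lbeta ?ks gs) (concat ?xss))"
    by (rule arr_eq.gen[OF m b])
  moreover have "muA a (map2 (\<lambda>r g. (fst r, pactA P (fst r) (fst (snd r)) g, snd (snd r))) rs gs)
    = (sum_list ?ks, pactA P (sum_list ?ks) (pmuA P ?ks a ?qs) (lbeta ?ks gs), concat ?xss)"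
    using A.equivar_beta[OF _ q g, of a] a l z[of "pactA P"] f[of fst] f[of "\<lambda>r. snd (snd r)"]
    by (simp add: raw_mu_def o_def case_prod_unfold)
  moreover have "muA a (map2 (\<lambda>r g. (fst r, fst (snd r), lact (fst r) g (snd (snd r)))) rs gs)
    = (sum_list ?ks, pmuA P ?ks a ?qs, lact (sum_list ?ks) (lbeta ?ks gs) (concat ?xss))"
    using lact_lbeta[OF _ len, of gs] g x f[of fst] f[of "\<lambda>r. fst (snd r)"]
    by (simp add: raw_mu_def o_def case_prod_unfold tuples_def)
  ultimately show ?thesis by (simp add: arr_rel_def)
qed

text \<open>As for \<open>mu_equivar_inner\<close>, with \<open>equivar_delta\<close> and
  \<open>lact_ldelta\<close>: an element acting on the outer operation permutes the inner
  representatives as blocks.\<close>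

lemma mu_equivar_outer:
  assumes a: "a \<in> Arr (pcat P n)" and l: "length rs = n" and rs: "set rs \<subseteq> Arr (raw X)"
    and g: "g \<in> carrier (lgrp L n)"
  shows "arr_rel X (muA (pactA P n a g) rs) (muA a (lact n g rs))"
proof -
  interpret A: lambda_set_operad L "\<lambda>n. Arr (pcat P n)" "Id (pcat P 1) (pid P)" "pmuA P" "pactA P"
    by (rule P_arr)
  let ?ks = "map fst rs" and ?qs = "map (\<lambda>r. fst (snd r)) rs" and ?xss = "map (\<lambda>r. snd (snd r)) rs"
  have len: "map length ?xss = ?ks" using rs by (auto simp: Arr_raw)
  have q: "?qs \<in> tuples (\<lambda>k. Arr (pcat P k)) ?ks"
    using rs by (auto simp: tuples_def list_all2_map1 list_all2_map2 list_all2_same Arr_raw)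
  have gk: "g \<in> carrier (lgrp L (length ?ks))" using g l by simp
  have s: "sum_list (lact n g ?ks) = sum_list ?ks" using sum_list_lact[OF gk] l by simp
  have lm: "lact n g (map h rs) = map h (lact n g rs)" for h :: "nat \<times> 'pa \<times> 'a list \<Rightarrow> 'z"
    by (rule lact_map[OF g l])
  have "set (lact n g rs) \<subseteq> set rs"
    using lact_index[OF g] l by (auto simp: in_set_conv_nth nth_lact) (metis One_nat_def)
  then have "muA a (lact n g rs) \<in> Arr (raw X)" using mu_in_Arr[OF a, of "lact n g rs" X] l rs by simp
  moreover have "muA a rs \<in> Arr (raw X)" using mu_in_Arr[OF a rs l] .
  ultimately have m: "(pmuA P (lact n g ?ks) a (lact n g ?qs), concat ?xss) \<in> Arr (power_cat (sum_list ?ks) X)"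
    unfolding lm by (simp add: Arr_power raw_power raw_mu_def s[unfolded lm])
  have "muA (pactA P n a g) rs
      = (sum_list ?ks, pactA P (sum_list ?ks) (pmuA P (lact n g ?ks) a (lact n g ?qs)) (ldelta ?ks g), concat ?xss)"
    using A.equivar_delta[OF _ q gk, of a] a l by (simp add: raw_mu_def)
  moreover have "muA a (lact n g rs)
      = (sum_list ?ks, pmuA P (lact n g ?ks) a (lact n g ?qs), lact (sum_list ?ks) (ldelta ?ks g) (concat ?xss))"
    unfolding lact_ldelta[OF gk len] using l by (simp add: raw_mu_def lm s[unfolded lm])
  moreover have "ldelta ?ks g \<in> carrier (lgrp L (sum_list ?ks))" by (rule ldelta_in[OF gk])
  ultimately show ?thesis using arr_eq.gen[OF m] by (simp add: arr_rel_def)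
qed

text \<open>Changing one entry at a time lets an entry that is a composite be split off, the other entries
  being composed with identities.\<close>

lemma mu_slot:
  fixes X :: "('o, 'a) cat"
  assumes X: "category X"
  shows "arr_eq k X c c' \<Longrightarrow> a \<in> Arr (pcat P (length pre + Suc (length post))) \<Longrightarrow>
    set pre \<subseteq> Arr (raw X) \<Longrightarrow> set post \<subseteq> Arr (raw X) \<Longrightarrow>
    arr_rel X (muA a (pre @ (k, c) # post)) (muA a (pre @ (k, c') # post))"
proof (induction arbitrary: a pre post rule: arr_eq.induct)
  case (gen q fs g)
  interpret A: lambda_set_operad L "\<lambda>n. Arr (pcat P n)" "Id (pcat P 1) (pid P)" "pmuA P" "pactA P"
    by (rule P_arr)
  \<comment> \<open>Only the entry at the chosen position is acted on by \<open>g\<close>; all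
    others are acted on by identity elements, which changes nothing.\<close>
  define one :: "nat \<times> 'pa \<times> 'a list \<Rightarrow> 'g" where "one = (\<lambda>r. \<one>\<^bsub>lgrp L (fst r)\<^esub>)"
  let ?rs = "pre @ (k, q, fs) # post"
  let ?gs = "map one pre @ g # map one post"
  have zz: "zip rs (map one rs) = map (\<lambda>r. (r, one r)) rs" for rs by (induction rs) auto
  have u: "map2 (\<lambda>r g. (fst r, pactA P (fst r) (fst (snd r)) g, snd (snd r))) rs (map one rs) = rs"
    "map2 (\<lambda>r g. (fst r, fst (snd r), lact (fst r) g (snd (snd r)))) rs (map one rs) = rs"
    if "set rs \<subseteq> Arr (raw X)" for rs
    unfolding zz map_map
    by (rule map_idI, use that in \<open>auto simp: one_def Arr_raw A.act_one lact_one\<close>)+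
  have "set ?rs \<subseteq> Arr (raw X)" using gen by (auto simp: raw_power)
  from mu_equivar_inner[OF gen(3) _ this, of ?gs]
  show ?case using gen(2)
    by (simp add: u[OF gen(4)] u[OF gen(5)] list_all2_appendI list.rel_map list_all2_same one_in one_def[symmetric])
      (simp add: one_def one_in list_all2_appendI list.rel_map list_all2_same)
next
  case (refl z)
  then show ?case using mu_in_Arr[of a _ "pre @ (k, z) # post"]
    by (intro arr_rel_refl) (auto simp: raw_power)
next
  case (sym z w)
  then show ?case by (blast intro: arr_rel_sym)
next
  case (trans z w v)
  then show ?case by (blast intro: arr_rel_trans)
next
  case (comp b b' d d')
  interpret R: category "raw X" by (rule raw_category[OF X])
  let ?n = "length pre + Suc (length post)"
  interpret Pn: category "pcat P ?n" by (rule P_cat)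
  \<comment> \<open>\<open>a\<close> is written as itself after an identity, and so is every entry
    other than the composite one. The interchange law then splits the multiplication into two
    factors, each containing one half of the composite. The second factor has identities in all
    other places, which is why the induction generalizes \<open>a\<close>, \<open>pre\<close> and
    \<open>post\<close>.\<close>
  let ?i = "Id (pcat P ?n) (Dom (pcat P ?n) a)" and ?I = "\<lambda>r. Id (raw X) (Dom (raw X) r)"
  have in_arr: "b \<in> Arr (power_cat k X)" "b' \<in> Arr (power_cat k X)" "d \<in> Arr (power_cat k X)" "d' \<in> Arr (power_cat k X)"
    using arr_eq_Arr[OF X comp(1)] arr_eq_Arr[OF X comp(2)] by auto
  have i: "?i \<in> Arr (pcat P ?n)" using comp.prems(1) Pn.Id_in Pn.Dom_in by blast
  have pre: "set (map ?I pre) \<subseteq> Arr (raw X)" and post: "set (map ?I post) \<subseteq> Arr (raw X)"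
    unfolding set_map using comp.prems R.Id_in R.Dom_in by blast+
  have ci: "map2 (Comp (raw X)) rs (map ?I rs) = rs" "map (Cod (raw X)) (map ?I rs) = map (Dom (raw X)) rs"
    if "set rs \<subseteq> Arr (raw X)" for rs
    using that by (induction rs) (auto simp: R.Comp_Id R.Cod_Id R.Dom_in)
  have split: "muA a (pre @ (k, Comp (power_cat k X) e f) # post)
      = Comp (raw X) (muA a (pre @ (k, e) # post)) (muA ?i (map ?I pre @ (k, f) # map ?I post))"
    "Dom (raw X) (muA a (pre @ (k, e) # post)) = Cod (raw X) (muA ?i (map ?I pre @ (k, f) # map ?I post))"
    if ef: "e \<in> Arr (power_cat k X)" "f \<in> Arr (power_cat k X)" "Dom (power_cat k X) e = Cod (power_cat k X) f" for e f
  proof -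
    let ?rs = "map ?I pre @ (k, f) # map ?I post" and ?ss = "pre @ (k, e) # post"
    have s: "set ?rs \<subseteq> Arr (raw X)" "set ?ss \<subseteq> Arr (raw X)"
      using ef pre post comp.prems by (simp_all add: raw_power del: set_map)
    have k: "Comp (raw X) (k, e) (k, f) = (k, Comp (power_cat k X) e f)" "Dom (raw X) (k, e) = Cod (raw X) (k, f)"
      using ef by (simp_all add: raw_def coprod_cat_def)
    have d: "map (Dom (raw X)) ?ss = map (Cod (raw X)) ?rs"
      using ci(2)[OF comp.prems(2)] ci(2)[OF comp.prems(3)] k(2) by simp
    have c: "map2 (Comp (raw X)) ?ss ?rs = pre @ (k, Comp (power_cat k X) e f) # post"
      using ci(1)[OF comp.prems(2)] ci(1)[OF comp.prems(3)] k(1) by simp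
    have h: "Dom (pcat P ?n) a = Cod (pcat P ?n) ?i" "Comp (pcat P ?n) a ?i = a"
      by (rule Pn.Cod_Id[OF Pn.Dom_in[OF comp.prems(1)], symmetric], rule Pn.Comp_Id[OF comp.prems(1)])
    show "muA a (pre @ (k, Comp (power_cat k X) e f) # post) = Comp (raw X) (muA a ?ss) (muA ?i ?rs)"
      using mu_maps(3)[of X ?rs ?n ?i a ?ss, OF X _ i comp.prems(1) h(1) s _ d] c h(2) by simp
    show "Dom (raw X) (muA a ?ss) = Cod (raw X) (muA ?i ?rs)"
      unfolding mu_maps(1)[of X ?ss ?n a, OF X _ comp.prems(1) s(2), simplified length_append length_Cons, OF HOL.refl]
        mu_maps(2)[of X ?rs ?n ?i, OF X _ i s(1), simplified length_append length_map length_Cons, OF HOL.refl]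
      using h(1) d by (rule arg_cong2[where f = muO])
  qed
  have "arr_rel X (muA ?i (map ?I pre @ (k, d) # map ?I post)) (muA ?i (map ?I pre @ (k, d') # map ?I post))"
    using comp.IH(2)[of ?i "map ?I pre" "map ?I post"] i pre post by simp
  then show ?case
    using comp.IH(1)[OF comp.prems] in_arr comp.hyps(3,4) by (simp only: split) (rule arr_rel_comp; simp only: split)
qed

text \<open>\<open>pre\<close> holds the entries that have already been replaced: each step applies
  \<open>mu_slot\<close> to the first remaining entry and moves it into \<open>pre\<close>.\<close>

lemma mu_rel:
  assumes X: "category X" and r: "list_all2 (arr_rel X) rs ss"
  shows "a \<in> Arr (pcat P (length pre + length rs)) \<Longrightarrow> set pre \<subseteq> Arr (raw X) \<Longrightarrow>
    arr_rel X (muA a (pre @ rs)) (muA a (pre @ ss))"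
  using r
proof (induction arbitrary: pre rule: list_all2_induct)
  case Nil
  then show ?case using mu_in_Arr[of a _ pre] by (auto intro: arr_rel_refl)
next
  case (Cons r rs s ss)
  have rs: "set rs \<subseteq> Arr (raw X)"
    using Cons(2) arr_rel_in[OF X] unfolding list_all2_conv_all_nth
    by (metis in_set_conv_nth subsetI)
  have s: "s \<in> Arr (raw X)" using arr_rel_in[OF X Cons(1)] by simp
  have "arr_rel X (muA a (pre @ (fst r, snd r) # rs)) (muA a (pre @ (fst r, snd s) # rs))"
    using Cons(1) Cons.prems rs by (intro mu_slot[OF X]) (auto simp: arr_rel_def)
  moreover have "(fst r, snd s) = s" using Cons(1) by (simp add: arr_rel_def)
  moreover have "arr_rel X (muA a ((pre @ [s]) @ rs)) (muA a ((pre @ [s]) @ ss))"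
    by (rule Cons.IH) (use Cons.prems s in simp_all)
  ultimately show ?case using arr_rel_trans by fastforce
qed

lemma mu_cl_eq:
  assumes X: "category X" and "a \<in> Arr (pcat P (length rs))" "set rs \<subseteq> Arr (raw X)" "set ss \<subseteq> Arr (raw X)"
    and e: "map (arr_cl X) rs = map (arr_cl X) ss"
  shows "arr_rel X (muA a rs) (muA a ss)"
proof -
  have l: "length rs = length ss" using e by (metis length_map)
  have "arr_rel X (rs ! i) (ss ! i)" if i: "i < length ss" for i
  proof -
    have "rs ! i \<in> Arr (raw X)" "ss ! i \<in> Arr (raw X)" using assms(3,4) i l by auto
    moreover have "arr_cl X (rs ! i) = arr_cl X (ss ! i)" using e i l by (metis nth_map)
    ultimately show ?thesis using arr_rel_iff by blast
  qed
  then have "list_all2 (arr_rel X) rs ss" using l by (simp add: list_all2_conv_all_nth)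
  then show ?thesis using mu_rel[OF X, of rs ss a "[]"] assms(2) by simp
qed

text \<open>Here the relation lives on lists of classes. The lists of representatives are
  universally quantified, so that transitivity and composition may choose fresh ones in between. For
  a generator, \<open>mu_equivar_outer\<close> gives a permuted list, which \<open>mu_cl_eq\<close>
  exchanges for the prescribed one.\<close>

lemma mu_outer:
  assumes X: "category X"
  shows "arr_eq n (Tcat X) z w \<Longrightarrow>
    set rs \<subseteq> Arr (raw X) \<Longrightarrow> set ss \<subseteq> Arr (raw X) \<Longrightarrow>
    map (arr_cl X) rs = snd z \<Longrightarrow> map (arr_cl X) ss = snd w \<Longrightarrow>
    arr_rel X (muA (fst z) rs) (muA (fst w) ss)"
proof (induction arbitrary: rs ss rule: arr_eq.induct)
  case (gen p fs g)
  have p: "p \<in> Arr (pcat P n)" and l: "length rs = n" using gen by (auto simp: Arr_power)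
  have "set (lact n g rs) \<subseteq> set rs"
    using lact_index[OF gen(2)] l by (auto simp: in_set_conv_nth nth_lact) (metis One_nat_def)
  moreover have "map (arr_cl X) (lact n g rs) = map (arr_cl X) ss"
    using gen(5,6) lact_map[OF gen(2) l, of "arr_cl X"] by simp
  ultimately have "arr_rel X (muA p (lact n g rs)) (muA p ss)"
    using gen(3,4) p l by (intro mu_cl_eq[OF X]) auto
  then show ?case using mu_equivar_outer[OF p l gen(3,2)] arr_rel_trans by simp
next
  case (refl z)
  then have "length rs = length (snd z)" by (metis length_map)
  with refl show ?case by (intro mu_cl_eq[OF X]) (auto simp: Arr_power)
next
  case (sym z w)
  then show ?case by (blast intro: arr_rel_sym)
next
  case (trans z w v)
  have "w \<in> Arr (power_cat n (Tcat X))" using arr_eq_Arr[OF Tcat_category[OF X] trans(1)] by simp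
  then have w: "set (snd w) \<subseteq> Arr (Tcat X)" by (rule Arr_power_set)
  let ?ts = "map repr (snd w)"
  have "set ?ts \<subseteq> Arr (raw X)" "map (arr_cl X) ?ts = snd w"
    by (rule repr_arrs[OF X w])+
  then show ?case using trans.IH(1)[of rs ?ts] trans.IH(2)[of ?ts ss] trans.prems arr_rel_trans by blast
next
  case (comp b b' d d')
  note TX = Tcat_category[OF X]
  have in_arr: "b \<in> Arr (power_cat n (Tcat X))" "b' \<in> Arr (power_cat n (Tcat X))"
    "d \<in> Arr (power_cat n (Tcat X))" "d' \<in> Arr (power_cat n (Tcat X))"
    using arr_eq_Arr[OF TX comp(1)] arr_eq_Arr[OF TX comp(2)] by auto
  \<comment> \<open>Representatives of a composite are exchanged for entrywise composites of
    composable representatives of the two factors. By the interchange law the result of the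
    multiplication is then a composite, and the induction hypotheses apply to its factors.\<close>
  have lift: "\<exists>es fs. set es \<subseteq> Arr (raw X) \<and> set fs \<subseteq> Arr (raw X) \<and> map (arr_cl X) es = snd e \<and>
      map (arr_cl X) fs = snd f \<and>
      arr_rel X (muA (fst (Comp (power_cat n (Tcat X)) e f)) ts)
        (Comp (raw X) (muA (fst e) es) (muA (fst f) fs)) \<and>
      Dom (raw X) (muA (fst e) es) = Cod (raw X) (muA (fst f) fs)"
    if e: "e \<in> Arr (power_cat n (Tcat X))" and f: "f \<in> Arr (power_cat n (Tcat X))"
      and d: "Dom (power_cat n (Tcat X)) e = Cod (power_cat n (Tcat X)) f"
      and ts: "set ts \<subseteq> Arr (raw X)" "map (arr_cl X) ts = snd (Comp (power_cat n (Tcat X)) e f)" for e f ts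
  proof -
    let ?fs = "map repr (snd f)"
    have le: "length (snd e) = n" and lf: "length (snd f) = n" using e f by (simp_all add: Arr_power)
    have fs: "set ?fs \<subseteq> Arr (raw X)" "map (arr_cl X) ?fs = snd f"
      by (rule repr_arrs[OF X Arr_power_set[OF f]])+
    have d': "Dom (pcat P n) (fst e) = Cod (pcat P n) (fst f)"
      "map (Dom (Tcat X)) (snd e) = map (Cod (Tcat X)) (snd f)"
      using d le lf by (simp_all add: Dom_power Cod_power)
    have "\<exists>s. s \<in> Arr (raw X) \<and> arr_cl X s = snd e ! i \<and> Dom (raw X) s = Cod (raw X) (?fs ! i)" if i: "i < n" for i
    proof -
      have "Dom (Tcat X) (snd e ! i) = Cod (Tcat X) (snd f ! i)" using d'(2) i le lf by (metis nth_map)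
      moreover have "snd f ! i = arr_cl X (?fs ! i)" using fs(2) i lf by (metis length_map nth_map)
      moreover have "?fs ! i \<in> Arr (raw X)" using fs(1) i lf by (metis length_map nth_mem subsetD)
      moreover have "snd e ! i \<in> Arr (Tcat X)" using e i by (simp add: Arr_power)
      ultimately show ?thesis using arr_cl_composable[OF X] by metis
    qed
    then obtain s where s: "\<And>i. i < n \<Longrightarrow> s i \<in> Arr (raw X)" "\<And>i. i < n \<Longrightarrow> arr_cl X (s i) = snd e ! i"
      "\<And>i. i < n \<Longrightarrow> Dom (raw X) (s i) = Cod (raw X) (?fs ! i)" by metis
    let ?es = "map s [0..<n]"
    have es: "set ?es \<subseteq> Arr (raw X)" "map (arr_cl X) ?es = snd e" "length ?es = n"
      and ds: "map (Dom (raw X)) ?es = map (Cod (raw X)) ?fs"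
      using s le lf by (auto intro!: nth_equalityI)
    have lfs: "length ?fs = n" using lf by simp
    have pe: "fst e \<in> Arr (pcat P n)" "fst f \<in> Arr (pcat P n)" using e f by (simp_all add: Arr_power)
    note mm = mu_maps(3)[OF X lfs pe(2,1) d'(1) fs(1) es(1,3) ds]
    have dm: "Dom (raw X) (muA (fst e) ?es) = Cod (raw X) (muA (fst f) ?fs)"
      using mu_maps(1)[OF X es(3) pe(1) es(1)] mu_maps(2)[OF X lfs pe(2) fs(1)] d'(1) ds by simp
    let ?c = "map2 (Comp (raw X)) ?es ?fs"
    have ci: "es' \<in> Arr (raw X) \<and> fs' \<in> Arr (raw X) \<and> Dom (raw X) es' = Cod (raw X) fs'"
      if mem: "(es', fs') \<in> set (zip ?es ?fs)" for es' fs'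
    proof -
      obtain i where i: "i < n" "es' = s i" "fs' = ?fs ! i" using mem by (auto simp: set_zip lf)
      moreover have "?fs ! i \<in> Arr (raw X)" using fs(1) i(1) lfs by (metis nth_mem subsetD)
      ultimately show ?thesis using s by simp
    qed
    have c1: "set ?c \<subseteq> Arr (raw X)"
    proof
      fix r assume "r \<in> set ?c"
      then obtain pr where "pr \<in> set (zip ?es ?fs)" "r = Comp (raw X) (fst pr) (snd pr)"
        unfolding set_map by (auto simp: case_prod_unfold)
      then show "r \<in> Arr (raw X)"
        using ci[of "fst pr" "snd pr"] category.Comp_in[OF raw_category[OF X]] by simp
    qed
    have pc: "map (arr_cl X) (map2 (Comp (raw X)) es fs)
        = map2 (Comp (Tcat X)) (map (arr_cl X) es) (map (arr_cl X) fs)"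
      if "\<And>e' f'. (e', f') \<in> set (zip es fs) \<Longrightarrow>
        e' \<in> Arr (raw X) \<and> f' \<in> Arr (raw X) \<and> Dom (raw X) e' = Cod (raw X) f'" for es fs
      using that by (auto simp: zip_map_map Tcat_maps(4)[OF X])
    have "map (arr_cl X) ?c = map2 (Comp (Tcat X)) (map (arr_cl X) ?es) (map (arr_cl X) ?fs)"
      by (rule pc[OF ci])
    also have "\<dots> = map (arr_cl X) ts" unfolding es(2) fs(2) ts(2) using le lf by (simp add: Comp_power)
    finally have c2: "map (arr_cl X) ts = map (arr_cl X) ?c" ..
    have "length ts = n" using arg_cong[OF c2, of length] lf by simp
    moreover have "Comp (pcat P n) (fst e) (fst f) \<in> Arr (pcat P n)"
      using category.Comp_in[OF P_cat pe d'(1)] .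
    ultimately have "arr_rel X (muA (Comp (pcat P n) (fst e) (fst f)) ts) (muA (Comp (pcat P n) (fst e) (fst f)) ?c)"
      using ts c1 c2 by (intro mu_cl_eq[OF X]) auto
    then show ?thesis using es fs dm mm le lf by (intro exI[of _ ?es] exI[of _ ?fs]) (simp add: Comp_power)
  qed
  obtain es fs where 1: "set es \<subseteq> Arr (raw X)" "set fs \<subseteq> Arr (raw X)" "map (arr_cl X) es = snd b"
      "map (arr_cl X) fs = snd d"
      "arr_rel X (muA (fst (Comp (power_cat n (Tcat X)) b d)) rs)
        (Comp (raw X) (muA (fst b) es) (muA (fst d) fs))"
      "Dom (raw X) (muA (fst b) es) = Cod (raw X) (muA (fst d) fs)"
    using lift[OF in_arr(1,3) comp.hyps(3) comp.prems(1,3)] by blast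
  obtain es' fs' where 2: "set es' \<subseteq> Arr (raw X)" "set fs' \<subseteq> Arr (raw X)" "map (arr_cl X) es' = snd b'"
      "map (arr_cl X) fs' = snd d'"
      "arr_rel X (muA (fst (Comp (power_cat n (Tcat X)) b' d')) ss)
        (Comp (raw X) (muA (fst b') es') (muA (fst d') fs'))"
      "Dom (raw X) (muA (fst b') es') = Cod (raw X) (muA (fst d') fs')"
    using lift[OF in_arr(2,4) comp.hyps(4) comp.prems(2,4)] by blast
  have "arr_rel X (Comp (raw X) (muA (fst b) es) (muA (fst d) fs)) (Comp (raw X) (muA (fst b') es') (muA (fst d') fs'))"
    by (rule arr_rel_comp[OF comp.IH(1)[OF 1(1) 2(1) 1(3) 2(3)] comp.IH(2)[OF 1(2) 2(2) 1(4) 2(4)] 1(6) 2(6)])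
  with 1(5) 2(5) show ?case by (blast intro: arr_rel_trans arr_rel_sym)
qed

lemma arr_rel_cl: "category X \<Longrightarrow> arr_rel X r s \<Longrightarrow> arr_cl X r = arr_cl X s"
  using arr_rel_iff arr_rel_in by blast

lemma Tmu_repr:
  "omap (Tmu X) z = obj_cl X (muO (fst (snd (repr z))) (map repr (snd (snd (repr z)))))"
  "amap (Tmu X) w = arr_cl X (muA (fst (snd (repr w))) (map repr (snd (snd (repr w)))))"
  by (simp_all add: Tmu_def obj_cl_def arr_cl_def repr_def raw_mu_def Let_def case_prod_unfold o_def)

lemma TT_obj_in:
  assumes "p \<in> Obj (pcat P n)" "set rs \<subseteq> Obj (raw X)" "length rs = n"
  shows "(n, p, map (obj_cl X) rs) \<in> Obj (raw (Tcat X))"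
proof -
  have "obj_cl X ` set rs \<subseteq> Obj (Tcat X)" using assms(2) obj_cl_in by blast
  then show ?thesis using assms by (simp add: Obj_raw)
qed

lemma TT_arr_in:
  assumes "a \<in> Arr (pcat P n)" "set rs \<subseteq> Arr (raw X)" "length rs = n"
  shows "(n, a, map (arr_cl X) rs) \<in> Arr (raw (Tcat X))"
proof -
  have "arr_cl X ` set rs \<subseteq> Arr (Tcat X)" using assms(2) arr_cl_in by blast
  then show ?thesis using assms by (simp add: Arr_raw)
qed

lemma Tmu_arr:
  assumes X: "category X" and a: "a \<in> Arr (pcat P n)" and rs: "set rs \<subseteq> Arr (raw X)" and l: "length rs = n"
  shows "amap (Tmu X) (arr_cl (Tcat X) (n, a, map (arr_cl X) rs)) = arr_cl X (muA a rs)"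
proof -
  let ?s = "(n, a, map (arr_cl X) rs)" and ?z = "arr_cl (Tcat X) (n, a, map (arr_cl X) rs)"
  note TX = Tcat_category[OF X]
  have s: "?s \<in> Arr (raw (Tcat X))" using TT_arr_in[OF a rs l] .
  note r = repr_arr[OF TX arr_cl_in[OF s]]
  have z: "set (snd (snd (repr ?z))) \<subseteq> Arr (Tcat X)" using r(1) by (simp add: Arr_raw)
  have "arr_eq n (Tcat X) (snd ?s) (snd (repr ?z))"
    using repr_arr_rel[OF TX s] by (simp add: arr_rel_def)
  then have "arr_rel X (muA (fst (snd ?s)) rs) (muA (fst (snd (repr ?z))) (map repr (snd (snd (repr ?z)))))"
    by (rule mu_outer[OF X _ rs repr_arrs(1)[OF X z] _ repr_arrs(2)[OF X z]]) simp
  then have "arr_rel X (muA a rs) (muA (fst (snd (repr ?z))) (map repr (snd (snd (repr ?z)))))"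
    unfolding snd_conv fst_conv .
  from arr_rel_cl[OF X this] show ?thesis unfolding Tmu_repr by (rule HOL.sym)
qed

text \<open>Representatives of objects are compared through their identity arrows.\<close>

lemma Tmu_obj:
  assumes X: "category X" and p: "p \<in> Obj (pcat P n)" and rs: "set rs \<subseteq> Obj (raw X)" and l: "length rs = n"
  shows "omap (Tmu X) (obj_cl (Tcat X) (n, p, map (obj_cl X) rs)) = obj_cl X (muO p rs)"
proof -
  let ?s = "(n, p, map (obj_cl X) rs)" and ?z = "obj_cl (Tcat X) (n, p, map (obj_cl X) rs)"
  let ?q = "fst (snd (repr ?z))" and ?zs = "snd (snd (repr ?z))"
  note TX = Tcat_category[OF X]
  interpret R: category "raw X" by (rule raw_category[OF X])
  interpret TX: category "Tcat X" by (rule TX)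
  have s: "?s \<in> Obj (raw (Tcat X))" using TT_obj_in[OF p rs l] .
  note r = repr_obj[OF obj_cl_in[OF s]]
  have z: "set ?zs \<subseteq> Obj (Tcat X)" and q: "?q \<in> Obj (pcat P n)" and lz: "length ?zs = n"
    using r(1) by (simp_all add: Obj_raw)
  have ids: "set (map (Id (raw X)) ts) \<subseteq> Arr (raw X)"
    "map (arr_cl X) (map (Id (raw X)) ts) = map (Id (Tcat X)) (map (obj_cl X) ts)"
    if "set ts \<subseteq> Obj (raw X)" for ts
    using that by (induction ts) (simp_all add: R.Id_in Tcat_maps(3)[OF X])
  have "obj_eq n (Tcat X) (snd ?s) (snd (repr ?z))"
    using repr_obj_rel[OF s] by (simp add: obj_rel_def)
  from arr_eq_cell[where t = "Id (Tcat X)" and Y = "Tcat X", OF TX.Id_in this]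
  have "arr_eq n (Tcat X) (Id (pcat P n) p, map (Id (Tcat X)) (map (obj_cl X) rs))
      (Id (pcat P n) ?q, map (Id (Tcat X)) ?zs)" by (simp only: fst_conv snd_conv)
  from mu_outer[OF X this, of "map (Id (raw X)) rs" "map (Id (raw X)) (map repr ?zs)"]
  have "arr_rel X (muA (Id (pcat P n) p) (map (Id (raw X)) rs))
      (muA (Id (pcat P n) ?q) (map (Id (raw X)) (map repr ?zs)))"
    using ids[OF rs] ids[OF repr_objs(1)[OF z]] repr_objs(2)[OF z] by (simp only: fst_conv snd_conv)
  then have "arr_rel X (Id (raw X) (muO p rs)) (Id (raw X) (muO ?q (map repr ?zs)))"
    using mu_Id[OF p rs l] mu_Id[OF q repr_objs(1)[OF z]] lz by simp
  then have "arr_cl X (Id (raw X) (muO p rs)) = arr_cl X (Id (raw X) (muO ?q (map repr ?zs)))"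
    by (rule arr_rel_cl[OF X])
  moreover have o: "muO p rs \<in> Obj (raw X)" "muO ?q (map repr ?zs) \<in> Obj (raw X)"
    using mu_in_Obj[OF p rs l] mu_in_Obj[OF q repr_objs(1)[OF z]] lz by simp_all
  \<comment> \<open>\<open>mu_outer\<close> compares arrows; an object is recovered as the domain of
    its identity.\<close>
  ultimately have "Dom (Tcat X) (Id (Tcat X) (obj_cl X (muO p rs)))
      = Dom (Tcat X) (Id (Tcat X) (obj_cl X (muO ?q (map repr ?zs))))"
    by (simp only: Tcat_maps(3)[OF X])
  then show ?thesis unfolding Tmu_repr using o by (simp add: TX.Dom_Id obj_cl_in)
qed

section \<open>Naturality, associativity and unit laws of the monad\<close>

lemma TT_obj_cases:
  assumes "z \<in> Obj (Tcat (Tcat X))"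
  obtains n p rs where "p \<in> Obj (pcat P n)" "set rs \<subseteq> Obj (raw X)" "length rs = n"
    "z = obj_cl (Tcat X) (n, p, map (obj_cl X) rs)"
proof -
  note r = repr_obj[OF assms]
  have s: "set (snd (snd (repr z))) \<subseteq> Obj (Tcat X)" using r(1) by (simp add: Obj_raw)
  show ?thesis
    using that[of "fst (snd (repr z))" "fst z" "map repr (snd (snd (repr z)))"] r repr_objs[OF s]
    by (simp add: Obj_raw) (metis fst_cl(3) prod.collapse)
qed

lemma TT_arr_cases:
  assumes X: "category X" and "z \<in> Arr (Tcat (Tcat X))"
  obtains n a rs where "a \<in> Arr (pcat P n)" "set rs \<subseteq> Arr (raw X)" "length rs = n"
    "z = arr_cl (Tcat X) (n, a, map (arr_cl X) rs)"
proof -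
  note r = repr_arr[OF Tcat_category[OF X] assms(2)]
  have s: "set (snd (snd (repr z))) \<subseteq> Arr (Tcat X)" using r(1) by (simp add: Arr_raw)
  show ?thesis
    using that[of "fst (snd (repr z))" "fst z" "map repr (snd (snd (repr z)))"] r repr_arrs[OF X s]
    by (simp add: Arr_raw) (metis fst_cl(3) prod.collapse)
qed

lemma Tmu_maps:
  assumes X: "category X"
  shows "z \<in> Obj (Tcat (Tcat X)) \<Longrightarrow> omap (Tmu X) z \<in> Obj (Tcat X)"
    and "f \<in> Arr (Tcat (Tcat X)) \<Longrightarrow> amap (Tmu X) f \<in> Arr (Tcat X)"
    and "f \<in> Arr (Tcat (Tcat X)) \<Longrightarrow> Dom (Tcat X) (amap (Tmu X) f) = omap (Tmu X) (Dom (Tcat (Tcat X)) f)"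
    and "f \<in> Arr (Tcat (Tcat X)) \<Longrightarrow> Cod (Tcat X) (amap (Tmu X) f) = omap (Tmu X) (Cod (Tcat (Tcat X)) f)"
proof -
  note TX = Tcat_category[OF X]
  show "omap (Tmu X) z \<in> Obj (Tcat X)" if "z \<in> Obj (Tcat (Tcat X))"
    using that by (rule TT_obj_cases) (simp add: Tmu_obj[OF X] obj_cl_in mu_in_Obj)
  assume f: "f \<in> Arr (Tcat (Tcat X))"
  obtain n a rs where a: "a \<in> Arr (pcat P n)" and rs: "set rs \<subseteq> Arr (raw X)" and l: "length rs = n"
    and fe: "f = arr_cl (Tcat X) (n, a, map (arr_cl X) rs)"
    using TT_arr_cases[OF X f] .
  note m = Tmu_arr[OF X a rs l, folded fe]
  interpret R: category "raw X" by (rule raw_category[OF X])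
  interpret Pn: category "pcat P n" by (rule P_cat)
  show "amap (Tmu X) f \<in> Arr (Tcat X)" by (simp add: m arr_cl_in mu_in_Arr[OF a rs l])
  have d: "set (map (Dom (raw X)) rs) \<subseteq> Obj (raw X)" "set (map (Cod (raw X)) rs) \<subseteq> Obj (raw X)"
    "map (Dom (Tcat X)) (map (arr_cl X) rs) = map (obj_cl X) (map (Dom (raw X)) rs)"
    "map (Cod (Tcat X)) (map (arr_cl X) rs) = map (obj_cl X) (map (Cod (raw X)) rs)"
    using rs by (induction rs) (simp_all add: R.Dom_in R.Cod_in Tcat_maps(1,2)[OF X])
  note s = TT_arr_in[OF a rs l]
  have "Dom (Tcat (Tcat X)) f = obj_cl (Tcat X) (n, Dom (pcat P n) a, map (obj_cl X) (map (Dom (raw X)) rs))"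
    unfolding fe Tcat_maps(1)[OF TX s] using l d by (simp add: raw_maps del: map_map)
  then show "Dom (Tcat X) (amap (Tmu X) f) = omap (Tmu X) (Dom (Tcat (Tcat X)) f)"
    using Tmu_obj[OF X Pn.Dom_in[OF a] d(1)] l mu_maps(1)[OF X l a rs] Tcat_maps(1)[OF X mu_in_Arr[OF a rs l]]
    by (simp add: m)
  have "Cod (Tcat (Tcat X)) f = obj_cl (Tcat X) (n, Cod (pcat P n) a, map (obj_cl X) (map (Cod (raw X)) rs))"
    unfolding fe Tcat_maps(2)[OF TX s] using l d by (simp add: raw_maps del: map_map)
  then show "Cod (Tcat X) (amap (Tmu X) f) = omap (Tmu X) (Cod (Tcat (Tcat X)) f)"
    using Tmu_obj[OF X Pn.Cod_in[OF a] d(2)] l mu_maps(2)[OF X l a rs] Tcat_maps(2)[OF X mu_in_Arr[OF a rs l]]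
    by (simp add: m)
qed

lemma raw_map_mu:
  "raw_map h (raw_mu m p rs) = raw_mu m p (map (raw_map h) rs)"
  by (simp add: raw_map_def raw_mu_def o_def map_concat)

lemma Tmu_natural_obj:
  assumes X: "category X" and Y: "category Y" and F: "\<And>x. x \<in> Obj X \<Longrightarrow> omap F x \<in> Obj Y"
    and z: "z \<in> Obj (Tcat (Tcat X))"
  shows "omap (Tfun Y F) (omap (Tmu X) z) = omap (Tmu Y) (omap (Tfun (Tcat Y) (Tfun Y F)) z)"
proof -
  obtain n p rs where p: "p \<in> Obj (pcat P n)" and rs: "set rs \<subseteq> Obj (raw X)" and l: "length rs = n"
    and z: "z = obj_cl (Tcat X) (n, p, map (obj_cl X) rs)"
    using TT_obj_cases[OF z] .
  have rs': "set (map (raw_map (omap F)) rs) \<subseteq> Obj (raw Y)"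
    "map (omap (Tfun Y F)) (map (obj_cl X) rs) = map (obj_cl Y) (map (raw_map (omap F)) rs)"
    using rs by (induction rs) (simp_all add: raw_map_in[of X _ Y, OF F] Tfun_obj[of X F Y, OF F])
  have "omap (Tfun (Tcat Y) (Tfun Y F)) z
      = obj_cl (Tcat Y) (n, p, map (obj_cl Y) (map (raw_map (omap F)) rs))"
    using Tfun_obj[of "Tcat X" "Tfun Y F" "Tcat Y", OF Tfun_obj_in[of X F Y, OF F] TT_obj_in[OF p rs l]] rs'(2)
    by (simp add: z raw_map_def[of "omap (Tfun Y F)"] del: map_map)
  then show ?thesis
    using Tmu_obj[OF Y p rs'(1)] l Tmu_obj[OF X p rs l] Tfun_obj[of X F Y, OF F mu_in_Obj[OF p rs l]]
    by (simp add: z raw_map_mu)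
qed

lemma Tmu_natural_arr:
  assumes X: "category X" and Y: "category Y" and F: "is_functor X Y F" and z: "z \<in> Arr (Tcat (Tcat X))"
  shows "amap (Tfun Y F) (amap (Tmu X) z) = amap (Tmu Y) (amap (Tfun (Tcat Y) (Tfun Y F)) z)"
proof -
  obtain n p rs where p: "p \<in> Arr (pcat P n)" and rs: "set rs \<subseteq> Arr (raw X)" and l: "length rs = n"
    and z: "z = arr_cl (Tcat X) (n, p, map (arr_cl X) rs)"
    using TT_arr_cases[OF X z] .
  have rs': "set (map (raw_map (amap F)) rs) \<subseteq> Arr (raw Y)"
    "map (amap (Tfun Y F)) (map (arr_cl X) rs) = map (arr_cl Y) (map (raw_map (amap F)) rs)"
    using rs is_functorD(2)[OF raw_map_functor[OF F]]
    by (induction rs) (simp_all add: Tfun_arr[OF X F])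
  have "amap (Tfun (Tcat Y) (Tfun Y F)) z
      = arr_cl (Tcat Y) (n, p, map (arr_cl Y) (map (raw_map (amap F)) rs))"
    using Tfun_arr[OF Tcat_category[OF X] Tfun_functor[OF X Y F] TT_arr_in[OF p rs l]] rs'(2)
    by (simp add: z raw_map_def[of "amap (Tfun Y F)"] del: map_map)
  then show ?thesis
    using Tmu_arr[OF Y p rs'(1)] l Tmu_arr[OF X p rs l] Tfun_arr[OF X F mu_in_Arr[OF p rs l]]
    by (simp add: z raw_map_mu)
qed

text \<open>Operad associativity at the nested list of arities \<open>?ls\<close>. Since
  concatenation is associative on the nose, the multiplication is strictly associative already on
  representatives.\<close>

lemma mu_assoc_raw:
  assumes p: "p \<in> Obj (pcat P (length ts))"
    and ts: "\<And>q rs. (q, rs) \<in> set ts \<Longrightarrow> q \<in> Obj (pcat P (length rs)) \<and> set rs \<subseteq> Obj (raw X)"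
  shows "muO p (map (\<lambda>(q, rs). muO q rs) ts)
    = muO (pmuO P (map (\<lambda>(q, rs). length rs) ts) p (map fst ts)) (concat (map snd ts))"
proof -
  interpret O: lambda_set_operad L "\<lambda>n. Obj (pcat P n)" "pid P" "pmuO P" "pactO P" by (rule P_obj)
  let ?ls = "map (\<lambda>(q, rs). map fst rs) ts" and ?qs = "map fst ts"
  let ?rs = "map (\<lambda>(q, rs). map (\<lambda>r. fst (snd r)) rs) ts"
  have "r \<in> Obj (raw X)" if "t \<in> set ts" "r \<in> set (snd t)" for t r
    using ts[of "fst t" "snd t"] that by auto
  then have r: "fst (snd r) \<in> Obj (pcat P (fst r))" if "t \<in> set ts" "r \<in> set (snd t)" for t r
    using that by (simp add: Obj_raw)
  have 1: "?qs \<in> tuples (\<lambda>n. Obj (pcat P n)) (map length ?ls)"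
    using ts by (auto simp: tuples_def list_all2_map1 list_all2_map2 list_all2_same)
  have 2: "list_all2 (\<lambda>ls rs. rs \<in> tuples (\<lambda>n. Obj (pcat P n)) ls) ?ls ?rs"
    using r by (auto simp: tuples_def list_all2_map1 list_all2_map2 list_all2_same case_prod_unfold)
  have "map (\<lambda>(ls, q, rs). pmuO P ls q rs) (zip ?ls (zip ?qs ?rs))
      = map (\<lambda>r. fst (snd r)) (map (\<lambda>(q, rs). muO q rs) ts)"
    by (rule nth_equalityI) (simp_all add: raw_mu_def case_prod_unfold)
  with O.m_assoc[of p ?ls, OF _ 1 2] p
  have e: "pmuO P (concat ?ls) (pmuO P (map length ?ls) p ?qs) (concat ?rs)
      = pmuO P (map sum_list ?ls) p (map (\<lambda>r. fst (snd r)) (map (\<lambda>(q, rs). muO q rs) ts))" by simp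
  have f: "map fst (concat (map snd ts)) = concat ?ls" "map (\<lambda>r. fst (snd r)) (concat (map snd ts)) = concat ?rs"
    "map length ?ls = map (\<lambda>(q, rs). length rs) ts"
    "map sum_list ?ls = map fst (map (\<lambda>(q, rs). muO q rs) ts)"
    by (simp_all add: map_concat case_prod_unfold raw_mu_def o_def)
  have g: "concat (map (\<lambda>r. snd (snd r)) (map (\<lambda>(q, rs). muO q rs) ts)) = concat (map (\<lambda>r. snd (snd r)) (concat (map snd ts)))"
    "sum_list (map fst (map (\<lambda>(q, rs). muO q rs) ts)) = sum_list (map fst (concat (map snd ts)))"
    by (induction ts) (auto simp: raw_mu_def)
  show ?thesis unfolding raw_mu_def[of _ p] raw_mu_def[of _ "pmuO P _ _ _"] g using e f
    by (simp only:)
qed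

text \<open>An object of the triple application is written with representatives at all three levels,
  collected in \<open>ts\<close>. Then \<open>Tmu_obj\<close> evaluates both sides and
  \<open>mu_assoc_raw\<close> compares them.\<close>

lemma Tmu_assoc:
  assumes X: "category X" and z: "z \<in> Obj (Tcat (Tcat (Tcat X)))"
  shows "omap (Tmu X) (omap (Tfun (Tcat X) (Tmu X)) z) = omap (Tmu X) (omap (Tmu (Tcat X)) z)"
proof -
  note TX = Tcat_category[OF X]
  \<comment> \<open>Forgets representatives at the innermost level only: each member of
    \<open>ts\<close> becomes an operation applied to classes.\<close>
  define inner where "inner = (\<lambda>(q, rs). (length rs, q, map (obj_cl X) rs) :: nat \<times> 'po \<times> ('po, 'a) tens list)"
  obtain n p ss where p: "p \<in> Obj (pcat P n)" and ss: "set ss \<subseteq> Obj (raw (Tcat X))" and l: "length ss = n"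
    and z: "z = obj_cl (Tcat (Tcat X)) (n, p, map (obj_cl (Tcat X)) ss)"
    using TT_obj_cases[OF z] .
  define ts where "ts = map (\<lambda>s. (fst (snd s), map repr (snd (snd s)))) ss"
  have in_ts: "s = inner (fst (snd s), map repr (snd (snd s)))" "set (map repr (snd (snd s))) \<subseteq> Obj (raw X)"
    if "s \<in> set ss" for s
  proof -
    have s: "s \<in> Obj (raw (Tcat X))" using that ss by blast
    then have "set (snd (snd s)) \<subseteq> Obj (Tcat X)" "length (snd (snd s)) = fst s" by (simp_all add: Obj_raw)
    then show "s = inner (fst (snd s), map repr (snd (snd s)))" "set (map repr (snd (snd s))) \<subseteq> Obj (raw X)"
      using repr_objs[of "snd (snd s)" X] by (simp_all add: inner_def)
  qed
  have ss_ts: "ss = map inner ts" unfolding ts_def map_map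
    by (rule map_idI[symmetric]) (use in_ts in simp)
  have lt: "length ts = n" using l by (simp add: ts_def)
  have tt: "q \<in> Obj (pcat P (length rs)) \<and> set rs \<subseteq> Obj (raw X)" if "(q, rs) \<in> set ts" for q rs
    using that ss in_ts(2) unfolding ts_def subset_iff Obj_raw by fastforce
  have cc: "set (concat (map snd ts)) \<subseteq> Obj (raw X)" using tt by fastforce
  let ?ms = "map (\<lambda>(q, rs). muO q rs) ts"
  have ms: "set ?ms \<subseteq> Obj (raw X)" using tt mu_in_Obj by fastforce
  have "map (omap (Tmu X)) (map (obj_cl (Tcat X)) ss) = map (obj_cl X) ?ms"
    unfolding ss_ts map_map
    by (rule map_cong[OF HOL.refl]) (use tt Tmu_obj[OF X] in \<open>auto simp: inner_def\<close>)
  then have "omap (Tfun (Tcat X) (Tmu X)) z = obj_cl (Tcat X) (n, p, map (obj_cl X) ?ms)"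
    using Tfun_obj[of "Tcat (Tcat X)" "Tmu X" "Tcat X", OF Tmu_maps(1)[OF X] TT_obj_in[OF p ss l]]
    by (simp add: z raw_map_def)
  then have L: "omap (Tmu X) (omap (Tfun (Tcat X) (Tmu X)) z) = obj_cl X (muO p ?ms)"
    using Tmu_obj[OF X p ms] lt by simp
  let ?q = "pmuO P (map (\<lambda>(q, rs). length rs) ts) p (map fst ts)" and ?rs = "concat (map snd ts)"
  have m: "muO p ss = (length ?rs, ?q, map (obj_cl X) ?rs)"
    by (auto simp: raw_mu_def ss_ts inner_def case_prod_unfold o_def length_concat map_concat)
  have "muO p ss \<in> Obj (raw (Tcat X))" by (rule mu_in_Obj[OF p ss l])
  then have "?q \<in> Obj (pcat P (length ?rs))" by (simp add: m Obj_raw)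
  then have "omap (Tmu X) (omap (Tmu (Tcat X)) z) = obj_cl X (muO ?q ?rs)"
    using Tmu_obj[OF TX p ss l] Tmu_obj[OF X _ cc] by (simp add: z m)
  then show ?thesis using L mu_assoc_raw[of p ts X, OF _ tt] p lt by simp
qed

lemma pid_in: "pid P \<in> Obj (pcat P 1)"
proof -
  interpret O: lambda_set_operad L "\<lambda>n. Obj (pcat P n)" "pid P" "pmuO P" "pactO P" by (rule P_obj)
  show ?thesis by (rule O.u_in)
qed

lemma Teta_cl:
  "omap (Teta X) x = obj_cl X (1, pid P, [x])"
  "amap (Teta X) f = arr_cl X (1, Id (pcat P 1) (pid P), [f])"
  by (simp_all add: Teta_def obj_cl_def arr_cl_def)

lemma Teta_raw_in: "x \<in> Obj X \<Longrightarrow> (1, pid P, [x]) \<in> Obj (raw X)"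
  "f \<in> Arr X \<Longrightarrow> (1, Id (pcat P 1) (pid P), [f]) \<in> Arr (raw X)"
  using pid_in category.Id_in[OF P_cat pid_in] by (simp_all add: Obj_raw Arr_raw)

lemma Teta_functor:
  assumes X: "category X"
  shows "is_functor X (Tcat X) (Teta X)"
proof -
  interpret P1: category "pcat P 1" by (rule P_cat)
  note p = P1.Dom_Id[OF pid_in] P1.Cod_Id[OF pid_in] P1.Comp_Id[OF P1.Id_in[OF pid_in]]
  show ?thesis
    unfolding is_functor_def Teta_cl
    using p
    by (auto simp: Teta_raw_in obj_cl_in arr_cl_in Tcat_maps[OF X] raw_maps simp del: One_nat_def)
qed

lemma Tfun_Teta_obj:
  assumes F: "\<And>x. x \<in> Obj X \<Longrightarrow> omap F x \<in> Obj Y" and x: "x \<in> Obj X"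
  shows "omap (Tfun Y F) (omap (Teta X) x) = omap (Teta Y) (omap F x)"
  using Tfun_obj[of X F Y, OF F Teta_raw_in(1)[OF x]] by (simp add: Teta_cl raw_map_def)

lemma Tfun_Teta_arr:
  assumes X: "category X" and F: "is_functor X Y F" and f: "f \<in> Arr X"
  shows "amap (Tfun Y F) (amap (Teta X) f) = amap (Teta Y) (amap F f)"
  using Tfun_arr[OF X F Teta_raw_in(2)[OF f]] by (simp add: Teta_cl raw_map_def)

lemma Tcell_Teta:
  assumes t: "\<And>x. x \<in> Obj X \<Longrightarrow> t x \<in> Arr Y" and x: "x \<in> Obj X"
  shows "Tcell Y t (omap (Teta X) x) = amap (Teta Y) (t x)"
  using Tcell_cl[of X t Y, OF t Teta_raw_in(1)[OF x]] by (simp add: Teta_cl raw_cell_def)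

lemma Tmu_Teta:
  assumes X: "category X" and z: "z \<in> Obj (Tcat X)"
  shows "omap (Tmu X) (omap (Teta (Tcat X)) z) = z"
proof -
  interpret O: lambda_set_operad L "\<lambda>n. Obj (pcat P n)" "pid P" "pmuO P" "pactO P" by (rule P_obj)
  note r = repr_obj[OF z]
  have "muO (pid P) [repr z] = repr z"
    using r(1) O.left_unit by (simp add: raw_mu_def Obj_raw prod_eq_iff)
  then show ?thesis using Tmu_obj[OF X pid_in, of "[repr z]"] r by (simp add: Teta_cl)
qed

lemma Tmu_Tfun_Teta:
  assumes X: "category X" and z: "z \<in> Obj (Tcat X)"
  shows "omap (Tmu X) (omap (Tfun (Tcat X) (Teta X)) z) = z"
proof -
  interpret O: lambda_set_operad L "\<lambda>n. Obj (pcat P n)" "pid P" "pmuO P" "pactO P" by (rule P_obj)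
  note r = repr_obj[OF z]
  let ?xs = "snd (snd (repr z))" and ?q = "fst (snd (repr z))"
  let ?rs = "map (\<lambda>x. (1, pid P, [x])) ?xs"
  have q: "?q \<in> Obj (pcat P (fst z))" "length ?xs = fst z" "set ?xs \<subseteq> Obj X" using r(1) by (simp_all add: Obj_raw)
  have rs: "set ?rs \<subseteq> Obj (raw X)" using q(3) Teta_raw_in(1)[of _ X] by auto
  have "muO ?q ?rs = repr z"
    using O.right_unit[OF q(1)] q(2)
    by (simp add: raw_mu_def o_def prod_eq_iff map_replicate_const sum_list_replicate)
  moreover have "omap (Tfun (Tcat X) (Teta X)) z = obj_cl (Tcat X) (fst z, ?q, map (obj_cl X) ?rs)"
    using ext[of "omap (Teta X)", OF Teta_cl(1)] by (simp add: Tfun_repr raw_map_def o_def)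
  ultimately show ?thesis using Tmu_obj[OF X q(1) rs] q(2) r(2) by simp
qed

text \<open>For the strictification: \<open>B\<close> has the objects of \<open>Tcat X\<close> but
  other arrows, even of another type. The relation on objects does not involve arrows, so object
  computations over \<open>B\<close> can be carried out over \<open>Tcat X\<close>.\<close>

lemma Obj_congs:
  assumes "Obj X = Obj Y"
  shows "Obj (Tcat X) = Obj (Tcat Y)" "omap (Tmu X) = omap (Tmu Y)" "omap (Teta X) = omap (Teta Y)"
    "omap F = omap G \<Longrightarrow> omap (Tfun X F) = omap (Tfun Y G)"
proof -
  have p: "Obj (power_cat n X) = Obj (power_cat n Y)" for n
    using assms by (auto simp: Obj_power)
  \<comment> \<open>Stated for arbitrary categories in order to be used in both directions, where
    the types of arrows are interchanged.\<close>
  have imp: "obj_eq n X z w \<Longrightarrow> obj_eq n Y z w"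
    if "\<And>n. Obj (power_cat n X) = Obj (power_cat n Y)" for n z w and X :: "('x, 'y) cat" and Y :: "('x, 'z) cat"
    by (induction rule: obj_eq.induct) (auto simp: that intro: obj_eq.intros)
  have "obj_eq n X z w \<longleftrightarrow> obj_eq n Y z w" for n z w using imp[of X Y] imp[of Y X] p by blast
  then have c: "obj_class n X = obj_class n Y" for n by (simp add: obj_class_def fun_eq_iff)
  then show "Obj (Tcat X) = Obj (Tcat Y)" by (simp add: Tcat_def coprod_cat_def tensor_def p)
  have c': "obj_cl X = obj_cl Y" using c by (simp add: obj_cl_def fun_eq_iff)
  then show "omap (Tmu X) = omap (Tmu Y)" "omap (Teta X) = omap (Teta Y)"
    by (intro ext; simp only: Tmu_repr Teta_cl)+
  show "omap (Tfun X F) = omap (Tfun Y G)" if "omap F = omap G"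
    by (intro ext) (simp only: Tfun_repr c' that)
qed

end

section \<open>Strict algebras\<close>

lemma ftor_comp_simps [simp]:
  "omap (ftor_comp G F) x = omap G (omap F x)" "amap (ftor_comp G F) f = amap G (amap F f)"
  by (simp_all add: ftor_comp_def)

lemma ftor_id_simps [simp]: "omap ftor_id x = x" "amap ftor_id f = f"
  by (simp_all add: ftor_id_def)

lemma ftor_comp_functor: "is_functor C D F \<Longrightarrow> is_functor D E G \<Longrightarrow> is_functor C E (ftor_comp G F)"
  by (simp add: is_functor_def)

lemma ftor_id_functor: "is_functor C C ftor_id"
  by (simp add: is_functor_def)

lemma identity_cell_nat_iso:
  assumes C: "category C" and D: "category D" and F: "is_functor C D F"
    and t: "is_identity_cell C D F G t"
  shows "is_nat_iso C D F G t"
proof -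
  interpret C: category C by fact
  interpret D: category D by fact
  have e: "omap G x = omap F x" "t x = Id D (omap F x)" if "x \<in> Obj C" for x
    using t that by (simp_all add: is_identity_cell_def ftor_eq_def)
  have a: "amap G f = amap F f" if "f \<in> Arr C" for f
    using t that by (simp add: is_identity_cell_def ftor_eq_def)
  note f = is_functorD(1-4)[OF F] e a D.Id_in D.Dom_Id D.Cod_Id C.Dom_in C.Cod_in
  have "Comp D (Id D (omap F (Cod C h))) (amap F h) = amap F h"
    "Comp D (amap F h) (Id D (omap F (Dom C h))) = amap F h" if "h \<in> Arr C" for h
    using D.Id_Comp[of "amap F h"] D.Comp_Id[of "amap F h"] that by (simp_all add: f)
  then have "is_nat_trans C D F G t" "is_nat_trans C D G F t"
    by (simp_all add: is_nat_trans_def f)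
  moreover have "inverse_cells C D F G t t"
    unfolding inverse_cells_def using D.Id_Comp[OF D.Id_in] by (simp add: f)
  ultimately show ?thesis unfolding is_nat_iso_def by blast
qed

context lambda_operad
begin

lemma raw_map_id: "raw_map (omap ftor_id) r = r" "raw_map (amap ftor_id) s = s"
  by (simp_all add: raw_map_def ftor_id_def)

lemma Tfun_id_obj: "z \<in> Obj (Tcat X) \<Longrightarrow> omap (Tfun X ftor_id) z = z"
  by (simp add: Tfun_repr raw_map_id repr_obj)

lemma Tfun_id_arr: "category X \<Longrightarrow> z \<in> Arr (Tcat X) \<Longrightarrow> amap (Tfun X ftor_id) z = z"
  by (simp add: Tfun_repr raw_map_id repr_arr)

text \<open>With identity cells, each coherence equation only says that its identities sit at the
  same object. This follows from the strict laws and the naturality of the multiplication.\<close>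

lemma strict_algebraI:
  assumes Y: "category Y" and b: "is_functor (Tcat Y) Y b"
    and as: "ftor_eq (Tcat (Tcat Y)) (ftor_comp b (Tfun Y b)) (ftor_comp b (Tmu Y))"
    and un: "ftor_eq Y ftor_id (ftor_comp b (Teta Y))"
  shows "strict_algebra \<lparr>carr = Y, str = b,
    assoc_cell = \<lambda>z. Id Y (omap b (omap (Tfun Y b) z)), unit_cell = Id Y\<rparr>"
proof -
  note TY = Tcat_category[OF Y]
  note TTY = Tcat_category[OF TY]
  interpret Y: category Y by fact
  note B = is_functorD(1)[OF b]
  note Tb = Tfun_functor[OF TY Y b]
  note TTb = Tfun_functor[OF TTY TY Tb]
  note bTb = ftor_comp_functor[OF Tb b]
  have c1: "is_identity_cell (Tcat (Tcat Y)) Y (ftor_comp b (Tfun Y b)) (ftor_comp b (Tmu Y))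
      (\<lambda>z. Id Y (omap b (omap (Tfun Y b) z)))"
    using as by (simp add: is_identity_cell_def)
  have c2: "is_identity_cell Y Y ftor_id (ftor_comp b (Teta Y)) (Id Y)"
    using un by (simp add: is_identity_cell_def)
  have as': "omap b (omap (Tfun Y b) z) = omap b (omap (Tmu Y) z)" if "z \<in> Obj (Tcat (Tcat Y))" for z
    using as that by (simp add: ftor_eq_def)
  have un': "omap b (omap (Teta Y) z) = z" if "z \<in> Obj Y" for z
    using un that by (simp add: ftor_eq_def)
  have tid: "amap b (Tcell Y (\<lambda>x. Id Y (omap F x)) z) = Id Y (omap b (omap (Tfun Y F) z))"
    if F: "is_functor Z Y F" and z: "z \<in> Obj (Tcat Z)" for F Z z
    using Tcell_Id[of Y Z F z, OF Y is_functorD(1)[OF F] z] is_functorD(5)[OF b]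
      Tfun_obj_in[of Z F Y z, OF is_functorD(1)[OF F] z] by simp
  have ii: "Comp Y (Id Y x) (Id Y x) = Id Y x" if "x \<in> Obj Y" for x
    using Y.Id_Comp[OF Y.Id_in[OF that]] Y.Cod_Id[OF that] by simp
  have "Comp Y (Id Y (omap b (omap (Tfun Y b) (omap (Tfun (Tcat Y) (Tmu Y)) z))))
         (amap b (Tcell Y (\<lambda>z. Id Y (omap b (omap (Tfun Y b) z))) z))
       = Comp Y (Id Y (omap b (omap (Tfun Y b) (omap (Tmu (Tcat Y)) z))))
         (Id Y (omap b (omap (Tfun Y b) (omap (Tfun (Tcat Y) (Tfun Y b)) z))))"
    if z: "z \<in> Obj (Tcat (Tcat (Tcat Y)))" for z
  proof -
    \<comment> \<open>All four cells in the associativity equation are the identity of this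
      object.\<close>
    let ?o = "omap b (omap (Tfun Y (ftor_comp b (Tfun Y b))) z)"
    have o: "?o \<in> Obj Y" using Tfun_obj_in[OF is_functorD(1)[OF bTb] z] B by simp
    have 1: "omap (Tfun Y b) (omap (Tfun (Tcat Y) (Tmu Y)) z) = omap (Tfun Y (ftor_comp b (Tfun Y b))) z"
      using Tfun_obj_Tfun[of "Tcat (Tcat Y)" "Tmu Y" "Tcat Y" b Y, OF Tmu_maps(1)[OF Y] B z]
        Tfun_obj_cong[OF z, of "ftor_comp b (Tmu Y)" "ftor_comp b (Tfun Y b)" Y] as' by simp
    have 2: "omap (Tfun Y b) (omap (Tfun (Tcat Y) (Tfun Y b)) z) = omap (Tfun Y (ftor_comp b (Tfun Y b))) z"
      using Tfun_obj_Tfun[of "Tcat (Tcat Y)" "Tfun Y b" "Tcat Y" b Y, OF is_functorD(1)[OF Tb] B z] by simp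
    have 3: "omap b (omap (Tfun Y b) (omap (Tmu (Tcat Y)) z)) = ?o"
      using Tmu_natural_obj[of "Tcat Y" Y b z, OF TY Y B z] as'[OF is_functorD(1)[OF TTb z]] 2 by simp
    show ?thesis
      using tid[OF bTb z] ii[OF o] by (simp add: 1 2 3)
  qed
  moreover have "Comp Y (Id Y (omap b (omap (Tfun Y b) (omap (Tfun (Tcat Y) (Teta Y)) z))))
      (amap b (Tcell Y (Id Y) z)) = Id Y (omap b z)" if z: "z \<in> Obj (Tcat Y)" for z
  proof -
    have "omap (Tfun Y b) (omap (Tfun (Tcat Y) (Teta Y)) z) = omap (Tfun Y ftor_id) z"
      using Tfun_obj_Tfun[of Y "Teta Y" "Tcat Y" b Y, OF is_functorD(1)[OF Teta_functor[OF Y]] B z]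
        Tfun_obj_cong[OF z, of "ftor_comp b (Teta Y)" ftor_id Y] un' by simp
    then show ?thesis using tid[OF ftor_id_functor z] ii B[OF z] by (simp add: Tfun_id_obj[OF z])
  qed
  ultimately show ?thesis
    using Y b c1 c2 identity_cell_nat_iso[OF TTY Y bTb c1] identity_cell_nat_iso[OF Y Y ftor_id_functor c2]
    by (simp add: strict_algebra_def pseudo_algebra_def)
qed

end

section \<open>Strictification\<close>

text \<open>A pseudo-algebra with its components unbundled. The inverse cells are fixed as data
  because \<open>Phi'\<close> occurs in the definition of \<open>beta\<close>, and \<open>e'\<close>
  in the 2-cells of the equivalence.\<close>

locale pseudo_alg_cells = lambda_operad L P
  for L :: "'g action_operad_data" and P :: "('g, 'po, 'pa) cat_operad_data" +
  fixes X :: "('o, 'a) cat" and al :: "(('po, 'o) tens, ('pa, 'a) tens, 'o, 'a) ftor"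
    and Phi Phi' :: "('po, ('po, 'o) tens) tens \<Rightarrow> 'a" and e e' :: "'o \<Rightarrow> 'a"
  assumes X: "category X" and al: "is_functor (Tcat X) X al"
    and Phi: "is_nat_trans (Tcat (Tcat X)) X (ftor_comp al (Tfun X al)) (ftor_comp al (Tmu X)) Phi"
    and Phi': "is_nat_trans (Tcat (Tcat X)) X (ftor_comp al (Tmu X)) (ftor_comp al (Tfun X al)) Phi'"
    and Phi_inv: "inverse_cells (Tcat (Tcat X)) X (ftor_comp al (Tfun X al)) (ftor_comp al (Tmu X)) Phi Phi'"
    and e: "is_nat_trans X X ftor_id (ftor_comp al (Teta X)) e"
    and e': "is_nat_trans X X (ftor_comp al (Teta X)) ftor_id e'"
    and e_inv: "inverse_cells X X ftor_id (ftor_comp al (Teta X)) e e'"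
    and Phi_assoc: "\<And>z. z \<in> Obj (Tcat (Tcat (Tcat X))) \<Longrightarrow>
         Comp X (Phi (omap (Tfun (Tcat X) (Tmu X)) z)) (amap al (Tcell X Phi z))
         = Comp X (Phi (omap (Tmu (Tcat X)) z)) (Phi (omap (Tfun (Tcat X) (Tfun X al)) z))"
    and right_unit: "\<And>z. z \<in> Obj (Tcat X) \<Longrightarrow>
         Comp X (Phi (omap (Tfun (Tcat X) (Teta X)) z)) (amap al (Tcell X e z)) = Id X (omap al z)"
begin

sublocale X: category X by (rule X)

abbreviation comp (infixr "\<bullet>" 70) where "g \<bullet> f \<equiv> Comp X g f"

section \<open>Arrows with endpoints and cancellation of isomorphisms\<close>

definition arrow :: "'o \<Rightarrow> 'o \<Rightarrow> 'a \<Rightarrow> bool" where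
  "arrow x y f \<longleftrightarrow> f \<in> Arr X \<and> Dom X f = x \<and> Cod X f = y"

lemma arrow_comp: "arrow x y f \<Longrightarrow> arrow y z g \<Longrightarrow> arrow x z (g \<bullet> f)"
  by (auto simp: arrow_def X.Comp_in X.Dom_Comp X.Cod_Comp)

lemma arrow_assoc: "arrow w x f \<Longrightarrow> arrow x y g \<Longrightarrow> arrow y z h \<Longrightarrow> (h \<bullet> g) \<bullet> f = h \<bullet> (g \<bullet> f)"
  by (auto simp: arrow_def X.Comp_assoc)

lemma arrow_unit: "arrow x y f \<Longrightarrow> f \<bullet> Id X x = f" "arrow x y f \<Longrightarrow> Id X y \<bullet> f = f"
  by (auto simp: arrow_def X.Comp_Id X.Id_Comp)

lemma arrow_Id: "x \<in> Obj X \<Longrightarrow> arrow x x (Id X x)"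
  by (simp add: arrow_def X.Id_in X.Dom_Id X.Cod_Id)

definition inverses :: "'o \<Rightarrow> 'o \<Rightarrow> 'a \<Rightarrow> 'a \<Rightarrow> bool" where
  "inverses x y f g \<longleftrightarrow> arrow x y f \<and> arrow y x g \<and> g \<bullet> f = Id X x \<and> f \<bullet> g = Id X y"

lemma inversesD:
  assumes "inverses x y f g"
  shows "arrow x y f" "arrow y x g" "g \<bullet> f = Id X x" "f \<bullet> g = Id X y"
  using assms by (simp_all add: inverses_def)

lemma cancel:
  assumes i: "inverses x y f g"
  shows "arrow w x h \<Longrightarrow> g \<bullet> (f \<bullet> h) = h" "arrow w y k \<Longrightarrow> f \<bullet> (g \<bullet> k) = k"
  using arrow_assoc[OF _ inversesD(1,2)[OF i]] arrow_assoc[OF _ inversesD(2,1)[OF i]]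
    inversesD(3,4)[OF i] arrow_unit(2) by simp_all

lemma inverse_unique:
  assumes i: "inverses x y f g" and h: "arrow y x h" and e: "f \<bullet> h = Id X y \<or> h \<bullet> f = Id X x"
  shows "h = g"
  using e
proof
  assume "f \<bullet> h = Id X y"
  then show ?thesis using cancel(1)[OF i h] arrow_unit(1)[OF inversesD(2)[OF i]] by simp
next
  assume "h \<bullet> f = Id X x"
  with arrow_assoc[OF inversesD(2,1)[OF i] h] have "Id X x \<bullet> g = h \<bullet> Id X y"
    by (simp only: inversesD(4)[OF i])
  then show ?thesis by (simp only: arrow_unit(1)[OF h] arrow_unit(2)[OF inversesD(2)[OF i]])
qed

lemma cancel_right:
  assumes i: "inverses x y f g" and h: "arrow y w h" and k: "arrow y w k" and e: "h \<bullet> f = k \<bullet> f"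
  shows "h = k"
proof -
  have "h \<bullet> (f \<bullet> g) = k \<bullet> (f \<bullet> g)"
    by (simp only: arrow_assoc[OF inversesD(2,1)[OF i] h, symmetric]
        arrow_assoc[OF inversesD(2,1)[OF i] k, symmetric] e)
  then show ?thesis by (simp only: inversesD(4)[OF i] arrow_unit(1)[OF h] arrow_unit(1)[OF k])
qed

section \<open>The cells of a pseudo-algebra at unit objects\<close>

abbreviation "TX \<equiv> Tcat X"
abbreviation "T2X \<equiv> Tcat (Tcat X)"
abbreviation "T3X \<equiv> Tcat (Tcat (Tcat X))"
abbreviation "a \<equiv> omap al"
abbreviation "Ta \<equiv> omap (Tfun X al)"
abbreviation "mu \<equiv> omap (Tmu X)"
abbreviation "eta \<equiv> omap (Teta X)"
abbreviation "Teta' \<equiv> omap (Tfun (Tcat X) (Teta X))"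

lemmas TX = Tcat_category[OF X]
lemmas T2X = Tcat_category[OF TX]
lemmas Tal = Tfun_functor[OF TX X al]
lemmas T2al = Tfun_functor[OF T2X TX Tal]
lemmas eta_functor = Teta_functor[OF X]

lemma obj_in:
  "z \<in> Obj TX \<Longrightarrow> a z \<in> Obj X" "w \<in> Obj T2X \<Longrightarrow> Ta w \<in> Obj TX" "w \<in> Obj T2X \<Longrightarrow> mu w \<in> Obj TX"
  "x \<in> Obj X \<Longrightarrow> eta x \<in> Obj TX" "z \<in> Obj TX \<Longrightarrow> Teta' z \<in> Obj T2X"
  "z \<in> Obj TX \<Longrightarrow> omap (Teta TX) z \<in> Obj T2X"
  using is_functorD(1)[OF al] is_functorD(1)[OF Tal] Tmu_maps(1)[OF X] is_functorD(1)[OF eta_functor]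
    is_functorD(1)[OF Tfun_functor[OF X TX eta_functor]] is_functorD(1)[OF Teta_functor[OF TX]] by blast+

lemma Phi_inverses: "z \<in> Obj T2X \<Longrightarrow> inverses (a (Ta z)) (a (mu z)) (Phi z) (Phi' z)"
  using is_nat_transD[OF Phi] is_nat_transD[OF Phi'] Phi_inv
  by (simp add: inverses_def arrow_def inverse_cells_def)

lemma e_inverses: "x \<in> Obj X \<Longrightarrow> inverses x (a (eta x)) (e x) (e' x)"
  using is_nat_transD[OF e] is_nat_transD[OF e'] e_inv
  by (simp add: inverses_def arrow_def inverse_cells_def)

lemma arrow_al: "f \<in> Arr TX \<Longrightarrow> Dom TX f = z \<Longrightarrow> Cod TX f = w \<Longrightarrow> arrow (a z) (a w) (amap al f)"
  using is_functorD[OF al] by (auto simp: arrow_def)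

lemma arrow_al_eta: "arrow x y f \<Longrightarrow> arrow (a (eta x)) (a (eta y)) (amap al (amap (Teta X) f))"
  using is_functorD[OF eta_functor] by (intro arrow_al) (auto simp: arrow_def)

lemma e_natural: "arrow x y f \<Longrightarrow> e y \<bullet> f = amap al (amap (Teta X) f) \<bullet> e x"
  using is_nat_transD(4)[OF e, of f] by (simp add: arrow_def)

text \<open>\<open>T\<close> on 2-cells and \<open>al\<close> on arrows preserve composites and
  identities, hence inverse pairs. \<open>F\<close> and \<open>G\<close> enter through their object
  parts as names for the endpoints, so they may be built from \<open>Tmu X\<close>.\<close>

lemma al_Tcell_inverses:
  assumes t: "\<And>x. x \<in> Obj Z \<Longrightarrow> inverses (omap F x) (omap G x) (t x) (t' x)"
    and z: "z \<in> Obj (Tcat Z)"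
  shows "inverses (a (omap (Tfun X F) z)) (a (omap (Tfun X G) z))
    (amap al (Tcell X t z)) (amap al (Tcell X t' z))"
proof -
  have ob: "omap F x \<in> Obj X" "omap G x \<in> Obj X" if "x \<in> Obj Z" for x
    using t[OF that] X.Dom_in[of "t x"] X.Cod_in[of "t x"] by (auto simp: inverses_def arrow_def)
  have "t x \<in> Arr X" "t' x \<in> Arr X" if "x \<in> Obj Z" for x
    using t[OF that] by (auto simp: inverses_def arrow_def)
  note in_arr = this
  have dc: "Dom X (t x) = omap F x" "Cod X (t x) = omap G x" "Dom X (t' x) = omap G x" "Cod X (t' x) = omap F x"
    if "x \<in> Obj Z" for x
    using t[OF that] by (auto simp: inverses_def arrow_def)
  note c = Tcell_arr[where Y = X and X = Z and t = t and z = z, OF X in_arr(1) z]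
    and c' = Tcell_arr[where Y = X and X = Z and t = t' and z = z, OF X in_arr(2) z]
  have D: "Dom TX (Tcell X t z) = omap (Tfun X F) z" "Cod TX (Tcell X t z) = omap (Tfun X G) z"
    "Dom TX (Tcell X t' z) = omap (Tfun X G) z" "Cod TX (Tcell X t' z) = omap (Tfun X F) z"
    by (simp_all add: c(2)[OF _ dc(1)] c(3)[OF _ dc(2)] c'(2)[OF _ dc(3)] c'(3)[OF _ dc(4)])
  have "Comp TX (Tcell X t' z) (Tcell X t z) = Tcell X (\<lambda>x. Id X (omap F x)) z"
    "Comp TX (Tcell X t z) (Tcell X t' z) = Tcell X (\<lambda>x. Id X (omap G x)) z"
    using Tcell_comp[where Y = X and X = Z and s = t' and t = t and z = z, OF X in_arr _ z]
      Tcell_comp[where Y = X and X = Z and s = t and t = t' and z = z, OF X in_arr(2,1) _ z] dc t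
    by (auto simp: inverses_def intro: Tcell_cong[OF z])
  then have "Comp TX (Tcell X t' z) (Tcell X t z) = Id TX (omap (Tfun X F) z)"
    "Comp TX (Tcell X t z) (Tcell X t' z) = Id TX (omap (Tfun X G) z)"
    using Tcell_Id[where Y = X and X = Z and F = F, OF X ob(1) z]
      Tcell_Id[where Y = X and X = Z and F = G, OF X ob(2) z] by simp_all
  then show ?thesis
    using is_functorD(6)[OF al c'(1) c(1)] is_functorD(6)[OF al c(1) c'(1)] D
      arrow_al[OF c(1)] arrow_al[OF c'(1)] is_functorD(5)[OF al]
      Tfun_obj_in[of Z F X, OF ob(1) z] Tfun_obj_in[of Z G X, OF ob(2) z]
    by (simp add: inverses_def)
qed

text \<open>The unit axiom exhibits \<open>amap al (Tcell X e z)\<close> as a right inverse of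
  \<open>Phi (Teta' z)\<close>, which is invertible, so it is the inverse. The codomains match
  because \<open>mu (Teta' z) = z\<close>.\<close>

lemma al_Te:
  assumes z: "z \<in> Obj TX"
  shows "amap al (Tcell X e z) = Phi' (Teta' z)" "amap al (Tcell X e' z) = Phi (Teta' z)"
proof -
  have TT: "Ta (Teta' z) = omap (Tfun X (ftor_comp al (Teta X))) z"
    using Tfun_obj_Tfun[of X "Teta X" TX al X, OF obj_in(4,1) z] by simp
  have i: "inverses (a z) (a (Ta (Teta' z))) (amap al (Tcell X e z)) (amap al (Tcell X e' z))"
    using al_Tcell_inverses[of X ftor_id "ftor_comp al (Teta X)" e e', OF _ z] e_inverses
    by (simp add: TT Tfun_id_obj[OF z])
  have p: "inverses (a (Ta (Teta' z))) (a z) (Phi (Teta' z)) (Phi' (Teta' z))"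
    using Phi_inverses[OF obj_in(5)[OF z]] Tmu_Tfun_Teta[OF X z] by simp
  show 1: "amap al (Tcell X e z) = Phi' (Teta' z)"
    by (rule inverse_unique[OF p]) (use i right_unit[OF z] in \<open>auto simp: inverses_def\<close>)
  show "amap al (Tcell X e' z) = Phi (Teta' z)"
    by (rule inverse_unique[OF i, symmetric]) (use p 1 in \<open>auto simp: inverses_def\<close>)
qed

text \<open>The second unit law: \<open>al \<circ> eta\<close> is faithful, being isomorphic to the identity, and it maps
  \<open>Phi (eta z) \<bullet> e (a z)\<close> to an identity by \<open>Phi_assoc\<close> at \<open>[id; [id; z]]\<close>.\<close>

lemma left_unit_law:
  assumes z: "z \<in> Obj TX"
  shows "Phi (omap (Teta TX) z) \<bullet> e (a z) = Id X (a z)"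
proof -
  let ?ez = "omap (Teta TX) z" and ?eez = "omap (Teta T2X) (omap (Teta TX) z)" and ?eaz = "eta (a z)"
  note az = obj_in(1)[OF z] and ez = obj_in(6)[OF z]
  have eez: "?eez \<in> Obj T3X" using is_functorD(1)[OF Teta_functor[OF T2X] ez] .
  have eaz: "?eaz \<in> Obj TX" by (rule obj_in(4)[OF az])
  have Taez: "Ta ?ez = ?eaz" by (rule Tfun_Teta_obj[of TX al X, OF obj_in(1) z])
  have muez: "mu ?ez = z" by (rule Tmu_Teta[OF X z])
  have P: "inverses (a ?eaz) (a z) (Phi ?ez) (Phi' ?ez)" using Phi_inverses[OF ez] by (simp add: Taez muez)
  have E: "inverses (a z) (a ?eaz) (e (a z)) (e' (a z))" by (rule e_inverses[OF az])
  let ?u = "Phi ?ez \<bullet> e (a z)"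
  have u: "arrow (a z) (a z) ?u" using P E arrow_comp by (auto simp: inverses_def)
  have T1: "omap (Tfun TX (Tmu X)) ?eez = ?ez"
    using Tfun_Teta_obj[of T2X "Tmu X" TX, OF obj_in(3) ez] by (simp add: muez)
  have T2: "omap (Tmu TX) ?eez = ?ez" by (rule Tmu_Teta[OF TX ez])
  have T3: "omap (Tfun TX (Tfun X al)) ?eez = Teta' ?eaz"
    using Tfun_Teta_obj[of T2X "Tfun X al" TX, OF obj_in(2) ez] Tfun_Teta_obj[of X "Teta X" TX, OF obj_in(4) az]
    by (simp add: Taez)
  have T4: "Tcell X Phi ?eez = amap (Teta X) (Phi ?ez)"
    by (rule Tcell_Teta[of T2X Phi X, OF is_nat_transD(1)[OF Phi] ez])
  \<comment> \<open>Both multiplications take \<open>?eez\<close> to \<open>?ez\<close>, so the two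
    composites in \<open>Phi_assoc\<close> end with the same invertible \<open>Phi ?ez\<close>.
    Cancelling it yields \<open>k\<close>.\<close>
  have as: "Phi ?ez \<bullet> amap al (amap (Teta X) (Phi ?ez)) = Phi ?ez \<bullet> Phi (Teta' ?eaz)"
    using Phi_assoc[OF eez] by (simp add: T1 T2 T3 T4)
  have p1: "arrow (a (eta (a ?eaz))) (a ?eaz) (amap al (amap (Teta X) (Phi ?ez)))"
    using arrow_al_eta[of "a ?eaz" "a z" "Phi ?ez"] P by (simp add: inverses_def)
  have "Ta (Teta' ?eaz) = eta (a ?eaz)"
  proof -
    have "Teta' ?eaz = omap (Teta TX) ?eaz" using Tfun_Teta_obj[of X "Teta X" TX, OF obj_in(4) az] .
    then show ?thesis using Tfun_Teta_obj[of TX al X, OF obj_in(1) eaz] by simp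
  qed
  moreover have "mu (Teta' ?eaz) = ?eaz" by (rule Tmu_Tfun_Teta[OF X eaz])
  ultimately have p2: "arrow (a (eta (a ?eaz))) (a ?eaz) (Phi (Teta' ?eaz))"
    using Phi_inverses[OF obj_in(5)[OF eaz]] by (simp add: inverses_def)
  have k: "amap al (amap (Teta X) (Phi ?ez)) = Phi (Teta' ?eaz)"
    using cancel(1)[OF P p1] cancel(1)[OF P p2] as by metis
  have T5: "Tcell X e ?eaz = amap (Teta X) (e (a z))"
    by (rule Tcell_Teta[of X e X, OF is_nat_transD(1)[OF e] az])
  have Arr: "Phi ?ez \<in> Arr X" "e (a z) \<in> Arr X" and dc: "Dom X (Phi ?ez) = Cod X (e (a z))"
    using P E by (auto simp: inverses_def arrow_def)
  have "amap al (amap (Teta X) ?u) = amap al (amap (Teta X) (Phi ?ez)) \<bullet> amap al (amap (Teta X) (e (a z)))"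
    using is_functorD(6)[OF ftor_comp_functor[OF eta_functor al] Arr dc] by simp
  \<comment> \<open>By \<open>k\<close> the product is the left side of the unit axiom at
    \<open>eta (a z)\<close>.\<close>
  also have "\<dots> = Id X (a ?eaz)" using right_unit[OF eaz] by (simp add: k T5)
  \<comment> \<open>Faithfulness is used through naturality: \<open>e (a z)\<close> after
    \<open>?u\<close> equals the image of \<open>?u\<close>, an identity, after
    \<open>e (a z)\<close>. As \<open>e (a z)\<close> is invertible, \<open>?u\<close> is an
    identity.\<close>
  finally have "e (a z) \<bullet> ?u = Id X (a ?eaz) \<bullet> e (a z)" using e_natural[OF u] by simp
  then have "e (a z) \<bullet> ?u = e (a z)" using E arrow_unit(2) by (auto simp: inverses_def)
  then show ?thesis using cancel(1)[OF E u] E by (simp add: inverses_def)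
qed

text \<open>At unit objects, conjugation by \<open>Phi\<close> becomes conjugation by
  \<open>e\<close>; this is what the unit law of \<open>beta\<close> rests on.\<close>

lemma Phi_Teta:
  assumes z: "z \<in> Obj TX"
  shows "Phi' (omap (Teta TX) z) = e (a z)" "Phi (omap (Teta TX) z) = e' (a z)"
proof -
  note ez = obj_in(6)[OF z]
  have "Ta (omap (Teta TX) z) = eta (a z)" by (rule Tfun_Teta_obj[of TX al X, OF obj_in(1) z])
  then have P: "inverses (a (eta (a z))) (a z) (Phi (omap (Teta TX) z)) (Phi' (omap (Teta TX) z))"
    using Phi_inverses[OF ez] by (simp add: Tmu_Teta[OF X z])
  note E = e_inverses[OF obj_in(1)[OF z]]
  show 1: "Phi' (omap (Teta TX) z) = e (a z)"
    by (rule inverse_unique[OF P, symmetric]) (use E left_unit_law[OF z] in \<open>auto simp: inverses_def\<close>)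
  show "Phi (omap (Teta TX) z) = e' (a z)"
    by (rule inverse_unique[OF E]) (use P 1 in \<open>auto simp: inverses_def\<close>)
qed

section \<open>The factorization of \<open>al\<close> and the strict action\<close>

definition B :: "(('po, 'o) tens, ('po, 'o) tens \<times> ('po, 'o) tens \<times> 'a) cat" where
  "B = \<lparr>Obj = Obj TX, Arr = {(z, w, f). z \<in> Obj TX \<and> w \<in> Obj TX \<and> arrow (a z) (a w) f},
     Dom = (\<lambda>(z, w, f). z), Cod = (\<lambda>(z, w, f). w), Id = (\<lambda>z. (z, z, Id X (a z))),
     Comp = (\<lambda>(z', w', g) (z, w, f). (z, w', g \<bullet> f))\<rparr>"

definition G :: "(('po, 'o) tens, ('po, 'o) tens \<times> ('po, 'o) tens \<times> 'a, 'o, 'a) ftor" where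
  "G = \<lparr>omap = a, amap = (\<lambda>(z, w, f). f)\<rparr>"

text \<open>\<open>Phi\<close> is indexed by the objects of \<open>T2X\<close>, which are also those
  of \<open>Tcat B\<close>. At \<open>z\<close> it runs from \<open>a (Ta z)\<close>, where
  \<open>amap al (amap (Tfun X G) F)\<close> has its endpoints, to \<open>a (mu z)\<close>, where an
  arrow of \<open>B\<close> between values of \<open>mu\<close> must have them.\<close>

definition beta where
  "beta = \<lparr>omap = mu, amap = (\<lambda>F. (mu (Dom (Tcat B) F), mu (Cod (Tcat B) F),
     Phi (Cod (Tcat B) F) \<bullet> (amap al (amap (Tfun X G) F) \<bullet> Phi' (Dom (Tcat B) F))))\<rparr>"

lemma B_simps [simp]:
  "Obj B = Obj TX" "(z, w, f) \<in> Arr B \<longleftrightarrow> z \<in> Obj TX \<and> w \<in> Obj TX \<and> arrow (a z) (a w) f"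
  "Dom B (z, w, f) = z" "Cod B (z, w, f) = w" "Id B z = (z, z, Id X (a z))"
  "Comp B (z', w', g) (z, w, f) = (z, w', g \<bullet> f)"
  by (simp_all add: B_def)

lemma G_simps [simp]: "omap G = a" "amap G (z, w, f) = f"
  by (simp_all add: G_def)

lemma B_category: "category B"
proof
  show "Comp B (Comp B h g) f = Comp B h (Comp B g f)"
    if "h \<in> Arr B" "g \<in> Arr B" "f \<in> Arr B" "Dom B h = Cod B g" "Dom B g = Cod B f" for h g f
    using that by (cases h; cases g; cases f) (auto intro: arrow_assoc)
qed (auto simp: arrow_comp arrow_Id arrow_unit obj_in)

lemma G_functor: "is_functor B X G"
  unfolding is_functor_def by (auto simp: arrow_def obj_in)

lemma omap_beta [simp]: "omap beta = mu"
  by (simp add: beta_def)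

lemmas B_congs = Obj_congs[OF B_simps(1)]

lemmas TB = Tcat_category[OF B_category]
lemmas T2B = Tcat_category[OF TB]
lemmas TG = Tfun_functor[OF B_category X G_functor]
lemmas T2G = Tfun_functor[OF TB TX TG]

lemma T_objs [simp]:
  "Obj (Tcat B) = Obj T2X" "Obj (Tcat (Tcat B)) = Obj T3X"
  "omap (Tfun X G) = Ta" "omap (Tfun TX (Tfun X G)) = omap (Tfun TX (Tfun X al))"
  "omap (Tmu B) = omap (Tmu TX)" "omap (Teta B) = omap (Teta TX)"
  using B_congs Obj_congs(1)[OF B_congs(1)] Obj_congs(4)[OF HOL.refl, of G al X]
    Obj_congs(4)[OF HOL.refl, of "Tfun X G" "Tfun X al" TX] by simp_all

lemma Tfun_B_obj: "omap F = omap F' \<Longrightarrow> omap (Tfun B F) = omap (Tfun TX F')"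
  by (rule B_congs(4))

lemma al_TG_arrow:
  assumes "F \<in> Arr (Tcat B)"
  shows "arrow (a (Ta (Dom (Tcat B) F))) (a (Ta (Cod (Tcat B) F))) (amap al (amap (Tfun X G) F))"
  using is_functorD[OF TG] assms by (intro arrow_al) auto

lemma TB_dom_cod:
  assumes "F \<in> Arr (Tcat B)"
  shows "Dom (Tcat B) F \<in> Obj T2X" "Cod (Tcat B) F \<in> Obj T2X"
  using category.Dom_in[OF TB assms] category.Cod_in[OF TB assms] by simp_all

lemma G_beta: "amap G (amap beta F)
    = Phi (Cod (Tcat B) F) \<bullet> (amap al (amap (Tfun X G) F) \<bullet> Phi' (Dom (Tcat B) F))"
  by (simp add: beta_def)

lemma beta_arr: "amap beta F = (mu (Dom (Tcat B) F), mu (Cod (Tcat B) F), amap G (amap beta F))"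
  by (simp add: beta_def)

lemma G_beta_arrow:
  assumes F: "F \<in> Arr (Tcat B)"
  shows "arrow (a (mu (Dom (Tcat B) F))) (a (mu (Cod (Tcat B) F))) (amap G (amap beta F))"
  unfolding G_beta
  by (rule arrow_comp[OF arrow_comp[OF inversesD(2)[OF Phi_inverses] al_TG_arrow[OF F]]
      inversesD(1)[OF Phi_inverses]]) (rule TB_dom_cod[OF F])+

lemma beta_functor: "is_functor (Tcat B) B beta"
  unfolding is_functor_def
proof (intro conjI ballI impI)
  interpret TB: category "Tcat B" by (rule TB)
  {
    fix z assume z: "z \<in> Obj (Tcat B)"
    then show "omap beta z \<in> Obj B" using obj_in by simp
    have "amap (Tfun X G) (Id (Tcat B) z) = Id TX (Ta z)" using is_functorD(5)[OF TG z] by simp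
    then have "amap al (amap (Tfun X G) (Id (Tcat B) z)) = Id X (a (Ta z))"
      using is_functorD(5)[OF al] obj_in z by simp
    then show "amap beta (Id (Tcat B) z) = Id B (omap beta z)"
      using inversesD[OF Phi_inverses] arrow_unit(2)[OF inversesD(2)[OF Phi_inverses]] z
      by (simp add: beta_def TB.Dom_Id TB.Cod_Id)
  next
    fix F assume F: "F \<in> Arr (Tcat B)"
    show "amap beta F \<in> Arr B" by (subst beta_arr) (use G_beta_arrow[OF F] TB_dom_cod[OF F] obj_in in simp)
    show "Dom B (amap beta F) = omap beta (Dom (Tcat B) F)" "Cod B (amap beta F) = omap beta (Cod (Tcat B) F)"
      by (subst beta_arr, simp)+
  next
    fix H F assume H: "H \<in> Arr (Tcat B)" and F: "F \<in> Arr (Tcat B)" and d: "Dom (Tcat B) H = Cod (Tcat B) F"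
    let ?z = "Dom (Tcat B) F" and ?w = "Cod (Tcat B) F" and ?v = "Cod (Tcat B) H"
    let ?f = "amap al (amap (Tfun X G) F)" and ?h = "amap al (amap (Tfun X G) H)"
    have o: "?z \<in> Obj T2X" "?w \<in> Obj T2X" "?v \<in> Obj T2X" using TB_dom_cod F H by auto
    note f = al_TG_arrow[OF F] and h = al_TG_arrow[OF H, unfolded d]
    note pz = inversesD(2)[OF Phi_inverses[OF o(1)]] and pv = inversesD(1)[OF Phi_inverses[OF o(3)]]
    note pw = inversesD(1,2)[OF Phi_inverses[OF o(2)]]
    note fp = arrow_comp[OF pz f]
    have "(Phi ?v \<bullet> (?h \<bullet> Phi' ?w)) \<bullet> (Phi ?w \<bullet> (?f \<bullet> Phi' ?z))
        = Phi ?v \<bullet> (?h \<bullet> (Phi' ?w \<bullet> (Phi ?w \<bullet> (?f \<bullet> Phi' ?z))))"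
      using arrow_assoc[OF arrow_comp[OF fp pw(1)] arrow_comp[OF pw(2) h] pv]
        arrow_assoc[OF arrow_comp[OF fp pw(1)] pw(2) h] by simp
    also have "\<dots> = Phi ?v \<bullet> ((?h \<bullet> ?f) \<bullet> Phi' ?z)"
      using cancel(1)[OF Phi_inverses[OF o(2)] fp] arrow_assoc[OF pz f h] by simp
    also have "?h \<bullet> ?f = amap al (amap (Tfun X G) (Comp (Tcat B) H F))"
      using is_functorD(6)[OF ftor_comp_functor[OF TG al] H F d] by simp
    finally show "amap beta (Comp (Tcat B) H F) = Comp B (amap beta H) (amap beta F)"
      using F H d by (simp add: beta_def TB.Dom_Comp TB.Cod_Comp)
  }
qed

lemmas Tbeta = Tfun_functor[OF TB B_category beta_functor]

text \<open>The naturality for which \<open>beta\<close> is designed. It makes \<open>Phi\<close>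
  the cell of the pseudomorphism on \<open>G\<close>, and \<open>beta_assoc\<close> uses it again
  with \<open>T\<close> applied to it.\<close>

lemma Phi_nat_B: "is_nat_trans (Tcat B) X (ftor_comp al (Tfun X G)) (ftor_comp G beta) Phi"
  unfolding is_nat_trans_def
proof (intro conjI ballI)
  fix z assume "z \<in> Obj (Tcat B)"
  then show "Phi z \<in> Arr X" "Dom X (Phi z) = omap (ftor_comp al (Tfun X G)) z"
    "Cod X (Phi z) = omap (ftor_comp G beta) z"
    using Phi_inverses by (simp_all add: inverses_def arrow_def)
next
  fix F assume F: "F \<in> Arr (Tcat B)"
  let ?z = "Dom (Tcat B) F" and ?w = "Cod (Tcat B) F" and ?f = "amap al (amap (Tfun X G) F)"
  note P = Phi_inverses[OF TB_dom_cod(1)[OF F]] Phi_inverses[OF TB_dom_cod(2)[OF F]]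
  note f = al_TG_arrow[OF F]
  have "(Phi ?w \<bullet> (?f \<bullet> Phi' ?z)) \<bullet> Phi ?z = Phi ?w \<bullet> (?f \<bullet> (Phi' ?z \<bullet> Phi ?z))"
    using arrow_assoc[OF inversesD(1)[OF P(1)] arrow_comp[OF inversesD(2)[OF P(1)] f] inversesD(1)[OF P(2)]]
      arrow_assoc[OF inversesD(1,2)[OF P(1)] f] by simp
  also have "\<dots> = Phi ?w \<bullet> ?f" using inversesD(3)[OF P(1)] arrow_unit(1)[OF f] by simp
  finally show "Phi ?w \<bullet> amap (ftor_comp al (Tfun X G)) F = amap (ftor_comp G beta) F \<bullet> Phi ?z"
    by (simp add: G_beta)
qed

text \<open>On an arrow the two sides conjugate \<open>?A\<close> by \<open>?r\<close> and
  \<open>?C\<close> by \<open>?s\<close>. In turn \<open>?p\<close> intertwines \<open>?D\<close>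
  with \<open>?A\<close>, and \<open>?q\<close> intertwines \<open>?D\<close> with
  \<open>?C\<close>. By \<open>Phi_assoc\<close> the composites of \<open>?r\<close> with
  \<open>?p\<close> and of \<open>?s\<close> with \<open>?q\<close> coincide, so both sides are the
  conjugate of \<open>?D\<close> by one isomorphism.\<close>

lemma beta_assoc: "ftor_eq (Tcat (Tcat B)) (ftor_comp beta (Tfun B beta)) (ftor_comp beta (Tmu B))"
  unfolding ftor_eq_def
proof (intro conjI ballI)
  have Tb: "omap (Tfun B beta) = omap (Tfun TX (Tmu X))" by (rule Tfun_B_obj) simp
  show "omap (ftor_comp beta (Tfun B beta)) z = omap (ftor_comp beta (Tmu B)) z"
    if "z \<in> Obj (Tcat (Tcat B))" for z
    using Tmu_assoc[OF X, of z] that by (simp add: Tb)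
  fix F assume F: "F \<in> Arr (Tcat (Tcat B))"
  let ?z = "Dom (Tcat (Tcat B)) F" and ?w = "Cod (Tcat (Tcat B)) F"
  have o: "?z \<in> Obj T3X" "?w \<in> Obj T3X"
    using category.Dom_in[OF T2B F] category.Cod_in[OF T2B F] by simp_all
  let ?A = "amap al (amap (Tfun X G) (amap (Tfun B beta) F))"
  let ?C = "amap al (amap (Tfun X G) (amap (Tmu B) F))"
  let ?D = "amap al (amap (Tfun X al) (amap (Tfun TX (Tfun X G)) F))"
  let ?p = "\<lambda>z. amap al (Tcell X Phi z)" and ?q = "\<lambda>z. Phi (omap (Tfun TX (Tfun X al)) z)"
  let ?r = "\<lambda>z. Phi (omap (Tfun TX (Tmu X)) z)" and ?s = "\<lambda>z. Phi (omap (Tmu TX) z)"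
  let ?x = "\<lambda>z. a (Ta (omap (Tfun TX (Tfun X al)) z))" and ?y = "\<lambda>z. a (Ta (omap (Tfun TX (Tmu X)) z))"
  let ?u = "\<lambda>z. a (Ta (omap (Tmu TX) z))" and ?v = "\<lambda>z. a (mu (omap (Tmu TX) z))"
  have p: "inverses (?x z) (?y z) (?p z) (amap al (Tcell X Phi' z))" if z: "z \<in> Obj T3X" for z
    using al_Tcell_inverses[of T2X "ftor_comp al (Tfun X al)" "ftor_comp al (Tmu X)" Phi Phi', OF _ z] Phi_inverses
      Tfun_obj_Tfun[of T2X "Tfun X al" TX al X z, OF obj_in(2,1) z]
      Tfun_obj_Tfun[of T2X "Tmu X" TX al X z, OF obj_in(3,1) z] by simp
  have in2: "omap (Tfun TX (Tmu X)) z \<in> Obj T2X" "omap (Tmu TX) z \<in> Obj T2X" "omap (Tfun TX (Tfun X al)) z \<in> Obj T2X"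
    if z: "z \<in> Obj T3X" for z
    using Tfun_obj_in[of T2X "Tmu X" TX, OF obj_in(3) z] Tmu_maps(1)[OF TX z] is_functorD(1)[OF T2al z] by auto
  have r: "inverses (?y z) (?v z) (?r z) (Phi' (omap (Tfun TX (Tmu X)) z))" if z: "z \<in> Obj T3X" for z
    using Phi_inverses[OF in2(1)[OF z]] Tmu_assoc[OF X z] by simp
  have s: "inverses (?u z) (?v z) (?s z) (Phi' (omap (Tmu TX) z))" if z: "z \<in> Obj T3X" for z
    using Phi_inverses[OF in2(2)[OF z]] .
  have q: "arrow (?x z) (?u z) (?q z)" if z: "z \<in> Obj T3X" for z
    using Phi_inverses[OF in2(3)[OF z]] Tmu_natural_obj[of TX X al z, OF TX X obj_in(1) z] by (simp add: inverses_def)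
  have rs: "?r z \<bullet> ?p z = ?s z \<bullet> ?q z" if z: "z \<in> Obj T3X" for z by (rule Phi_assoc[OF z])
  have bF: "amap (Tfun B beta) F \<in> Arr (Tcat B)" "Dom (Tcat B) (amap (Tfun B beta) F) = omap (Tfun TX (Tmu X)) ?z"
    "Cod (Tcat B) (amap (Tfun B beta) F) = omap (Tfun TX (Tmu X)) ?w"
    using is_functorD[OF Tbeta] F by (simp_all add: Tb)
  have mF: "amap (Tmu B) F \<in> Arr (Tcat B)" "Dom (Tcat B) (amap (Tmu B) F) = omap (Tmu TX) ?z"
    "Cod (Tcat B) (amap (Tmu B) F) = omap (Tmu TX) ?w"
    using Tmu_maps[OF B_category] F by simp_all
  have A: "arrow (?y ?z) (?y ?w) ?A" using al_TG_arrow[OF bF(1)] bF by simp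
  have C: "arrow (?u ?z) (?u ?w) ?C" using al_TG_arrow[OF mF(1)] mF by simp
  have FF: "amap (Tfun TX (Tfun X G)) F \<in> Arr T2X" "Dom T2X (amap (Tfun TX (Tfun X G)) F) = omap (Tfun TX (Tfun X al)) ?z"
    "Cod T2X (amap (Tfun TX (Tfun X G)) F) = omap (Tfun TX (Tfun X al)) ?w"
    using is_functorD[OF T2G] F by simp_all
  have D: "arrow (?x ?z) (?x ?w) ?D"
    using is_functorD[OF Tal] FF by (intro arrow_al) simp_all
  \<comment> \<open>\<open>T\<close> applied to \<open>Phi_nat_B\<close>; under \<open>al\<close>
    this becomes the square \<open>pD\<close>.\<close>
  have "Comp TX (Tcell X Phi ?w) (amap (Tfun X (ftor_comp al (Tfun X G))) F)
      = Comp TX (amap (Tfun X (ftor_comp G beta)) F) (Tcell X Phi ?z)"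
    by (rule is_nat_transD(4)[OF Tcell_nat_trans[OF TB X ftor_comp_functor[OF TG al]
        ftor_comp_functor[OF beta_functor G_functor] Phi_nat_B] F])
  then have nat: "Comp TX (Tcell X Phi ?w) (amap (Tfun X al) (amap (Tfun TX (Tfun X G)) F))
      = Comp TX (amap (Tfun X G) (amap (Tfun B beta) F)) (Tcell X Phi ?z)"
    using Tfun_arr_Tfun[OF TB TX TG al F] Tfun_arr_Tfun[OF TB B_category beta_functor G_functor F] by simp
  have cell: "Tcell X Phi z \<in> Arr TX" "Dom TX (Tcell X Phi z) = Ta (omap (Tfun TX (Tfun X al)) z)"
     "Cod TX (Tcell X Phi z) = Ta (omap (Tfun TX (Tmu X)) z)" if z: "z \<in> Obj T3X" for z
    using Tcell_arr[of X T2X Phi z, OF X is_nat_transD(1)[OF Phi] z]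
      Tcell_arr(2)[of X T2X Phi z, OF X is_nat_transD(1)[OF Phi] z is_nat_transD(2)[OF Phi]]
      Tcell_arr(3)[of X T2X Phi z, OF X is_nat_transD(1)[OF Phi] z is_nat_transD(3)[OF Phi]]
      Tfun_obj_Tfun[of T2X "Tfun X al" TX al X z, OF obj_in(2,1) z]
      Tfun_obj_Tfun[of T2X "Tmu X" TX al X z, OF obj_in(3,1) z] by simp_all
  have pD: "?p ?w \<bullet> ?D = ?A \<bullet> ?p ?z"
    using arg_cong[OF nat, of "amap al"]
      is_functorD(6)[OF al cell(1)[OF o(2)], of "amap (Tfun X al) (amap (Tfun TX (Tfun X G)) F)"]
      is_functorD(6)[OF al _ cell(1)[OF o(1)], of "amap (Tfun X G) (amap (Tfun B beta) F)"]
      is_functorD[OF Tal] is_functorD[OF TG] bF FF cell[OF o(1)] cell[OF o(2)] by simp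
  \<comment> \<open>Naturality of \<open>Phi\<close> itself at the image of \<open>F\<close> in
    \<open>T2X\<close>, with \<open>Tmu_natural_arr\<close> moving the multiplication across
    \<open>G\<close>.\<close>
  have qD: "?q ?w \<bullet> ?D = ?C \<bullet> ?q ?z"
    using is_nat_transD(4)[OF Phi FF(1)] FF Tmu_natural_arr[OF B_category X G_functor F] by simp
  let ?L = "?r ?w \<bullet> (?A \<bullet> Phi' (omap (Tfun TX (Tmu X)) ?z))" and ?R = "?s ?w \<bullet> (?C \<bullet> Phi' (omap (Tmu TX) ?z))"
  have cancel': "(m \<bullet> (n \<bullet> k')) \<bullet> (k \<bullet> l) = m \<bullet> (n \<bullet> l)"
    if "inverses x1 x2 k k'" "arrow x0 x1 l" "arrow x1 x3 n" "arrow x3 x4 m" for x0 x1 x2 x3 x4 k k' l m n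
  proof -
    note i = inversesD[OF that(1)]
    have kl: "arrow x0 x2 (k \<bullet> l)" by (rule arrow_comp[OF that(2) i(1)])
    show ?thesis
      by (simp only: arrow_assoc[OF kl arrow_comp[OF i(2) that(3)] that(4)] arrow_assoc[OF kl i(2) that(3)]
          cancel(1)[OF that(1,2)])
  qed
  \<comment> \<open>Both candidates are precomposed with \<open>?r ?z \<bullet> ?p ?z\<close>, which
    cancels the inverse cell at the end of each and leaves composites starting with
    \<open>?D\<close>.\<close>
  have "?L \<bullet> (?r ?z \<bullet> ?p ?z) = ?r ?w \<bullet> (?A \<bullet> ?p ?z)"
    by (rule cancel'[OF r[OF o(1)] inversesD(1)[OF p[OF o(1)]] A inversesD(1)[OF r[OF o(2)]]])
  also have "\<dots> = (?r ?w \<bullet> ?p ?w) \<bullet> ?D"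
    unfolding pD[symmetric] by (rule arrow_assoc[OF D inversesD(1)[OF p[OF o(2)]] inversesD(1)[OF r[OF o(2)]], symmetric])
  also have "\<dots> = ?s ?w \<bullet> (?C \<bullet> ?q ?z)"
    unfolding rs[OF o(2)] qD[symmetric] by (rule arrow_assoc[OF D q[OF o(2)] inversesD(1)[OF s[OF o(2)]]])
  also have "\<dots> = ?R \<bullet> (?s ?z \<bullet> ?q ?z)"
    by (rule cancel'[OF s[OF o(1)] q[OF o(1)] C inversesD(1)[OF s[OF o(2)]], symmetric])
  finally have LR: "?L \<bullet> (?r ?z \<bullet> ?p ?z) = ?R \<bullet> (?r ?z \<bullet> ?p ?z)" by (simp only: rs[OF o(1)])
  have L: "arrow (?v ?z) (?v ?w) ?L"
    by (rule arrow_comp[OF arrow_comp[OF inversesD(2)[OF r[OF o(1)]] A] inversesD(1)[OF r[OF o(2)]]])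
  have R: "arrow (?v ?z) (?v ?w) ?R"
    by (rule arrow_comp[OF arrow_comp[OF inversesD(2)[OF s[OF o(1)]] C] inversesD(1)[OF s[OF o(2)]]])
  \<comment> \<open>The common first factor is a composite of two isomorphisms, removed one at a
    time: \<open>?p ?z\<close> here, \<open>?r ?z\<close> afterwards.\<close>
  have "?L \<bullet> ?r ?z = ?R \<bullet> ?r ?z"
  proof (rule cancel_right[OF p[OF o(1)]])
    note ri = inversesD(1)[OF r[OF o(1)]] and pi = inversesD(1)[OF p[OF o(1)]]
    show "arrow (?y ?z) (?v ?w) (?L \<bullet> ?r ?z)" "arrow (?y ?z) (?v ?w) (?R \<bullet> ?r ?z)"
      by (rule arrow_comp[OF ri L], rule arrow_comp[OF ri R])
    show "(?L \<bullet> ?r ?z) \<bullet> ?p ?z = (?R \<bullet> ?r ?z) \<bullet> ?p ?z"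
      unfolding arrow_assoc[OF pi ri L] arrow_assoc[OF pi ri R] by (rule LR)
  qed
  then have "?L = ?R" by (rule cancel_right[OF r[OF o(1)] L R])
  then show "amap (ftor_comp beta (Tfun B beta)) F = amap (ftor_comp beta (Tmu B)) F"
    using Tmu_assoc[OF X o(1)] Tmu_assoc[OF X o(2)]
    by (simp add: beta_def[THEN arg_cong[of _ _ amap]] bF mF)
qed

text \<open>By \<open>Phi_Teta\<close> the action on the unit at \<open>f\<close> is the conjugate
  of \<open>al (eta f)\<close> by \<open>e\<close>, which is \<open>f\<close> because
  \<open>e\<close> is natural.\<close>

lemma beta_unit: "ftor_eq B ftor_id (ftor_comp beta (Teta B))"
  unfolding ftor_eq_def
proof (intro conjI ballI)
  fix z assume "z \<in> Obj B"
  then show "omap ftor_id z = omap (ftor_comp beta (Teta B)) z" using Tmu_Teta[OF X] by simp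
next
  fix F assume F: "F \<in> Arr B"
  obtain z w f where zwf: "F = (z, w, f)" by (cases F)
  have z: "z \<in> Obj TX" and w: "w \<in> Obj TX" and f: "arrow (a z) (a w) f" using F by (simp_all add: zwf)
  note H = is_functorD[OF Teta_functor[OF B_category]]
  have d: "Dom (Tcat B) (amap (Teta B) F) = omap (Teta TX) z" "Cod (Tcat B) (amap (Teta B) F) = omap (Teta TX) w"
    using H(3,4)[OF F] by (simp_all add: zwf)
  have t: "amap (Tfun X G) (amap (Teta B) F) = amap (Teta X) f"
    using Tfun_Teta_arr[OF B_category G_functor F] by (simp add: zwf)
  have "e' (a w) \<bullet> (amap al (amap (Teta X) f) \<bullet> e (a z)) = f"
    using e_natural[OF f] cancel(1)[OF e_inverses[OF obj_in(1)[OF w]] f] by simp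
  then show "amap ftor_id F = amap (ftor_comp beta (Teta B)) F"
    unfolding ftor_comp_simps
    by (subst beta_arr) (simp add: G_beta d[unfolded zwf] t[unfolded zwf] zwf Phi_Teta[OF z] Phi_Teta[OF w] Tmu_Teta[OF X z] Tmu_Teta[OF X w])
qed

text \<open>The two sides are identity functors over different types of arrows, as occur for
  \<open>B\<close> and \<open>TX\<close>.\<close>

lemma omap_ftor_id: "omap (ftor_id :: ('x, 'y, 'x, 'y) ftor) = omap (ftor_id :: ('x, 'z, 'x, 'z) ftor)"
  by (simp add: fun_eq_iff)

section \<open>The equivalence of the two algebras\<close>

definition A_alg where
  "A_alg = \<lparr>carr = X, str = al, assoc_cell = Phi, unit_cell = e\<rparr>"

definition B_alg where
  "B_alg = \<lparr>carr = B, str = beta,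
     assoc_cell = \<lambda>z. Id B (omap beta (omap (Tfun B beta) z)), unit_cell = Id B\<rparr>"

definition K where
  "K = \<lparr>omap = eta, amap = \<lambda>g. (eta (Dom X g), eta (Cod X g), amap al (amap (Teta X) g))\<rparr>"

text \<open>\<open>beta\<close> after \<open>Tfun B K\<close> sends \<open>z\<close> to
  \<open>mu (Teta' z) = z\<close>, so the cell of \<open>K\<close> at \<open>z\<close> must run from
  \<open>z\<close> to \<open>eta (a z)\<close>. The same family is the 2-cell from the identity of
  \<open>B\<close> to \<open>K\<close> after \<open>G\<close>.\<close>

definition k_cell where
  "k_cell = (\<lambda>z. (z, eta (a z), e (a z)))"

definition M where "M = \<lparr>mfun = K, mcell = k_cell\<rparr>"

definition N where "N = \<lparr>mfun = G, mcell = Phi\<rparr>"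

lemma alg_simps [simp]:
  "carr A_alg = X" "str A_alg = al" "assoc_cell A_alg = Phi" "unit_cell A_alg = e"
  "carr B_alg = B" "str B_alg = beta" "unit_cell B_alg = Id B"
  "assoc_cell B_alg z = Id B (omap beta (omap (Tfun B beta) z))"
  "mfun M = K" "mcell M = k_cell" "mfun N = G" "mcell N = Phi"
  by (simp_all add: A_alg_def B_alg_def M_def N_def)

lemma K_simps [simp]:
  "omap K = eta" "amap K g = (eta (Dom X g), eta (Cod X g), amap al (amap (Teta X) g))"
  by (simp_all add: K_def)

lemma strict_B: "strict_algebra B_alg"
  unfolding B_alg_def by (rule strict_algebraI[OF B_category beta_functor beta_assoc beta_unit])

lemma K_functor: "is_functor X B K"
  unfolding is_functor_def
proof (intro conjI ballI impI)
  fix f assume f: "f \<in> Arr X"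
  then have "arrow (Dom X f) (Cod X f) f" by (simp add: arrow_def)
  from arrow_al_eta[OF this] show "amap K f \<in> Arr B" using f by (simp add: obj_in X.Dom_in X.Cod_in)
qed (use is_functorD[OF ftor_comp_functor[OF eta_functor al]] in
      \<open>auto simp: obj_in X.Dom_Id X.Cod_Id X.Dom_Comp X.Cod_Comp\<close>)

lemma omap_K_al: "omap (ftor_comp K al) = omap (ftor_comp (Teta X) al)"
  by (simp add: fun_eq_iff)

lemmas TK = Tfun_functor[OF X B_category K_functor]

lemma TK_obj [simp]: "omap (Tfun B K) = Teta'"
  by (rule Tfun_B_obj) simp

lemma Tbeta_obj [simp]: "omap (Tfun B beta) = omap (Tfun TX (Tmu X))"
  by (rule Tfun_B_obj) simp

text \<open>Thus \<open>beta\<close> after \<open>Tfun B K\<close> is the identity-on-objects factor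
  of \<open>al\<close>. Naturality of \<open>Tcell X e\<close> relates \<open>F\<close> to its image
  under \<open>al\<close> after \<open>eta\<close>, and by \<open>al_Te\<close> the cells involved
  are those by which \<open>beta\<close> conjugates.\<close>

lemma beta_TK:
  assumes F: "F \<in> Arr TX"
  shows "amap beta (amap (Tfun B K) F) = (Dom TX F, Cod TX F, amap al F)"
proof -
  interpret TXc: category TX by (rule TX)
  let ?z = "Dom TX F" and ?w = "Cod TX F"
  have z: "?z \<in> Obj TX" and w: "?w \<in> Obj TX" using TXc.Dom_in[OF F] TXc.Cod_in[OF F] .
  note H = is_functorD[OF TK]
  have d: "Dom (Tcat B) (amap (Tfun B K) F) = Teta' ?z" "Cod (Tcat B) (amap (Tfun B K) F) = Teta' ?w"
    using H(3,4)[OF F] by simp_all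
  have "amap (Tfun X G) (amap (Tfun B K) F) = amap (Tfun X (ftor_comp al (Teta X))) F"
    using Tfun_arr_Tfun[OF X B_category K_functor G_functor F] Tfun_arr_cong[OF X F, of "ftor_comp G K" "ftor_comp al (Teta X)" X] by simp
  note t = this
  have "Comp TX (Tcell X e ?w) F = Comp TX (amap (Tfun X (ftor_comp al (Teta X))) F) (Tcell X e ?z)"
    using is_nat_transD(4)[OF Tcell_nat_trans[OF X X ftor_id_functor ftor_comp_functor[OF eta_functor al] e] F]
    by (simp add: Tfun_id_arr[OF X F])
  note nat = this
  note TE = Tcell_nat_trans[OF X X ftor_id_functor ftor_comp_functor[OF eta_functor al] e]
  have c: "Tcell X e y \<in> Arr TX" "Dom TX (Tcell X e y) = y" "Cod TX (Tcell X e y) = omap (Tfun X (ftor_comp al (Teta X))) y"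
    if "y \<in> Obj TX" for y
    using is_nat_transD(1-3)[OF TE that] by (simp_all add: Tfun_id_obj[OF that])
  have f: "amap (Tfun X (ftor_comp al (Teta X))) F \<in> Arr TX"
    "Dom TX (amap (Tfun X (ftor_comp al (Teta X))) F) = omap (Tfun X (ftor_comp al (Teta X))) ?z"
    using is_functorD(2,3)[OF Tfun_functor[OF X X ftor_comp_functor[OF eta_functor al]] F] .
  have "amap al (Tcell X e ?w) \<bullet> amap al F
      = amap al (amap (Tfun X (ftor_comp al (Teta X))) F) \<bullet> amap al (Tcell X e ?z)"
    using arg_cong[OF nat, of "amap al"] is_functorD(6)[OF al c(1)[OF w] F] c[OF w] c[OF z] f
      is_functorD(6)[OF al f(1) c(1)[OF z]] by simp
  moreover have P: "inverses (a (Ta (Teta' ?w))) (a ?w) (Phi (Teta' ?w)) (Phi' (Teta' ?w))"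
    using Phi_inverses[OF obj_in(5)[OF w]] by (simp add: Tmu_Tfun_Teta[OF X w])
  ultimately have "Phi (Teta' ?w) \<bullet> (amap al (amap (Tfun X (ftor_comp al (Teta X))) F) \<bullet> Phi' (Teta' ?z)) = amap al F"
    using cancel(2)[OF P, of "a ?z" "amap al F"] arrow_al[OF F] by (simp add: al_Te(1)[OF z] al_Te(1)[OF w])
  then show ?thesis
    by (subst beta_arr) (simp add: G_beta d t Tmu_Tfun_Teta[OF X z] Tmu_Tfun_Teta[OF X w])
qed

lemma k_cell_arr: "z \<in> Obj TX \<Longrightarrow> k_cell z \<in> Arr B"
  using inversesD(1)[OF e_inverses] obj_in by (simp add: k_cell_def)

lemma k_cell_nat_iso: "is_nat_iso TX B (ftor_comp beta (Tfun B K)) (ftor_comp K al) k_cell"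
  unfolding is_nat_iso_def
proof (intro conjI exI)
  let ?s = "\<lambda>z. (eta (a z), z, e' (a z))"
  interpret TXc: category TX by (rule TX)
  have E: "inverses (a z) (a (eta (a z))) (e (a z)) (e' (a z))" if "z \<in> Obj TX" for z
    by (rule e_inverses[OF obj_in(1)[OF that]])
  have nat: "e (a (Cod TX F)) \<bullet> amap al F = amap al (amap (Teta X) (amap al F)) \<bullet> e (a (Dom TX F))"
    "e' (a (Cod TX F)) \<bullet> amap al (amap (Teta X) (amap al F)) = amap al F \<bullet> e' (a (Dom TX F))" if F: "F \<in> Arr TX" for F
    using is_nat_transD(4)[OF e, of "amap al F"] is_nat_transD(4)[OF e', of "amap al F"] is_functorD[OF al] F by simp_all
  show "is_nat_trans TX B (ftor_comp beta (Tfun B K)) (ftor_comp K al) k_cell"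
    unfolding is_nat_trans_def
    using k_cell_arr nat is_functorD(3,4)[OF al] by (auto simp: k_cell_def beta_TK Tmu_Tfun_Teta[OF X])
  show "is_nat_trans TX B (ftor_comp K al) (ftor_comp beta (Tfun B K)) ?s"
    unfolding is_nat_trans_def
    using inversesD(2)[OF E] nat is_functorD(3,4)[OF al] by (auto simp: beta_TK Tmu_Tfun_Teta[OF X] obj_in)
  show "inverse_cells TX B (ftor_comp beta (Tfun B K)) (ftor_comp K al) k_cell ?s"
    unfolding inverse_cells_def using inversesD(3,4)[OF E] by (auto simp: k_cell_def Tmu_Tfun_Teta[OF X])
qed

text \<open>Over \<open>X\<close> the arrow is \<open>Tcell X e (Ta z)\<close>, which
  \<open>al\<close> takes to \<open>Phi' (Teta' (Ta z))\<close> by \<open>al_Te\<close>. The leading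
  \<open>Phi\<close> in \<open>beta\<close> cancels it, and \<open>Phi' z\<close> remains.\<close>

lemma beta_k_cell:
  assumes z: "z \<in> Obj T2X"
  shows "amap beta (Tcell B k_cell z) = (mu z, Ta z, Phi' z)"
proof -
  note Taz = obj_in(2)[OF z]
  have k: "Dom B (k_cell x) = omap ftor_id x" "Cod B (k_cell x) = omap (ftor_comp K al) x" for x
    by (simp_all add: k_cell_def)
  have d: "Dom (Tcat B) (Tcell B k_cell z) = z"
    using Tcell_arr(2)[of B TX k_cell z ftor_id, OF B_category k_cell_arr z k(1)] Tfun_B_obj[OF omap_ftor_id] Tfun_id_obj[OF z] by simp
  have c: "Cod (Tcat B) (Tcell B k_cell z) = Teta' (Ta z)"
    using Tcell_arr(3)[of B TX k_cell z "ftor_comp K al", OF B_category k_cell_arr z k(2)]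
      Tfun_B_obj[OF omap_K_al]
      Tfun_obj_Tfun[of TX al X "Teta X" TX, OF obj_in(1,4) z] by simp
  have t: "amap (Tfun X G) (Tcell B k_cell z) = Tcell X e (Ta z)"
    using Tfun_Tcell[of B TX k_cell X G z, OF B_category k_cell_arr G_functor z]
      Tcell_Tfun[of TX al X e X z, OF obj_in(1) is_nat_transD(1)[OF e] z]
    by (simp add: k_cell_def)
  have P: "inverses (a (Ta (Teta' (Ta z)))) (a (Ta z)) (Phi (Teta' (Ta z))) (Phi' (Teta' (Ta z)))"
    using Phi_inverses[OF obj_in(5)[OF Taz]] by (simp add: Tmu_Tfun_Teta[OF X Taz])
  show ?thesis
    using cancel(2)[OF P inversesD(2)[OF Phi_inverses[OF z]]]
    by (subst beta_arr) (simp add: G_beta d c t al_Te(1)[OF Taz] Tmu_Tfun_Teta[OF X Taz])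
qed

lemma pseudomorphism_M: "pseudomorphism A_alg B_alg M"
proof -
  have "Comp B (k_cell (mu z)) (Id B (mu (omap (Tfun TX (Tmu X)) (omap (Tfun (Tcat B) (Tfun B K)) z))))
      = Comp B (amap K (Phi z)) (Comp B (k_cell (Ta z)) (amap beta (Tcell B k_cell z)))"
    if z: "z \<in> Obj T2X" for z
  proof -
    note P = Phi_inverses[OF z] and muz = obj_in(3)[OF z] and Taz = obj_in(2)[OF z]
    \<comment> \<open>\<open>T\<close> applied to the unit law \<open>Tmu_Tfun_Teta\<close>; it
      locates the identity that serves as associativity cell of \<open>B_alg\<close>.\<close>
    have "omap (Tfun TX (Tmu X)) (omap (Tfun (Tcat B) (Tfun B K)) z) = z"
    proof -
      have "omap (Tfun (Tcat B) (Tfun B K)) z = omap (Tfun T2X (Tfun TX (Teta X))) z"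
        using Obj_congs(4)[OF T_objs(1), of "Tfun B K" "Tfun TX (Teta X)"] by simp
      then show ?thesis
        using Tfun_obj_Tfun[of TX "Tfun TX (Teta X)" T2X "Tmu X" TX z, OF obj_in(5) obj_in(3) z]
          Tfun_obj_cong[OF z, of "ftor_comp (Tmu X) (Tfun TX (Teta X))" ftor_id TX] Tmu_Tfun_Teta[OF X] Tfun_id_obj[OF z]
        by simp
    qed
    moreover have "amap al (amap (Teta X) (Phi z)) \<bullet> (e (a (Ta z)) \<bullet> Phi' z) = e (a (mu z))"
    proof -
      note p = inversesD[OF P]
      note ez = inversesD(1)[OF e_inverses[OF obj_in(1)[OF Taz]]] and em = inversesD(1)[OF e_inverses[OF obj_in(1)[OF muz]]]
      have "amap al (amap (Teta X) (Phi z)) \<bullet> (e (a (Ta z)) \<bullet> Phi' z)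
          = (e (a (mu z)) \<bullet> Phi z) \<bullet> Phi' z"
        using arrow_assoc[OF p(2) ez arrow_al_eta[OF p(1)]] e_natural[OF p(1)] by simp
      also have "\<dots> = e (a (mu z))" using arrow_assoc[OF p(2,1) em] p(4) arrow_unit(1)[OF em] by simp
      finally show ?thesis .
    qed
    moreover have "Cod X (Phi z) = a (mu z)" using inversesD(1)[OF P] by (simp add: arrow_def)
    ultimately show ?thesis
      using arrow_unit(1)[OF inversesD(1)[OF e_inverses[OF obj_in(1)[OF muz]]]]
      unfolding beta_k_cell[OF z] by (simp add: k_cell_def)
  qed
  moreover have "Comp B (k_cell (eta x)) (Id B (eta x)) = amap K (e x)" if x: "x \<in> Obj X" for x
  proof -
    note E = e_inverses[OF x] and ax = obj_in(1)[OF obj_in(4)[OF x]]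
    note i = inversesD(1,2)[OF E] and ea = inversesD(1)[OF e_inverses[OF ax]]
    \<comment> \<open>Naturality of \<open>e\<close> at its own component \<open>e x\<close>, with
      that component cancelled on the right.\<close>
    have "e (a (eta x)) = amap al (amap (Teta X) (e x))"
      by (rule cancel_right[OF E ea arrow_al_eta[OF i(1)] e_natural[OF i(1)]])
    then show ?thesis using arrow_unit(1)[OF ea] i(1) by (simp add: k_cell_def arrow_def)
  qed
  ultimately show ?thesis
    unfolding pseudomorphism_def using K_functor k_cell_nat_iso by simp
qed

text \<open>With \<open>Phi\<close> as cell of \<open>G\<close> and identity cells on
  \<open>B_alg\<close>, the coherence conditions become \<open>Phi_assoc\<close> and the second unit
  law \<open>left_unit_law\<close>.\<close>

lemma pseudomorphism_N: "pseudomorphism B_alg A_alg N"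
proof -
  have iso: "is_nat_iso (Tcat B) X (ftor_comp al (Tfun X G)) (ftor_comp G beta) Phi"
  proof -
    have "is_nat_trans (Tcat B) X (ftor_comp G beta) (ftor_comp al (Tfun X G)) Phi'"
      unfolding is_nat_trans_def
    proof (intro conjI ballI)
      fix z assume "z \<in> Obj (Tcat B)"
      then show "Phi' z \<in> Arr X" "Dom X (Phi' z) = omap (ftor_comp G beta) z"
        "Cod X (Phi' z) = omap (ftor_comp al (Tfun X G)) z"
        using Phi_inverses by (simp_all add: inverses_def arrow_def)
    next
      fix F assume F: "F \<in> Arr (Tcat B)"
      note P = Phi_inverses[OF TB_dom_cod(1)[OF F]] Phi_inverses[OF TB_dom_cod(2)[OF F]]
      show "Phi' (Cod (Tcat B) F) \<bullet> amap (ftor_comp G beta) F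
          = amap (ftor_comp al (Tfun X G)) F \<bullet> Phi' (Dom (Tcat B) F)"
        using cancel(1)[OF P(2) arrow_comp[OF inversesD(2)[OF P(1)] al_TG_arrow[OF F]]] by (simp add: G_beta)
    qed
    moreover have "inverse_cells (Tcat B) X (ftor_comp al (Tfun X G)) (ftor_comp G beta) Phi Phi'"
      unfolding inverse_cells_def using inversesD(3,4)[OF Phi_inverses] by simp
    ultimately show ?thesis unfolding is_nat_iso_def using Phi_nat_B by blast
  qed
  have "Phi (omap (Tmu TX) z) \<bullet> Phi (omap (Tfun TX (Tfun X al)) z)
      = Id X (a (mu (omap (Tfun TX (Tmu X)) z))) \<bullet> (Phi (omap (Tfun TX (Tmu X)) z) \<bullet> amap al (Tcell X Phi z))"
    if z: "z \<in> Obj T3X" for z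
  proof -
    have Tm: "omap (Tfun TX (Tmu X)) z \<in> Obj T2X" using Tfun_obj_in[of T2X "Tmu X" TX, OF obj_in(3) z] .
    have "arrow (a (Ta (omap (Tfun TX (Tfun X al)) z))) (a (Ta (omap (Tfun TX (Tmu X)) z))) (amap al (Tcell X Phi z))"
      using al_Tcell_inverses[of T2X "ftor_comp al (Tfun X al)" "ftor_comp al (Tmu X)" Phi Phi', OF _ z] Phi_inverses
        Tfun_obj_Tfun[of T2X "Tfun X al" TX al X z, OF obj_in(2,1) z]
        Tfun_obj_Tfun[of T2X "Tmu X" TX al X z, OF obj_in(3,1) z] by (simp add: inverses_def)
    from arrow_unit(2)[OF arrow_comp[OF this inversesD(1)[OF Phi_inverses[OF Tm]]]]
    show ?thesis using Phi_assoc[OF z] by simp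
  qed
  moreover have "Phi (omap (Teta TX) z) \<bullet> e (a z) = Id X (a z)" if "z \<in> Obj TX" for z
    by (rule left_unit_law[OF that])
  ultimately show ?thesis
    unfolding pseudomorphism_def using G_functor iso by simp
qed

text \<open>\<open>G\<close> takes \<open>k_cell z\<close> to \<open>e (a z)\<close>, so the
  composite has cell \<open>e (a z) \<bullet> Phi (Teta' z)\<close>. By \<open>al_Te\<close> its
  second factor cancels against \<open>amap al (Tcell X e z)\<close>, which makes \<open>e\<close>
  compatible with the cells.\<close>

lemma NM_iso: "isomorphic_mors A_alg A_alg (mor_id A_alg) (mor_comp B_alg A_alg N M)"
  unfolding isomorphic_mors_def
proof (intro exI conjI)
  have m: "mcell (mor_comp B_alg A_alg N M) z = e (a z) \<bullet> Phi (Teta' z)" for z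
    by (simp add: mor_comp_def k_cell_def)
  have f: "omap (mfun (mor_comp B_alg A_alg N M)) x = a (eta x)"
    "amap (mfun (mor_comp B_alg A_alg N M)) g = amap al (amap (Teta X) g)" for x g
    by (simp_all add: mor_comp_def)
  have i: "mfun (mor_id A_alg) = ftor_id" "mcell (mor_id A_alg) z = Id X (a z)" for z
    by (simp_all add: mor_id_def)
  have P: "inverses (a (Ta (Teta' z))) (a z) (Phi (Teta' z)) (Phi' (Teta' z))" if z: "z \<in> Obj TX" for z
    using Phi_inverses[OF obj_in(5)[OF z]] by (simp add: Tmu_Tfun_Teta[OF X z])
  have E: "inverses (a z) (a (eta (a z))) (e (a z)) (e' (a z))" if "z \<in> Obj TX" for z
    by (rule e_inverses[OF obj_in(1)[OF that]])
  show "T_transformation A_alg A_alg (mor_id A_alg) (mor_comp B_alg A_alg N M) e"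
  proof -
    have "(e (a z) \<bullet> Phi (Teta' z)) \<bullet> amap al (Tcell X e z) = e (a z) \<bullet> Id X (a z)" if z: "z \<in> Obj TX" for z
      using arrow_assoc[OF inversesD(2,1)[OF P[OF z]] inversesD(1)[OF E[OF z]]] inversesD(4)[OF P[OF z]]
      by (simp add: al_Te(1)[OF z])
    then show ?thesis
      using e by (simp add: T_transformation_def is_nat_trans_def m f i)
  qed
  show "T_transformation A_alg A_alg (mor_comp B_alg A_alg N M) (mor_id A_alg) e'"
  proof -
    have "Id X (a z) \<bullet> amap al (Tcell X e' z) = e' (a z) \<bullet> (e (a z) \<bullet> Phi (Teta' z))" if z: "z \<in> Obj TX" for z
      using arrow_unit(2)[OF inversesD(1)[OF P[OF z]]] cancel(1)[OF E[OF z] inversesD(1)[OF P[OF z]]]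
      by (simp add: al_Te(2)[OF z])
    then show ?thesis
      using e' by (simp add: T_transformation_def is_nat_trans_def m f i)
  qed
  show "inverse_cells (carr A_alg) (carr A_alg) (mfun (mor_id A_alg)) (mfun (mor_comp B_alg A_alg N M)) e e'"
    using e_inv by (simp add: inverse_cells_def f i)
qed

text \<open>Since \<open>G\<close> is fully faithful, the isomorphism between \<open>a z\<close> and
  \<open>a (eta (a z))\<close> lifts to \<open>B\<close>: \<open>k_cell\<close> lies over
  \<open>e\<close>, and \<open>?g\<close>, its inverse, over \<open>e'\<close>.\<close>

lemma MN_iso: "isomorphic_mors B_alg B_alg (mor_comp A_alg B_alg M N) (mor_id B_alg)"
  unfolding isomorphic_mors_def
proof (intro exI conjI)
  let ?g = "\<lambda>z. (eta (a z), z, e' (a z))"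
  have E: "inverses (a z) (a (eta (a z))) (e (a z)) (e' (a z))" if "z \<in> Obj TX" for z
    by (rule e_inverses[OF obj_in(1)[OF that]])
  have m: "mcell (mor_comp A_alg B_alg M N) z = (Ta z, eta (a (mu z)), e (a (mu z)) \<bullet> Phi z)" if z: "z \<in> Obj T2X" for z
    using e_natural[OF inversesD(1)[OF Phi_inverses[OF z]]] inversesD(1)[OF Phi_inverses[OF z]]
    by (simp add: mor_comp_def k_cell_def arrow_def)
  have f: "omap (mfun (mor_comp A_alg B_alg M N)) x = eta (a x)"
    "amap (mfun (mor_comp A_alg B_alg M N)) g = amap K (amap G g)" for x g
    by (simp_all add: mor_comp_def)
  have i: "mfun (mor_id B_alg) = ftor_id" "mcell (mor_id B_alg) z = (mu z, mu z, Id X (a (mu z)))" for z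
    by (simp_all add: mor_id_def)
  have in_B: "k_cell z \<in> Arr B" "?g z \<in> Arr B" if "z \<in> Obj TX" for z
    using k_cell_arr[OF that] inversesD(2)[OF E[OF that]] that obj_in by auto
  have nat: "e w \<bullet> h = amap al (amap (Teta X) h) \<bullet> e z" "e' w \<bullet> amap al (amap (Teta X) h) = h \<bullet> e' z"
    "Dom X h = z" "Cod X h = w" if "arrow z w h" for z w h
    using is_nat_transD(4)[OF e, of h] is_nat_transD(4)[OF e', of h] that by (simp_all add: arrow_def)
  show "T_transformation B_alg B_alg (mor_comp A_alg B_alg M N) (mor_id B_alg) ?g"
  proof -
    have "is_nat_trans B B (mfun (mor_comp A_alg B_alg M N)) (mfun (mor_id B_alg)) ?g"
      unfolding is_nat_trans_def using in_B nat by (auto simp: f i simp del: One_nat_def)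
    moreover have "Comp B (mu z, mu z, Id X (a (mu z))) (amap beta (Tcell B ?g z))
        = Comp B (?g (mu z)) (Ta z, eta (a (mu z)), e (a (mu z)) \<bullet> Phi z)" if z: "z \<in> Obj T2X" for z
    proof -
      note Taz = obj_in(2)[OF z] and muz = obj_in(3)[OF z] and p = inversesD[OF Phi_inverses[OF z]]
      have k: "Cod B (?g x) = omap ftor_id x" "Dom B (?g x) = omap (ftor_comp K al) x" for x by simp_all
      have c: "Cod (Tcat B) (Tcell B ?g z) = z"
        using Tcell_arr(3)[of B TX ?g z ftor_id, OF B_category in_B(2) z k(1)] Tfun_B_obj[OF omap_ftor_id] Tfun_id_obj[OF z] by simp
      have d: "Dom (Tcat B) (Tcell B ?g z) = Teta' (Ta z)"
        using Tcell_arr(2)[of B TX ?g z "ftor_comp K al", OF B_category in_B(2) z k(2)]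
          Tfun_B_obj[OF omap_K_al]
          Tfun_obj_Tfun[of TX al X "Teta X" TX, OF obj_in(1,4) z] by simp
      have t: "amap (Tfun X G) (Tcell B ?g z) = Tcell X e' (Ta z)"
        using Tfun_Tcell[of B TX ?g X G z, OF B_category in_B(2) G_functor z]
          Tcell_Tfun[of TX al X e' X z, OF obj_in(1) is_nat_transD(1)[OF e'] z] by simp
      have P: "inverses (a (Ta (Teta' (Ta z)))) (a (Ta z)) (Phi (Teta' (Ta z))) (Phi' (Teta' (Ta z)))"
        using Phi_inverses[OF obj_in(5)[OF Taz]] by (simp add: Tmu_Tfun_Teta[OF X Taz])
      \<comment> \<open>The inverse of the arrow in \<open>beta_k_cell\<close>, obtained from the
        other half of \<open>al_Te\<close>.\<close>
      have "amap beta (Tcell B ?g z) = (Ta z, mu z, Phi z)"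
        using inversesD(4)[OF P] arrow_unit(1)[OF p(1)]
        by (subst beta_arr) (simp add: G_beta d c t al_Te(2)[OF Taz] Tmu_Tfun_Teta[OF X Taz])
      then show ?thesis using arrow_unit(2)[OF p(1)] cancel(1)[OF E[OF muz] p(1)] by simp
    qed
    ultimately show ?thesis by (simp add: T_transformation_def m i)
  qed
  show "T_transformation B_alg B_alg (mor_id B_alg) (mor_comp A_alg B_alg M N) k_cell"
  proof -
    have "is_nat_trans B B (mfun (mor_id B_alg)) (mfun (mor_comp A_alg B_alg M N)) k_cell"
      unfolding is_nat_trans_def using in_B(1) nat by (auto simp: f i k_cell_def)
    moreover have "Comp B (Ta z, eta (a (mu z)), e (a (mu z)) \<bullet> Phi z) (mu z, Ta z, Phi' z)
        = Comp B (k_cell (mu z)) (mu z, mu z, Id X (a (mu z)))" if z: "z \<in> Obj T2X" for z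
    proof -
      note p = inversesD[OF Phi_inverses[OF z]]
      show ?thesis using arrow_assoc[OF p(2,1) inversesD(1)[OF E[OF obj_in(3)[OF z]]]] p(4)
        by (simp add: k_cell_def)
    qed
    ultimately show ?thesis by (simp add: T_transformation_def m i beta_k_cell)
  qed
  show "inverse_cells (carr B_alg) (carr B_alg) (mfun (mor_comp A_alg B_alg M N)) (mfun (mor_id B_alg)) ?g k_cell"
    using inversesD(3,4)[OF E] by (simp add: inverse_cells_def f i k_cell_def)
qed

lemma equivalent_B: "equivalent A_alg B_alg"
  unfolding equivalent_def using pseudomorphism_M pseudomorphism_N NM_iso MN_iso by blast

end

theorem corollary13p6:
  fixes L :: "'g action_operad_data"
    and P :: "('g, 'po, 'pa) cat_operad_data"
    and A :: "('po, 'pa, 'o, 'a) pseudo_alg"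
  assumes "action_operad L"
    and "lambda_operad L P"
    and "lambda_operad.pseudo_algebra L P A"
  shows "\<exists>B :: ('po, 'pa, ('po, 'o) tens, ('po, 'o) tens \<times> ('po, 'o) tens \<times> 'a) pseudo_alg.
    lambda_operad.strict_algebra L P B \<and> lambda_operad.equivalent L P A B"
proof -
  interpret lambda_operad L P by fact
  let ?X = "carr A" and ?al = "str A"
  note ps = assms(3)[unfolded pseudo_algebra_def Let_def]
  obtain Phi' where Phi': "is_nat_trans (Tcat (Tcat ?X)) ?X (ftor_comp ?al (Tmu ?X)) (ftor_comp ?al (Tfun ?X ?al)) Phi'"
    "inverse_cells (Tcat (Tcat ?X)) ?X (ftor_comp ?al (Tfun ?X ?al)) (ftor_comp ?al (Tmu ?X)) (assoc_cell A) Phi'"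
    using ps unfolding is_nat_iso_def by blast
  obtain e' where e': "is_nat_trans ?X ?X (ftor_comp ?al (Teta ?X)) ftor_id e'"
    "inverse_cells ?X ?X ftor_id (ftor_comp ?al (Teta ?X)) (unit_cell A) e'"
    using ps unfolding is_nat_iso_def by blast
  interpret pseudo_alg_cells L P ?X ?al "assoc_cell A" Phi' "unit_cell A" e'
    by (intro pseudo_alg_cells.intro pseudo_alg_cells_axioms.intro lambda_operad_axioms)
      (use ps Phi' e' in \<open>unfold is_nat_iso_def, blast\<close>)+
  have "A_alg = A" by (simp add: A_alg_def)
  with equivalent_B have "equivalent A B_alg" by simp
  with strict_B show ?thesis by blast
qed

end
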